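(* Under the unequal-cluster-size setting in the context (null log-linear model true), for any admissible $\phi_1,\phi_2$, \[ \frac{T^{\phi_1}(\boldsymbol{Y},\widehat{\boldsymbol{\theta}}_{\phi_2})}{\widetilde{\vartheta}_{\widehat{n}^*,N,\phi_2}}\xrightarrow[N\to\infty]{\mathcal{L}}\chi^2_{M-M_0-1},\qquad T^{\phi_1}(\boldsymbol{Y},\widehat{\boldsymbol{\theta}}_{\phi_2})=\frac{2\sum_{g=1}^GN_gn_g}{\phi_1''(1)}d_{\phi_1}\big(\widehat{\boldsymbol{p}},\boldsymbol{p}(\widehat{\boldsymbol{\theta}}_{\phi_2})\big). \]
   Context: Let $M\ge 3$ and $1\le M_0<M-1$. Let $\boldsymbol{W}$ be a real $M\times M_0$ matrix of full column rank whose columns, together with $\boldsymbol{1}_M$, are linearly independent; $\boldsymbol{p}(\boldsymbol{\theta})=\exp\{\boldsymbol{W}\boldsymbol{\theta}\}/(\boldsymbol{1}_M^T\exp\{\boldsymbol{W}\boldsymbol{\theta}\})$ for $\boldsymbol{\theta}\in\mathbb{R}^{M_0}$; $\boldsymbol{D}_{\boldsymbol{p}}=\mathrm{diag}(\boldsymbol{p})$, $\boldsymbol{\Sigma}_{\boldsymbol{p}}=\boldsymbol{D}_{\boldsymbol{p}}-\boldsymbol{p}\boldsymbol{p}^T$. Unequal cluster sizes: there are $G$ groups of clusters; group $g$ contains $N_g$ clusters, each of size $n_g\ge2$ (distinct $n_g$); $N=\sum_{g=1}^G N_g$, and $N_g/N\to N_g^*\in(0,1]$ as $N\to\infty$. The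 cluster frequency vectors $\boldsymbol{Y}^{(g,\ell)}$, $\ell=1,\dots,N_g$, $g=1,\dots,G$, are independent, with nonnegative integer entries summing to $n_g$, identically distributed within each group, $\mathrm{E}[\boldsymbol{Y}^{(g,\ell)}]=n_g\boldsymbol{p}(\boldsymbol{\theta}_0)$, $\mathrm{Var}[\boldsymbol{Y}^{(g,\ell)}]=\vartheta_{n_g}n_g\boldsymbol{\Sigma}_{\boldsymbol{p}(\boldsymbol{\theta}_0)}$, $\vartheta_{n_g}=1+(n_g-1)\rho^2$, $\rho^2\ge0$, $\boldsymbol{\theta}_0$ the unknown true parameter. Let $\boldsymbol{Y}=\sum_g\sum_\ell\boldsymbol{Y}^{(g,\ell)}$, $\widehat{\boldsymbol{p}}=\boldsymbol{Y}/\sum_{h}n_hN_h$, $\widehat{\boldsymbol{p}}^{(g,\ell)}=\boldsymbol{Y}^{(g,\ell)}/n_g$, $\widehat{\boldsymbol{p}}^{(g)}=\frac{1}{n_gN_g}\sum_{\ell=1}^{N_g}\boldsymbol{Y}^{(g,\ell)}$, $w_g=n_gN_g/\sum_hn_hN_h$, $\widehat{n}^*=\sum_gw_gn_g$. Admissible $\phi:(0,\infty)\to\mathbb{R}$: convex, twice continuously differentiable, $\phi(1)=\phi'(1)=0$, $\phi''(1)>0$, conventions $0\phi(0/0)=0$, $0\phi(p/0)=p\lim_{u\to\infty}\phi(u)/u$; $d_\phi(\boldsymbol{p},\boldsymbol{q})=\sum_r q_r\phi(p_r/q_r)$; QM$\phi$E $\widehat{\boldsymbol{\theta}}_\phi=\arg\min_{\boldsymbol{\theta}}d_\phi(\widehat{\boldsymbol{p}},\boldsymbol{p}(\boldsymbol{\theta}))$.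 Semi-parametric design effect estimator: $\widetilde{\vartheta}_{\widehat{n}^*,N,\phi}=\sum_{g=1}^Gw_g\widetilde{\vartheta}_{n_g,N_g,\phi}$, where $\widetilde{\vartheta}_{n_g,N_g,\phi}=\frac{n_g}{(N_g-1)(M-1)}\sum_{r=1}^M\frac{1}{p_r(\widehat{\boldsymbol{\theta}}_\phi)}\sum_{\ell=1}^{N_g}(\widehat{p}^{(g,\ell)}_r-\widehat{p}^{(g)}_r)^2$. *)

theory Defs
  imports "HOL-Probability.Probability" "HOL-Analysis.Gamma_Function"
begin

text \<open>Categories are indexed by r in {..<M}; parameters theta by s in {..<M0}
  (vectors are rendered as functions on nat, only the relevant coordinates matter).\<close>

definition pmodel :: "nat \<Rightarrow> nat \<Rightarrow> (nat \<Rightarrow> nat \<Rightarrow> real) \<Rightarrow> (nat \<Rightarrow> real) \<Rightarrow> nat \<Rightarrow> real" where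
  "pmodel M M0 W \<theta> r =
     exp (\<Sum>s<M0. W r s * \<theta> s) / (\<Sum>r'<M. exp (\<Sum>s<M0. W r' s * \<theta> s))"

definition admissible :: "(real \<Rightarrow> real) \<Rightarrow> bool" where
  "admissible \<phi> \<longleftrightarrow>
     convex_on {0<..} \<phi> \<and>
     (\<forall>x>0. \<phi> differentiable (at x)) \<and>
     (\<forall>x>0. deriv \<phi> differentiable (at x)) \<and>
     continuous_on {0<..} (deriv (deriv \<phi>)) \<and>
     \<phi> 1 = 0 \<and> deriv \<phi> 1 = 0 \<and> deriv (deriv \<phi>) 1 > 0"

text \<open>phi-divergence d_phi(p,q) = sum_r q_r phi(p_r/q_r), with the conventions
  0 phi(0/0) = 0 and 0 phi(p/0) = p lim_{u->inf} phi(u)/u (the latter limit is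
  taken in the extended reals; the second argument of every divergence in the
  theorem is p(theta), which has strictly positive entries, so these conventions are
  never actually invoked).\<close>
definition dphi :: "(real \<Rightarrow> real) \<Rightarrow> nat \<Rightarrow> (nat \<Rightarrow> real) \<Rightarrow> (nat \<Rightarrow> real) \<Rightarrow> ereal" where
  "dphi \<phi> M p q = (\<Sum>r<M.
      (if q r = 0 then (if p r = 0 then 0
                        else ereal (p r) * Lim at_top (\<lambda>u. ereal (\<phi> u / u)))
       else ereal (q r * \<phi> (p r / q r))))"

definition chi2_density :: "nat \<Rightarrow> real \<Rightarrow> real" where
  "chi2_density k x =
     (if x > 0 then x powr (real k / 2 - 1) * exp (- x / 2) / (2 powr (real k / 2) * Gamma (real k / 2))
      else 0)"

definition chi2 :: "nat \<Rightarrow> real measure" where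
  "chi2 k = density lborel (\<lambda>x. ennreal (chi2_density k x))"

end

theory Submission
  imports Defs
begin

text \<open>
  Near the true cell probabilities every \<open>\<phi>\<close>-divergence agrees to second order with the
  Pearson quadratic form, so \<open>T\<close> is asymptotically the squared (weighted) distance of the empirical
  frequencies to the model surface. Minimality of the estimator, compared with the tangential
  projection as a competitor, sandwiches this distance between quantities equivalent to the squared
  distance to the tangent space; no implicit function theorem is needed. That squared distance is
  \<open>|Z|\<^sup>2\<close> for \<open>M - M0 - 1\<close> linear statistics whose covariance matrix is the limiting design
  effect times the identity, and the design effect estimator converges to the same factor.

  The law of \<open>|Z|\<^sup>2\<close> is identified through Laplace transforms: \<open>exp (- s |z|\<^sup>2)\<close> is a Gaussian
  average of characters, which reduces everything to one-dimensional characteristic functions.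
\<close>

section \<open>Orthonormal systems in coordinate space\<close>

text \<open>In the coordinates \<open>(x r - p0 r) / sqrt (p0 r)\<close> the Pearson form is the
  Euclidean norm, and each cluster covariance is a multiple of the identity minus the projection
  onto the vector \<open>sqrt (p0 r)\<close>. On the orthogonal complement of this vector and of the
  \<open>M0\<close> weighted columns of \<open>W\<close> the covariance is scalar. That explains
  both the \<open>M - M0 - 1\<close> statistics and why a single design effect can normalise them.

  The log-linear form supplies the two sides of the sandwich. The tangential coefficients of the
  data are themselves the parameter of a competitor. Conversely,
  \<open>ln (pm \<theta> r / p0 r)\<close> is exactly a constant plus a combination of columns of
  \<open>W\<close>, so the logarithm flattens the model and only the error of \<open>exp z\<close>
  against \<open>1 + z\<close> has to be controlled.

  A further obstacle is that the divergence may have no minimiser at some sample points, since the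
  parameter space is unbounded and cells may be empty. Existence is proved for frequencies close to
  \<open>p0\<close> only: competitors at least as good as \<open>\<theta>0\<close> stay in a fixed
  box.\<close>

definition dotp :: "nat \<Rightarrow> (nat \<Rightarrow> real) \<Rightarrow> (nat \<Rightarrow> real) \<Rightarrow> real" where
  "dotp M f g = (\<Sum>r<M. f r * g r)"

definition orthonormal :: "nat \<Rightarrow> nat \<Rightarrow> (nat \<Rightarrow> nat \<Rightarrow> real) \<Rightarrow> bool" where
  "orthonormal M m e \<longleftrightarrow> (\<forall>i<m. \<forall>j<m. dotp M (e i) (e j) = (if i = j then 1 else 0))"

definition residual :: "nat \<Rightarrow> nat \<Rightarrow> (nat \<Rightarrow> nat \<Rightarrow> real) \<Rightarrow> (nat \<Rightarrow> real) \<Rightarrow> nat \<Rightarrow> real" where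
  "residual M m e y r = y r - (\<Sum>j<m. dotp M (e j) y * e j r)"

lemma dotp_commute: "dotp M f g = dotp M g f"
  by (simp add: dotp_def mult.commute)

lemma dotp_cong: "(\<And>r. r < M \<Longrightarrow> g r = h r) \<Longrightarrow> dotp M f g = dotp M f h"
  by (simp add: dotp_def)

lemma dotp_diff_right: "dotp M f (\<lambda>r. g r - h r) = dotp M f g - dotp M f h"
  by (simp add: dotp_def algebra_simps sum_subtractf)

lemma dotp_sum_right: "dotp M f (\<lambda>r. \<Sum>j\<in>A. c j * g j r) = (\<Sum>j\<in>A. c j * dotp M f (g j))"
proof -
  have "dotp M f (\<lambda>r. \<Sum>j\<in>A. c j * g j r) = (\<Sum>r<M. \<Sum>j\<in>A. c j * (f r * g j r))"
    by (simp add: dotp_def sum_distrib_left algebra_simps)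
  also have "\<dots> = (\<Sum>j\<in>A. c j * dotp M f (g j))"
    by (subst sum.swap) (simp add: dotp_def sum_distrib_left)
  finally show ?thesis .
qed

lemma dotp_scale_right: "dotp M f (\<lambda>r. c * g r) = c * dotp M f g"
  by (simp add: dotp_def sum_distrib_left algebra_simps)

lemma dotp_self_nonneg: "0 \<le> dotp M f f"
  by (simp add: dotp_def sum_nonneg)

lemma dotp_self_eq_0: "dotp M f f = 0 \<longleftrightarrow> (\<forall>r<M. f r = 0)"
  by (auto simp: dotp_def sum_nonneg_eq_0_iff)

lemma dotp_residual:
  assumes "orthonormal M m e" "i < m"
  shows "dotp M (e i) (residual M m e y) = 0"
proof -
  have "dotp M (e i) (residual M m e y) = dotp M (e i) y - (\<Sum>j<m. dotp M (e j) y * dotp M (e i) (e j))"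
    unfolding residual_def dotp_diff_right dotp_sum_right ..
  also have "(\<Sum>j<m. dotp M (e j) y * dotp M (e i) (e j)) = (\<Sum>j<m. if i = j then dotp M (e j) y else 0)"
    using assms by (intro sum.cong) (auto simp: orthonormal_def)
  finally show ?thesis using assms by simp
qed

lemma dotp_residual_self:
  assumes "orthonormal M m e"
  shows "dotp M (residual M m e y) (residual M m e y) = dotp M y y - (\<Sum>j<m. (dotp M (e j) y)\<^sup>2)"
proof -
  let ?z = "residual M m e y"
  have "dotp M ?z ?z = dotp M ?z y - (\<Sum>j<m. dotp M (e j) y * dotp M ?z (e j))"
    by (subst (2) residual_def[abs_def]) (simp only: dotp_diff_right dotp_sum_right)
  also have "(\<Sum>j<m. dotp M (e j) y * dotp M ?z (e j)) = 0"
    using dotp_residual[OF assms] by (intro sum.neutral) (auto simp: dotp_commute[of M ?z])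
  also have "dotp M ?z y = dotp M y ?z" by (rule dotp_commute)
  also have "dotp M y ?z = dotp M y y - (\<Sum>j<m. dotp M (e j) y * dotp M y (e j))"
    unfolding residual_def dotp_diff_right dotp_sum_right ..
  finally show ?thesis by (simp add: power2_eq_square dotp_commute)
qed

lemma bessel:
  assumes "orthonormal M m e"
  shows "(\<Sum>j<m. (dotp M (e j) y)\<^sup>2) \<le> dotp M y y"
  using dotp_residual_self[OF assms, of y] dotp_self_nonneg[of M "residual M m e y"] by simp

lemma orthonormal_extend:
  assumes e: "orthonormal M m e" and z: "dotp M z z > 0" "\<And>i. i < m \<Longrightarrow> dotp M (e i) z = 0"
  shows "orthonormal M (Suc m) (e(m := (\<lambda>r. z r / sqrt (dotp M z z))))"
proof -
  define c where "c = 1 / sqrt (dotp M z z)"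
  have c: "(\<lambda>r. z r / sqrt (dotp M z z)) = (\<lambda>r. c * z r)" by (auto simp: c_def)
  have "dotp M (\<lambda>r. c * z r) (\<lambda>r. c * z r) = c * c * dotp M z z"
    by (simp add: dotp_def sum_distrib_left algebra_simps)
  also have "\<dots> = 1" using z(1) by (simp add: c_def)
  finally have 1: "dotp M (\<lambda>r. c * z r) (\<lambda>r. c * z r) = 1" .
  have 2: "dotp M (e i) (\<lambda>r. c * z r) = 0" "dotp M (\<lambda>r. c * z r) (e i) = 0" if "i < m" for i
    using z(2)[OF that] dotp_scale_right[of M "e i" c z] by (simp_all add: dotp_commute[of M _ "e i"])
  show ?thesis
    using e 1 2 unfolding orthonormal_def c by (auto simp: less_Suc_eq)
qed

section \<open>Row sums of squares and completion to an orthonormal basis\<close>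

lemma sum_dotp_delta:
  assumes "r < M" shows "dotp M f (\<lambda>r'. if r' = r then 1 else 0) = f r"
  using assms by (simp add: dotp_def if_distrib sum.delta cong: if_cong)

lemma orthonormal_sum_squares:
  assumes "orthonormal M m e"
  shows "(\<Sum>r<M. \<Sum>j<m. (e j r)\<^sup>2) = real m"
proof -
  have "(\<Sum>r<M. \<Sum>j<m. (e j r)\<^sup>2) = (\<Sum>j<m. dotp M (e j) (e j))"
    by (subst sum.swap) (simp add: dotp_def power2_eq_square)
  thus ?thesis using assms by (simp add: orthonormal_def)
qed

lemma orthonormal_coordinate_le_1:
  assumes "orthonormal M m e" "r < M"
  shows "(\<Sum>j<m. (e j r)\<^sup>2) \<le> 1"
  using bessel[OF assms(1), of "\<lambda>r'. if r' = r then 1 else 0"] assms(2)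
  by (simp add: sum_dotp_delta)

text \<open>The squares \<open>(e j r)\<^sup>2\<close> add up to \<open>m\<close> in total and to at
  most 1 in each of the \<open>M\<close> rows.\<close>

lemma orthonormal_card_le: "orthonormal M m e \<Longrightarrow> m \<le> M"
  using orthonormal_sum_squares[of M m e] sum_mono[of "{..<M}" "\<lambda>r. \<Sum>j<m. (e j r)\<^sup>2" "\<lambda>_. 1"]
    orthonormal_coordinate_le_1[of M m e] by simp

text \<open>With \<open>M\<close> vectors the \<open>M\<close> row sums, each at most 1, total
  \<open>M\<close>, so each equals 1. Bessel's inequality is then an equality for every coordinate
  vector, whose residual therefore vanishes; linearity gives the expansion of
  \<open>y\<close>.\<close>

lemma orthonormal_complete:
  assumes e: "orthonormal M M e" and r: "r < M"
  shows "y r = (\<Sum>j<M. dotp M (e j) y * e j r)"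
proof -
  have eq1: "(\<Sum>j<M. (e j s)\<^sup>2) = 1" if "s < M" for s
  proof -
    have "(\<Sum>s<M. 1 - (\<Sum>j<M. (e j s)\<^sup>2)) = 0"
      using orthonormal_sum_squares[OF e] by (simp add: sum_subtractf)
    hence "\<forall>s\<in>{..<M}. 1 - (\<Sum>j<M. (e j s)\<^sup>2) = 0"
      using orthonormal_coordinate_le_1[OF e] by (subst (asm) sum_nonneg_eq_0_iff) auto
    thus ?thesis using that by auto
  qed
  let ?d = "\<lambda>s t. if t = s then 1 else (0::real)"
  have delta: "?d s t = (\<Sum>j<M. e j s * e j t)" if "s < M" "t < M" for s t
  proof -
    have "dotp M (residual M M e (?d s)) (residual M M e (?d s)) = 0"
      using that eq1[of s] sum_dotp_delta[of s M]
      by (subst dotp_residual_self[OF e]) auto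
    hence "residual M M e (?d s) t = 0"
      using that by (auto simp: dotp_self_eq_0)
    thus ?thesis using that by (simp add: residual_def sum_dotp_delta)
  qed
  have "(\<Sum>j<M. dotp M (e j) y * e j r) = (\<Sum>j<M. \<Sum>s<M. y s * (e j s * e j r))"
    by (simp add: dotp_def sum_distrib_right sum_distrib_left mult_ac)
  also have "\<dots> = (\<Sum>s<M. y s * (\<Sum>j<M. e j s * e j r))"
    by (subst sum.swap) (simp add: sum_distrib_left)
  also have "\<dots> = (\<Sum>s<M. y s * ?d s r)"
    using r by (intro sum.cong) (auto simp: delta)
  also have "\<dots> = y r" using r by (simp add: if_distrib sum.delta cong: if_cong)
  finally show ?thesis by simp
qed

lemma orthonormal_extend_complete:
  assumes "orthonormal M m e"
  shows "\<exists>e'. orthonormal M M e' \<and> (\<forall>j<m. e' j = e j)"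
proof -
  have "m \<le> M" using assms by (rule orthonormal_card_le)
  thus ?thesis using assms
  proof (induction m arbitrary: e rule: inc_induct)
    case base
    thus ?case by blast
  next
    case (step m)
    \<comment> \<open>For \<open>m < M\<close> the row sums total less than \<open>M\<close>, so
      some row stays below 1. The residual of that coordinate vector is then nonzero and,
      normalised, becomes the next basis vector.\<close>
    have "\<exists>r<M. (\<Sum>j<m. (e j r)\<^sup>2) < 1"
    proof (rule ccontr)
      assume "\<not> ?thesis"
      hence "(\<Sum>r<M. 1) \<le> (\<Sum>r<M. \<Sum>j<m. (e j r)\<^sup>2)" by (intro sum_mono) force
      thus False using orthonormal_sum_squares[OF step.prems] step.hyps by simp
    qed
    then obtain r where r: "r < M" "(\<Sum>j<m. (e j r)\<^sup>2) < 1" by blast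
    define z where "z = residual M m e (\<lambda>r'. if r' = r then 1 else 0)"
    have "dotp M z z > 0"
      using r unfolding z_def dotp_residual_self[OF step.prems]
      by (simp add: sum_dotp_delta)
    from orthonormal_extend[OF step.prems this dotp_residual[OF step.prems, of _ "\<lambda>r'. if r' = r then 1 else 0", folded z_def]]
    have "orthonormal M (Suc m) (e(m := (\<lambda>r. z r / sqrt (dotp M z z))))" by simp
    from step.IH[OF this] obtain e' where e': "orthonormal M M e'"
      "\<forall>j<Suc m. e' j = (e(m := (\<lambda>r. z r / sqrt (dotp M z z)))) j" by blast
    have "e' j = e j" if "j < m" for j using e'(2)[rule_format, of j] that by simp
    thus ?case using e'(1) by blast
  qed
qed

text \<open>Coefficients are kept in both directions: \<open>d\<close> writes each
  \<open>e j\<close> through the \<open>u i\<close>, and the last clause writes each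
  \<open>u i\<close> back through the \<open>e j\<close>. The matrix \<open>d\<close> is what later
  turns coordinates in \<open>e\<close> into coefficients of the original vectors.\<close>

lemma gram_schmidt:
  assumes "\<forall>c. (\<forall>r<M. (\<Sum>i<m. c i * u i r) = 0) \<longrightarrow> (\<forall>i<m. c i = 0)"
  shows "\<exists>e d. orthonormal M m e \<and> (\<forall>j<m. \<forall>r. e j r = (\<Sum>i<m. d j i * u i r))
           \<and> (\<forall>i<m. \<forall>r<M. u i r = (\<Sum>j<m. dotp M (e j) (u i) * e j r))"
  using assms
proof (induction m)
  case 0
  show ?case by (auto simp: orthonormal_def)
next
  case (Suc m)
  have indep: "\<forall>i<m. c i = 0" if c: "\<forall>r<M. (\<Sum>i<m. c i * u i r) = 0" for c
  proof -
    have "\<forall>i<Suc m. (c(m := 0)) i = 0"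
      using Suc.prems[rule_format, of "c(m := 0)"] c by simp
    thus ?thesis by (metis fun_upd_other less_Suc_eq nat_neq_iff)
  qed
  have "\<forall>c. (\<forall>r<M. (\<Sum>i<m. c i * u i r) = 0) \<longrightarrow> (\<forall>i<m. c i = 0)"
    using indep by simp
  from Suc.IH[OF this] obtain e d where ed: "orthonormal M m e"
    "\<forall>j<m. \<forall>r. e j r = (\<Sum>i<m. d j i * u i r)"
    "\<forall>i<m. \<forall>r<M. u i r = (\<Sum>j<m. dotp M (e j) (u i) * e j r)"
    by (elim exE conjE)
  note e = ed(1) and d = ed(2)[rule_format] and u = ed(3)[rule_format]
  define z where "z = residual M m e (u m)"
  define c where "c i = - (\<Sum>j<m. dotp M (e j) (u m) * d j i)" for i
  have z: "z r = u m r + (\<Sum>i<m. c i * u i r)" for r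
  proof -
    have "(\<Sum>j<m. dotp M (e j) (u m) * e j r) = (\<Sum>j<m. \<Sum>i<m. dotp M (e j) (u m) * d j i * u i r)"
      by (intro sum.cong) (auto simp: d sum_distrib_left algebra_simps)
    also have "\<dots> = - (\<Sum>i<m. c i * u i r)"
      by (subst sum.swap) (simp add: c_def sum_distrib_right sum_negf)
    finally show ?thesis by (simp add: z_def residual_def)
  qed
  \<comment> \<open>\<open>z\<close> is a combination of the \<open>u i\<close> with coefficient 1
    at \<open>u m\<close>, so its vanishing would contradict independence.\<close>
  have "dotp M z z \<noteq> 0"
  proof
    assume "dotp M z z = 0"
    hence "\<forall>r<M. (\<Sum>i<Suc m. (c(m := 1)) i * u i r) = 0"
      by (simp add: dotp_self_eq_0 z add.commute)
    with Suc.prems have "\<forall>i<Suc m. (c(m := 1)) i = 0" by blast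
    thus False by auto
  qed
  hence pos: "dotp M z z > 0" using dotp_self_nonneg[of M z] by simp
  define w where "w = (\<lambda>r. z r / sqrt (dotp M z z))"
  have orth: "dotp M (e i) z = 0" if "i < m" for i
    using dotp_residual[OF e that] by (simp add: z_def)
  have e': "orthonormal M (Suc m) (e(m := w))"
    unfolding w_def by (rule orthonormal_extend[OF e pos orth])
  let ?e = "e(m := w)"
  have wu: "dotp M w (u i) = 0" if "i < m" for i
  proof -
    have "dotp M w (u i) = dotp M w (\<lambda>r. \<Sum>j<m. dotp M (e j) (u i) * e j r)"
      by (rule dotp_cong) (rule u[OF that])
    also have "\<dots> = (\<Sum>j<m. dotp M (e j) (u i) * dotp M w (e j))" by (rule dotp_sum_right)
    also have "\<dots> = 0"
    proof (intro sum.neutral ballI)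
      fix j assume j: "j \<in> {..<m}"
      have "dotp M ((e(m := w)) m) ((e(m := w)) j) = 0"
        using e'[unfolded orthonormal_def, rule_format, of m j] j by simp
      thus "dotp M (e j) (u i) * dotp M w (e j) = 0" using j by simp
    qed
    finally show ?thesis .
  qed
  have zz: "dotp M z z = dotp M z (u m)"
  proof -
    have "dotp M z z = dotp M z (u m) - (\<Sum>j<m. dotp M (e j) (u m) * dotp M z (e j))"
      by (subst (2) z_def) (simp only: residual_def[abs_def] dotp_diff_right dotp_sum_right)
    also have "(\<Sum>j<m. dotp M (e j) (u m) * dotp M z (e j)) = 0"
      using orth by (intro sum.neutral) (auto simp: dotp_commute[of M z])
    finally show ?thesis by simp
  qed
  have um: "u m r = (\<Sum>j<Suc m. dotp M (?e j) (u m) * ?e j r)" for r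
  proof -
    have "dotp M w (u m) * w r = dotp M z (u m) * (z r / dotp M z z)"
    proof -
      have "w = (\<lambda>r. 1 / sqrt (dotp M z z) * z r)" by (simp add: w_def fun_eq_iff)
      hence "dotp M w (u m) = 1 / sqrt (dotp M z z) * dotp M z (u m)"
        using dotp_scale_right[of M "u m" "1 / sqrt (dotp M z z)" z]
        by (simp only: dotp_commute[of M _ "u m"])
      moreover have "w r = z r / sqrt (dotp M z z)" by (simp add: w_def)
      ultimately have "dotp M w (u m) * w r
          = dotp M z (u m) * z r / (sqrt (dotp M z z) * sqrt (dotp M z z))" by simp
      thus ?thesis using pos by simp
    qed
    also have "\<dots> = z r" using zz pos by simp
    finally show ?thesis by (simp add: z_def residual_def)
  qed
  have ex: "\<exists>d'. \<forall>r. ?e j r = (\<Sum>i<Suc m. d' i * u i r)" if "j < Suc m" for j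
  proof (cases "j = m")
    case True
    show ?thesis
    proof (intro exI[of _ "\<lambda>i. (c(m := 1)) i / sqrt (dotp M z z)"] allI)
      fix r
      have "w r = (\<Sum>i<Suc m. (c(m:=1)) i * u i r) / sqrt (dotp M z z)"
        by (simp add: w_def z)
      also have "\<dots> = (\<Sum>i<Suc m. (c(m := 1)) i / sqrt (dotp M z z) * u i r)"
        unfolding sum_divide_distrib by (rule sum.cong) auto
      finally show "?e j r = (\<Sum>i<Suc m. (c(m := 1)) i / sqrt (dotp M z z) * u i r)"
        using True by simp
    qed
  next
    case False
    thus ?thesis using that by (intro exI[of _ "(d j)(m := 0)"]) (simp add: d)
  qed
  then obtain d' where d': "\<forall>j<Suc m. \<forall>r. ?e j r = (\<Sum>i<Suc m. d' j i * u i r)" by metis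
  have "\<forall>i<Suc m. \<forall>r<M. u i r = (\<Sum>j<Suc m. dotp M (?e j) (u i) * ?e j r)"
  proof (intro allI impI)
    fix i r assume "i < Suc m" "r < M"
    thus "u i r = (\<Sum>j<Suc m. dotp M (?e j) (u i) * ?e j r)"
      using um u wu by (cases "i = m") auto
  qed
  with e' d' show ?case by (intro exI[of _ ?e] exI[of _ d'] conjI)
qed

text \<open>The \<open>u i\<close> are not orthogonal, so their coefficients in \<open>y\<close>
  need dual vectors. Expanding \<open>y\<close> in a completed orthonormal basis and rewriting the
  first \<open>m\<close> basis vectors through \<open>u\<close> shows that they are inner products
  with the fixed vectors \<open>C i\<close>; in particular they depend linearly on
  \<open>y\<close>.\<close>

lemma orthonormal_complement:
  assumes indep: "\<forall>c. (\<forall>r<M. (\<Sum>i<m. c i * u i r) = 0) \<longrightarrow> (\<forall>i<m. c i = 0)"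
  shows "\<exists>b C. orthonormal M (M - m) b \<and> (\<forall>j<M - m. \<forall>i<m. dotp M (b j) (u i) = 0)
     \<and> (\<forall>y. \<forall>r<M. y r = (\<Sum>i<m. dotp M (C i) y * u i r) + (\<Sum>j<M - m. dotp M (b j) y * b j r))"
proof -
  obtain e d where ed: "orthonormal M m e"
    "\<forall>j<m. \<forall>r. e j r = (\<Sum>i<m. d j i * u i r)"
    "\<forall>i<m. \<forall>r<M. u i r = (\<Sum>j<m. dotp M (e j) (u i) * e j r)"
    using gram_schmidt[OF indep] by (elim exE conjE)
  note e = ed(1) and d = ed(2)[rule_format] and u = ed(3)[rule_format]
  obtain e' where e': "orthonormal M M e'" "\<And>j. j < m \<Longrightarrow> e' j = e j"
    using orthonormal_extend_complete[OF e] by blast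
  \<comment> \<open>This makes the truncated difference \<open>M - m\<close> a true one.\<close>
  have mM: "m \<le> M" using e by (rule orthonormal_card_le)
  define b where "b j = e' (m + j)" for j
  define C where "C i = (\<lambda>r. \<Sum>j<m. d j i * e j r)" for i
  have "orthonormal M (M - m) b"
    unfolding orthonormal_def b_def
    using e'(1)[unfolded orthonormal_def, rule_format] by simp
  moreover have "dotp M (b j) (u i) = 0" if "j < M - m" "i < m" for i j
  proof -
    have "dotp M (b j) (u i) = dotp M (b j) (\<lambda>r. \<Sum>k<m. dotp M (e k) (u i) * e k r)"
      by (rule dotp_cong) (rule u[OF that(2)])
    also have "\<dots> = (\<Sum>k<m. dotp M (e k) (u i) * dotp M (b j) (e k))" by (rule dotp_sum_right)
    also have "\<dots> = 0"
    proof (intro sum.neutral ballI)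
      fix k assume k: "k \<in> {..<m}"
      have "dotp M (e' (m + j)) (e' k) = 0"
        using e'(1)[unfolded orthonormal_def, rule_format, of "m + j" k] that k by simp
      thus "dotp M (e k) (u i) * dotp M (b j) (e k) = 0" using k e'(2) by (simp add: b_def)
    qed
    finally show ?thesis .
  qed
  moreover have "y r = (\<Sum>i<m. dotp M (C i) y * u i r) + (\<Sum>j<M - m. dotp M (b j) y * b j r)"
    if r: "r < M" for y r
  proof -
    have Ci: "dotp M (C i) y = (\<Sum>j<m. d j i * dotp M (e j) y)" for i
      unfolding C_def dotp_commute[of M _ y] dotp_sum_right ..
    have "y r = (\<Sum>j<M. dotp M (e' j) y * e' j r)" by (rule orthonormal_complete[OF e'(1) r])
    also have "{..<M} = {..<m} \<union> (\<lambda>j. m + j) ` {..<M - m}"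
    proof (intro equalityI subsetI)
      fix i assume "i \<in> {..<M}"
      thus "i \<in> {..<m} \<union> (\<lambda>j. m + j) ` {..<M - m}"
        by (cases "i < m") (auto intro!: image_eqI[of _ _ "i - m"])
    qed (use mM in auto)
    also have "(\<Sum>j\<in>\<dots>. dotp M (e' j) y * e' j r)
      = (\<Sum>j<m. dotp M (e' j) y * e' j r) + (\<Sum>j\<in>(\<lambda>j. m + j) ` {..<M - m}. dotp M (e' j) y * e' j r)"
      by (intro sum.union_disjoint) auto
    also have "(\<Sum>j\<in>(\<lambda>j. m + j) ` {..<M - m}. dotp M (e' j) y * e' j r) = (\<Sum>j<M - m. dotp M (b j) y * b j r)"
      by (subst sum.reindex) (auto simp: b_def)
    also have "(\<Sum>j<m. dotp M (e' j) y * e' j r) = (\<Sum>j<m. \<Sum>i<m. d j i * dotp M (e j) y * u i r)"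
    proof (intro sum.cong refl)
      fix j assume "j \<in> {..<m}"
      hence "dotp M (e' j) y * e' j r = dotp M (e j) y * (\<Sum>i<m. d j i * u i r)"
        using e'(2)[of j] d[of j r] by simp
      thus "dotp M (e' j) y * e' j r = (\<Sum>i<m. d j i * dotp M (e j) y * u i r)"
        by (simp add: sum_distrib_left mult_ac)
    qed
    also have "\<dots> = (\<Sum>i<m. dotp M (C i) y * u i r)"
      by (subst sum.swap) (simp add: Ci sum_distrib_right)
    finally show ?thesis .
  qed
  ultimately show ?thesis by (intro exI[of _ b] exI[of _ C]) simp
qed

lemma orthonormal_norm_combination:
  assumes "orthonormal M k b"
  shows "(\<Sum>r<M. (\<Sum>i<k. \<beta> i * b i r)\<^sup>2) = (\<Sum>i<k. (\<beta> i)\<^sup>2)"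
proof -
  let ?f = "\<lambda>r. \<Sum>i<k. \<beta> i * b i r"
  have "(\<Sum>r<M. (?f r)\<^sup>2) = dotp M ?f ?f" by (simp add: dotp_def power2_eq_square)
  also have "\<dots> = (\<Sum>i<k. \<beta> i * dotp M ?f (b i))" by (rule dotp_sum_right)
  also have "\<dots> = (\<Sum>i<k. (\<beta> i)\<^sup>2)"
  proof (rule sum.cong[OF refl])
    fix i assume i: "i \<in> {..<k}"
    have "dotp M ?f (b i) = (\<Sum>l<k. \<beta> l * dotp M (b i) (b l))"
      unfolding dotp_commute[of M _ "b i"] by (rule dotp_sum_right)
    also have "\<dots> = (\<Sum>l<k. if i = l then \<beta> l else 0)"
      using assms i by (intro sum.cong) (auto simp: orthonormal_def)
    also have "\<dots> = \<beta> i" using i by simp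
    finally show "\<beta> i * dotp M ?f (b i) = (\<beta> i)\<^sup>2" by (simp add: power2_eq_square)
  qed
  finally show ?thesis .
qed

section \<open>Chi-square limits through Laplace transforms\<close>

lemma chi2_density_measurable [measurable]: "chi2_density k \<in> borel_measurable borel"
  unfolding chi2_density_def by measurable

text \<open>Rescaling by \<open>c = s + 1 / 2\<close> merges the two exponentials into
  \<open>exp (- x)\<close> and leaves a Gamma integral. The case \<open>s = 0\<close> is the
  normalisation of the density.\<close>

lemma nn_integral_exp_chi2_density:
  assumes k: "k \<ge> 1" and s: "s \<ge> (0::real)"
  shows "(\<integral>\<^sup>+x. ennreal (exp (- s * x) * chi2_density k x) \<partial>lborel) = ennreal ((1 + 2 * s) powr (- real k / 2))"
proof -
  define a where "a = real k / 2"
  define c where "c = s + 1 / 2"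
  have a: "a > 0" and c: "c > 0" using k s by (auto simp: a_def c_def)
  have G: "Gamma a > 0" using a by (rule Gamma_real_pos)
  define K where "K = c powr (1 - a) / (2 powr a * Gamma a)"
  have "(\<integral>\<^sup>+x. ennreal (exp (- s * x) * chi2_density k x) \<partial>lborel)
      = ennreal \<bar>1 / c\<bar> * (\<integral>\<^sup>+x. ennreal (exp (- s * (0 + 1 / c * x)) * chi2_density k (0 + 1 / c * x)) \<partial>lborel)"
    using c by (intro nn_integral_real_affine) auto
  also have "(\<integral>\<^sup>+x. ennreal (exp (- s * (0 + 1 / c * x)) * chi2_density k (0 + 1 / c * x)) \<partial>lborel)
      = (\<integral>\<^sup>+x. ennreal K * ennreal (indicator {0..} x * x powr (a - 1) / exp x) \<partial>lborel)"
  proof (intro nn_integral_cong)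
    fix x :: real
    have "exp (- s * (x / c)) * chi2_density k (x / c) = K * (indicator {0..} x * x powr (a - 1) / exp x)"
    proof (cases "x > 0")
      case True
      have "s * (x / c) + x / c / 2 = c * (x / c)" unfolding c_def distrib_right by simp
      also have "\<dots> = x" using c by simp
      finally have "s * (x / c) + x / c / 2 = x" .
      hence "exp (- s * (x / c)) * exp (- (x / c) / 2) = 1 / exp x"
        by (simp add: exp_add[symmetric] exp_minus[symmetric] field_simps)
      moreover have "(x / c) powr (a - 1) = x powr (a - 1) * c powr (1 - a)"
        using True c by (simp add: powr_divide powr_diff)
      moreover have "chi2_density k (x / c) = (x / c) powr (a - 1) * exp (- (x / c) / 2) / (2 powr a * Gamma a)"
        using True c by (simp add: chi2_density_def a_def)
      moreover have "A * (B * C / D) = B * (A * C) / D" for A B C D :: real by simp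
      ultimately have "exp (- s * (x / c)) * chi2_density k (x / c)
          = x powr (a - 1) * c powr (1 - a) * (1 / exp x) / (2 powr a * Gamma a)"
        by (simp only:)
      thus ?thesis using True by (simp add: K_def mult_ac)
    next
      case False
      thus ?thesis using c by (auto simp: chi2_density_def indicator_def zero_less_divide_iff)
    qed
    thus "ennreal (exp (- s * (0 + 1 / c * x)) * chi2_density k (0 + 1 / c * x))
        = ennreal K * ennreal (indicator {0..} x * x powr (a - 1) / exp x)"
      using G by (subst ennreal_mult'[symmetric]) (auto simp: K_def)
  qed
  also have "\<dots> = ennreal K * ennreal (Gamma a)"
    using a by (subst nn_integral_cmult) (auto simp: Gamma_conv_nn_integral_real)
  also have "ennreal \<bar>1 / c\<bar> * (ennreal K * ennreal (Gamma a)) = ennreal (1 / c * K * Gamma a)"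
  proof -
    have "K \<ge> 0" using c G by (simp add: K_def)
    thus ?thesis using c G by (simp add: ennreal_mult'[symmetric] del: times_divide_eq_right times_divide_eq_left)
  qed
  also have "1 / c * K * Gamma a = (2 * c) powr (- a)"
    using c G by (simp add: K_def powr_mult powr_minus powr_diff field_simps)
  also have "(2 * c) powr (- a) = (1 + 2 * s) powr (- real k / 2)"
    by (simp add: c_def a_def add.commute)
  finally show ?thesis .
qed

lemma chi2_density_nonneg: "k \<ge> 1 \<Longrightarrow> chi2_density k x \<ge> 0"
  using Gamma_real_pos[of "real k / 2"] by (auto simp: chi2_density_def)

lemma real_distribution_chi2:
  assumes "k \<ge> 1"
  shows "real_distribution (chi2 k)"
proof -
  have "emeasure (chi2 k) UNIV = 1"
    using nn_integral_exp_chi2_density[OF assms, of 0]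
    by (simp add: chi2_def emeasure_density)
  hence "prob_space (chi2 k)" by (intro prob_spaceI) (simp add: chi2_def)
  thus ?thesis by (simp add: real_distribution_def real_distribution_axioms_def chi2_def)
qed

lemma AE_chi2_nonneg: "AE x in chi2 k. x \<ge> 0"
  unfolding chi2_def by (subst AE_density) (auto simp: chi2_density_def split: if_splits)

lemma chi2_laplace:
  assumes k: "k \<ge> 1" and s: "s \<ge> 0"
  shows "(\<integral>x. exp (- s * x) \<partial>chi2 k) = (1 + 2 * s) powr (- real k / 2)"
proof -
  have "(\<integral>x. exp (- s * x) \<partial>chi2 k) = (\<integral>x. exp (- s * x) * chi2_density k x \<partial>lborel)"
    unfolding chi2_def using chi2_density_nonneg[OF k]
    by (subst integral_density) (auto simp: mult.commute)
  also have "\<dots> = enn2real (\<integral>\<^sup>+x. ennreal (exp (- s * x) * chi2_density k x) \<partial>lborel)"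
    using chi2_density_nonneg[OF k] by (intro integral_eq_nn_integral) auto
  finally show ?thesis unfolding nn_integral_exp_chi2_density[OF assms] by simp
qed

text \<open>The integrand is \<open>\<sigma>\<close> times the centred normal density of variance
  \<open>1 / (1 + 2 * s)\<close>, so the integral is \<open>\<sigma>\<close>.\<close>

lemma std_normal_exp_square:
  assumes s: "s \<ge> 0"
  shows "(\<integral>x. exp (- s * x\<^sup>2) \<partial>std_normal_distribution) = (1 + 2 * s) powr (- 1 / 2)"
proof -
  define \<sigma> where "\<sigma> = 1 / sqrt (1 + 2 * s)"
  have \<sigma>2: "\<sigma>\<^sup>2 = 1 / (1 + 2 * s)" and \<sigma>: "\<sigma> > 0" using s by (auto simp: \<sigma>_def power_divide)
  have "(\<integral>x. exp (- s * x\<^sup>2) \<partial>std_normal_distribution) = (\<integral>x. std_normal_density x * exp (- s * x\<^sup>2) \<partial>lborel)"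
    by (subst integral_density) auto
  also have "\<dots> = (\<integral>x. \<sigma> * normal_density 0 \<sigma> x \<partial>lborel)"
  proof (intro Bochner_Integration.integral_cong refl)
    fix x :: real
    have "exp (- x\<^sup>2 / 2) * exp (- s * x\<^sup>2) = exp (- x\<^sup>2 / (2 * \<sigma>\<^sup>2))"
      using s by (simp add: exp_add[symmetric] \<sigma>2 field_simps)
    thus "std_normal_density x * exp (- s * x\<^sup>2) = \<sigma> * normal_density 0 \<sigma> x"
      using \<sigma> by (simp add: normal_density_def real_sqrt_mult)
  qed
  also have "\<dots> = \<sigma>" using \<sigma> by simp
  also have "\<dots> = (1 + 2 * s) powr (- 1 / 2)"
    using s by (simp add: \<sigma>_def powr_minus powr_half_sqrt field_simps)
  finally show ?thesis .
qed

section \<open>Gaussian averages of exponentials and characters\<close>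

abbreviation gauss :: "nat \<Rightarrow> (nat \<Rightarrow> real) measure" where
  "gauss k \<equiv> Pi\<^sub>M {..<k} (\<lambda>_. std_normal_distribution)"

lemma product_sigma_finite_normal: "product_sigma_finite (\<lambda>_::nat. std_normal_distribution)"
  using real_dist_normal_dist
  by (simp add: product_sigma_finite_def real_distribution_def prob_space_imp_sigma_finite)

lemma prob_space_gauss: "prob_space (gauss k)"
  by (intro prob_space_PiM prob_space_normal_density) auto

lemma gauss_component_measurable: "j < k \<Longrightarrow> (\<lambda>\<xi>. \<xi> j) \<in> borel_measurable (gauss k)"
  using measurable_component_singleton[of j "{..<k}" "\<lambda>_. std_normal_distribution"] by simp

text \<open>The value agrees with \<open>chi2_laplace\<close>; this is where the squared norm of a
  standard normal vector is matched with the chi-square law.\<close>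

lemma gauss_exp_square:
  assumes s: "s \<ge> 0"
  shows "(\<integral>\<xi>. exp (- s * (\<Sum>j<k. (\<xi> j)\<^sup>2)) \<partial>gauss k) = (1 + 2 * s) powr (- real k / 2)"
proof -
  interpret product_sigma_finite "\<lambda>_::nat. std_normal_distribution" by (rule product_sigma_finite_normal)
  interpret R: real_distribution std_normal_distribution by (rule real_dist_normal_dist)
  have "(\<integral>\<xi>. exp (- s * (\<Sum>j<k. (\<xi> j)\<^sup>2)) \<partial>gauss k) = (\<integral>\<xi>. (\<Prod>j<k. exp (- s * (\<xi> j)\<^sup>2)) \<partial>gauss k)"
    by (simp add: exp_sum[symmetric] sum_distrib_left sum_negf)
  also have "\<dots> = (\<Prod>j<k. \<integral>x. exp (- s * x\<^sup>2) \<partial>std_normal_distribution)"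
    using s by (intro product_integral_prod R.integrable_const_bound[where B=1]) auto
  also have "\<dots> = ((1 + 2 * s) powr (- 1 / 2)) ^ k"
    using std_normal_exp_square[OF s] by simp
  also have "\<dots> = (1 + 2 * s) powr (- real k / 2)"
    using s by (subst powr_realpow[symmetric]) (auto simp: powr_powr)
  finally show ?thesis .
qed

text \<open>Here \<open>z\<close> plays the role of the data: a Gaussian function of
  \<open>z\<close> becomes an average over \<open>\<xi>\<close> of characters whose phase is linear
  in \<open>z\<close>.\<close>

lemma gauss_char:
  "(\<integral>\<xi>. iexp (\<Sum>j<k. \<xi> j * z j) \<partial>gauss k) = exp (- (\<Sum>j<k. (z j)\<^sup>2) / 2)"
proof -
  interpret product_sigma_finite "\<lambda>_::nat. std_normal_distribution" by (rule product_sigma_finite_normal)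
  interpret R: real_distribution std_normal_distribution by (rule real_dist_normal_dist)
  have "(\<integral>\<xi>. iexp (\<Sum>j<k. \<xi> j * z j) \<partial>gauss k) = (\<integral>\<xi>. (\<Prod>j<k. iexp (z j * \<xi> j)) \<partial>gauss k)"
    by (simp add: exp_sum[symmetric] sum_distrib_left mult_ac)
  also have "\<dots> = (\<Prod>j<k. \<integral>x. iexp (z j * x) \<partial>std_normal_distribution)"
    by (intro product_integral_prod R.integrable_const_bound[where B=1]) auto
  also have "\<dots> = (\<Prod>j<k. char std_normal_distribution (z j))" by (simp add: char_def)
  also have "\<dots> = exp (- (\<Sum>j<k. (z j)\<^sup>2) / 2)"
    unfolding char_std_normal_distribution of_real_prod[symmetric]
    by (simp add: exp_sum[symmetric] sum_divide_distrib sum_negf)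
  finally show ?thesis .
qed

text \<open>\<open>cts_step a b\<close> vanishes beyond \<open>b\<close>, so as a function of
  \<open>u = exp (- x)\<close> it is 0 for \<open>u < exp (- b)\<close> and extends continuously to
  \<open>u = 0\<close>. The test functions of weak convergence thus become continuous functions on a
  compact interval.\<close>

lemma cts_step_eq_exp_minus:
  assumes "a < b"
  obtains f where "continuous_on {0..1} f" "\<And>x. cts_step a b x = f (exp (- x))"
proof
  define f where "f u = (if u \<le> 0 then 0 else cts_step a b (- ln u))" for u :: real
  show "cts_step a b x = f (exp (- x))" for x by (simp add: f_def)
  have ctsc: "isCont (cts_step a b) x" for x
    using cts_step_uniformly_continuous[OF assms]
    by (auto dest!: uniformly_continuous_imp_continuous simp: continuous_on_eq_continuous_at)
  have "isCont f u" if "u \<ge> 0" for u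
  proof (cases "u = 0")
    case True
    have "\<forall>\<^sub>F v in nhds 0. f v = 0"
    proof -
      have "\<forall>\<^sub>F v in nhds (0::real). v < exp (- b)"
        by (intro eventually_nhds_in_open[of "{..<exp (- b)}", simplified]) auto
      thus ?thesis
      proof eventually_elim
        case (elim v)
        show ?case
        proof (cases "v \<le> 0")
          case False
          hence "ln v < ln (exp (- b))" using elim by (subst ln_less_cancel_iff) auto
          hence "- ln v > b" by simp
          thus ?thesis using False assms by (simp add: f_def cts_step_def)
        qed (simp add: f_def)
      qed
    qed
    thus ?thesis using True isCont_cong[of f "\<lambda>_. 0" 0] by simp
  next
    case False
    hence u: "u > 0" using that by simp
    have "\<forall>\<^sub>F v in nhds u. f v = cts_step a b (- ln v)"
      using eventually_nhds_in_open[of "{0<..}" u] u by (auto simp: f_def elim!: eventually_mono)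
    moreover have "isCont (\<lambda>v. cts_step a b (- ln v)) u"
      using u by (intro isCont_o2[OF _ ctsc] continuous_intros) auto
    ultimately show ?thesis using isCont_cong[of f "\<lambda>v. cts_step a b (- ln v)" u] by simp
  qed
  thus "continuous_on {0..1} f" by (intro continuous_at_imp_continuous_on) auto
qed

lemma cts_step_lipschitz:
  assumes "a < b" shows "\<bar>cts_step a b x - cts_step a b y\<bar> \<le> \<bar>x - y\<bar> / (b - a)"
proof -
  have clamp: "cts_step a b z = max 0 (min 1 ((b - z) / (b - a)))" for z
    using assms by (auto simp: cts_step_def max_def min_def field_simps)
  have "\<bar>cts_step a b x - cts_step a b y\<bar> \<le> \<bar>(b - x) / (b - a) - (b - y) / (b - a)\<bar>"
    unfolding clamp by linarith
  also have "(b - x) / (b - a) - (b - y) / (b - a) = (y - x) / (b - a)"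
    unfolding diff_divide_distrib[symmetric] by simp
  also have "\<bar>(y - x) / (b - a)\<bar> = \<bar>x - y\<bar> / (b - a)"
    using assms by (simp add: abs_minus_commute)
  finally show ?thesis .
qed

section \<open>Weak convergence of squared norms\<close>

context prob_space begin

lemma iexp_pairing_measurable:
  assumes "\<And>j. j < k \<Longrightarrow> Z j \<in> borel_measurable M"
  shows "(\<lambda>x. iexp (\<Sum>j<k. c * fst x j * Z j (snd x))) \<in> borel_measurable (gauss k \<Otimes>\<^sub>M M)"
proof -
  have "(\<lambda>x. \<Sum>j<k. c * fst x j * Z j (snd x)) \<in> borel_measurable (gauss k \<Otimes>\<^sub>M M)"
  proof (intro borel_measurable_sum borel_measurable_times borel_measurable_const)
    fix j assume j: "j \<in> {..<k}"
    show "(\<lambda>x. fst x j) \<in> borel_measurable (gauss k \<Otimes>\<^sub>M M)"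
      using j by (intro measurable_compose[OF measurable_fst] gauss_component_measurable) auto
    show "(\<lambda>x. Z j (snd x)) \<in> borel_measurable (gauss k \<Otimes>\<^sub>M M)"
      using j assms by (intro measurable_compose[OF measurable_snd]) auto
  qed
  thus ?thesis by measurable
qed

text \<open>This is \<open>gauss_char\<close> at \<open>sqrt (2 * s) * Z j \<omega>\<close>,
  followed by Fubini. The factor \<open>sqrt (2 * s)\<close> compensates the division by 2 in the
  exponent of \<open>gauss_char\<close>.\<close>

lemma laplace_square_norm_eq:
  assumes [measurable]: "\<And>j. j < k \<Longrightarrow> Z j \<in> borel_measurable M" and s: "s \<ge> 0"
  shows "complex_of_real (expectation (\<lambda>\<omega>. exp (- s * (\<Sum>j<k. (Z j \<omega>)\<^sup>2))))
    = (\<integral>\<xi>. (\<integral>\<omega>. iexp (\<Sum>j<k. sqrt (2 * s) * \<xi> j * Z j \<omega>) \<partial>M) \<partial>gauss k)"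
proof -
  interpret N: prob_space "gauss k" by (rule prob_space_gauss)
  interpret P: pair_prob_space "gauss k" M ..
  have int: "integrable (gauss k \<Otimes>\<^sub>M M) (\<lambda>(\<xi>, \<omega>). iexp (\<Sum>j<k. sqrt (2 * s) * \<xi> j * Z j \<omega>))"
    using iexp_pairing_measurable[OF assms(1)]
    by (intro P.integrable_const_bound[where B=1]) (auto simp: case_prod_beta)
  have "(\<integral>\<xi>. (\<integral>\<omega>. iexp (\<Sum>j<k. sqrt (2 * s) * \<xi> j * Z j \<omega>) \<partial>M) \<partial>gauss k)
     = (\<integral>\<omega>. (\<integral>\<xi>. iexp (\<Sum>j<k. sqrt (2 * s) * \<xi> j * Z j \<omega>) \<partial>gauss k) \<partial>M)"
    using P.Fubini_integral[OF int] by simp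
  also have "\<dots> = (\<integral>\<omega>. complex_of_real (exp (- s * (\<Sum>j<k. (Z j \<omega>)\<^sup>2))) \<partial>M)"
  proof (intro Bochner_Integration.integral_cong refl)
    fix \<omega>
    have "(\<integral>\<xi>. iexp (\<Sum>j<k. sqrt (2 * s) * \<xi> j * Z j \<omega>) \<partial>gauss k)
       = (\<integral>\<xi>. iexp (\<Sum>j<k. \<xi> j * (sqrt (2 * s) * Z j \<omega>)) \<partial>gauss k)" by (simp add: mult_ac)
    also have "\<dots> = exp (- (\<Sum>j<k. (sqrt (2 * s) * Z j \<omega>)\<^sup>2) / 2)" by (rule gauss_char)
    also have "(\<Sum>j<k. (sqrt (2 * s) * Z j \<omega>)\<^sup>2) = 2 * s * (\<Sum>j<k. (Z j \<omega>)\<^sup>2)"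
      using s by (simp add: power_mult_distrib sum_distrib_left)
    finally show "(\<integral>\<xi>. iexp (\<Sum>j<k. sqrt (2 * s) * \<xi> j * Z j \<omega>) \<partial>gauss k)
       = complex_of_real (exp (- s * (\<Sum>j<k. (Z j \<omega>)\<^sup>2)))" by simp
  qed
  finally show ?thesis by simp
qed

text \<open>The inner integrals have modulus at most 1, so dominated convergence carries the
  pointwise limit in \<open>\<xi>\<close> through the Gaussian average. The average of the limit is
  \<open>gauss_exp_square\<close>.\<close>

lemma laplace_square_norm_tendsto:
  assumes [measurable]: "\<And>N j. j < k \<Longrightarrow> Z N j \<in> borel_measurable M" and s: "s \<ge> 0"
    and lim: "\<And>\<xi>. (\<lambda>N. \<integral>\<omega>. iexp (\<Sum>j<k. \<xi> j * Z N j \<omega>) \<partial>M) \<longlonglongrightarrow> exp (- (\<Sum>j<k. (\<xi> j)\<^sup>2) / 2)"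
  shows "(\<lambda>N. expectation (\<lambda>\<omega>. exp (- s * (\<Sum>j<k. (Z N j \<omega>)\<^sup>2)))) \<longlonglongrightarrow> (1 + 2 * s) powr (- real k / 2)"
proof -
  interpret G: prob_space "gauss k" by (rule prob_space_gauss)
  interpret P: pair_prob_space "gauss k" M ..
  let ?F = "\<lambda>N \<xi>. \<integral>\<omega>. iexp (\<Sum>j<k. sqrt (2 * s) * \<xi> j * Z N j \<omega>) \<partial>M"
  have "(\<lambda>N. \<integral>\<xi>. ?F N \<xi> \<partial>gauss k) \<longlonglongrightarrow> (\<integral>\<xi>. complex_of_real (exp (- s * (\<Sum>j<k. (\<xi> j)\<^sup>2))) \<partial>gauss k)"
  proof (rule integral_dominated_convergence[where w="\<lambda>_. 1"])
    show "?F N \<in> borel_measurable (gauss k)" for N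
      using iexp_pairing_measurable[OF assms(1)]
      by (intro borel_measurable_lebesgue_integral) (simp add: case_prod_beta)
    show "(\<lambda>\<xi>. complex_of_real (exp (- s * (\<Sum>j<k. (\<xi> j)\<^sup>2)))) \<in> borel_measurable (gauss k)"
      by (intro measurable_compose[OF _ borel_measurable_of_real] measurable_compose[OF _ borel_measurable_exp]
          borel_measurable_times borel_measurable_sum borel_measurable_power gauss_component_measurable) auto
    show "AE \<xi> in gauss k. (\<lambda>N. ?F N \<xi>) \<longlonglongrightarrow> complex_of_real (exp (- s * (\<Sum>j<k. (\<xi> j)\<^sup>2)))"
    proof (intro AE_I2)
      fix \<xi> :: "nat \<Rightarrow> real"
      have "(\<Sum>j<k. (sqrt (2 * s) * \<xi> j)\<^sup>2) = 2 * s * (\<Sum>j<k. (\<xi> j)\<^sup>2)"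
        using s by (simp add: power_mult_distrib sum_distrib_left)
      thus "(\<lambda>N. ?F N \<xi>) \<longlonglongrightarrow> complex_of_real (exp (- s * (\<Sum>j<k. (\<xi> j)\<^sup>2)))"
        using lim[of "\<lambda>j. sqrt (2 * s) * \<xi> j"] by simp
    qed
    show "AE \<xi> in gauss k. norm (?F N \<xi>) \<le> 1" for N
    proof (intro AE_I2)
      fix \<xi> :: "nat \<Rightarrow> real"
      have "norm (?F N \<xi>) \<le> (\<integral>\<omega>. norm (iexp (\<Sum>j<k. sqrt (2 * s) * \<xi> j * Z N j \<omega>)) \<partial>M)"
        by (rule integral_norm_bound)
      thus "norm (?F N \<xi>) \<le> 1" by (simp add: prob_space)
    qed
  qed simp
  hence "(\<lambda>N. complex_of_real (expectation (\<lambda>\<omega>. exp (- s * (\<Sum>j<k. (Z N j \<omega>)\<^sup>2)))))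
      \<longlonglongrightarrow> complex_of_real ((1 + 2 * s) powr (- real k / 2))"
    using gauss_exp_square[OF s, of k] s
    by (subst laplace_square_norm_eq) auto
  thus ?thesis by (simp only: tendsto_of_real_iff)
qed

text \<open>Convergence of Laplace transforms at the integers is convergence of all moments of
  \<open>exp (- X)\<close>, a variable in the unit interval, so Weierstrass approximation applies.\<close>

lemma laplace_tendsto_imp_integral_tendsto:
  fixes X :: "nat \<Rightarrow> 'a \<Rightarrow> real" and \<nu> :: "real measure" and f :: "real \<Rightarrow> real"
  assumes X [measurable]: "\<And>N. X N \<in> borel_measurable M" and nn: "\<And>N \<omega>. X N \<omega> \<ge> 0"
    and \<nu>: "real_distribution \<nu>" "AE x in \<nu>. x \<ge> 0"
    and lim: "\<And>m::nat. (\<lambda>N. expectation (\<lambda>\<omega>. exp (- real m * X N \<omega>))) \<longlonglongrightarrow> (\<integral>x. exp (- real m * x) \<partial>\<nu>)"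
    and f: "continuous_on {0..1} f"
    and g [measurable]: "g \<in> borel_measurable borel" and fg: "\<And>x. x \<ge> 0 \<Longrightarrow> g x = f (exp (- x))"
  shows "(\<lambda>N. expectation (\<lambda>\<omega>. g (X N \<omega>))) \<longlonglongrightarrow> (\<integral>x. g x \<partial>\<nu>)"
proof (rule LIMSEQ_I)
  fix e :: real assume e: "e > 0"
  interpret \<nu>: real_distribution \<nu> by (rule \<nu>(1))
  obtain B where "\<forall>u\<in>{0..1}. \<bar>f u\<bar> \<le> B"
    using compact_imp_bounded[OF compact_continuous_image[OF f compact_Icc]]
    by (auto simp: bounded_iff)
  hence B: "\<bar>f u\<bar> \<le> B" if "u \<in> {0..1}" for u using that by blast
  obtain h where h: "real_polynomial_function h" "\<And>x. x \<in> {0..1} \<Longrightarrow> \<bar>f x - h x\<bar> < e / 3"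
    using Stone_Weierstrass_real_polynomial_function[OF compact_Icc f, of "e / 3"] e by auto
  obtain a n where hn: "h = (\<lambda>x. \<Sum>i\<le>n. a i * x ^ i)"
    using h(1) unfolding real_polynomial_function_iff_sum by blast
  \<comment> \<open>Inserting \<open>exp (- x)\<close> into the approximating polynomial gives a
    finite combination of Laplace kernels at integers, whose expectations converge by
    \<open>lim\<close>. The two approximation errors and the convergence error each receive
    \<open>e / 3\<close>.\<close>
  define P where "P x = (\<Sum>i\<le>n. a i * exp (- real i * x))" for x
  have hP: "h (exp (- x)) = P x" for x by (simp add: hn P_def exp_of_nat_mult[symmetric])
  have close: "\<bar>g x - P x\<bar> \<le> e / 3" if "x \<ge> 0" for x
    using h(2)[of "exp (- x)"] fg[OF that] that by (simp add: hP)
  have gB: "\<bar>g x\<bar> \<le> B" if "x \<ge> 0" for x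
    using B[of "exp (- x)"] fg[OF that] that by simp
  have intE: "integrable M (\<lambda>\<omega>. exp (- real i * X N \<omega>))" for i N
    using nn by (intro integrable_const_bound[where B=1]) auto
  have intE\<nu>: "integrable \<nu> (\<lambda>x. exp (- real i * x))" for i
    using \<nu>(2) by (intro \<nu>.integrable_const_bound[where B=1]) auto
  have intg: "integrable M (\<lambda>\<omega>. g (X N \<omega>))" for N
    using nn gB by (intro integrable_const_bound[where B=B]) auto
  have intg\<nu>: "integrable \<nu> g"
    using \<nu>(2) gB by (intro \<nu>.integrable_const_bound[where B=B]) auto
  have intP: "integrable M (\<lambda>\<omega>. P (X N \<omega>))" for N
    unfolding P_def using intE by (intro Bochner_Integration.integrable_sum integrable_mult_right) auto
  have intP\<nu>: "integrable \<nu> P"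
    unfolding P_def using intE\<nu> by (intro Bochner_Integration.integrable_sum integrable_mult_right) auto
  have "(\<lambda>N. \<Sum>i\<le>n. a i * expectation (\<lambda>\<omega>. exp (- real i * X N \<omega>)))
     \<longlonglongrightarrow> (\<Sum>i\<le>n. a i * (\<integral>x. exp (- real i * x) \<partial>\<nu>))"
    by (intro tendsto_intros lim)
  also have "(\<lambda>N. \<Sum>i\<le>n. a i * expectation (\<lambda>\<omega>. exp (- real i * X N \<omega>))) = (\<lambda>N. expectation (\<lambda>\<omega>. P (X N \<omega>)))"
    unfolding P_def using intE by (subst Bochner_Integration.integral_sum) auto
  also have "(\<Sum>i\<le>n. a i * (\<integral>x. exp (- real i * x) \<partial>\<nu>)) = (\<integral>x. P x \<partial>\<nu>)"
    unfolding P_def using intE\<nu> by (subst Bochner_Integration.integral_sum) auto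
  finally obtain N0 where N0: "\<And>N. N \<ge> N0 \<Longrightarrow> \<bar>expectation (\<lambda>\<omega>. P (X N \<omega>)) - (\<integral>x. P x \<partial>\<nu>)\<bar> < e / 3"
    using e by (force dest: LIMSEQ_D[of _ _ "e / 3"])
  show "\<exists>N0. \<forall>N\<ge>N0. norm (expectation (\<lambda>\<omega>. g (X N \<omega>)) - (\<integral>x. g x \<partial>\<nu>)) < e"
  proof (intro exI allI impI)
    fix N assume N: "N \<ge> N0"
    have "\<bar>expectation (\<lambda>\<omega>. g (X N \<omega>) - P (X N \<omega>))\<bar> \<le> expectation (\<lambda>\<omega>. e / 3)"
      using close nn intg intP
      by (intro order_trans[OF integral_abs_bound] integral_mono) auto
    hence 1: "\<bar>expectation (\<lambda>\<omega>. g (X N \<omega>)) - expectation (\<lambda>\<omega>. P (X N \<omega>))\<bar> \<le> e / 3"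
      using intg intP by (simp add: prob_space)
    have "\<bar>\<integral>x. g x - P x \<partial>\<nu>\<bar> \<le> (\<integral>x. e / 3 \<partial>\<nu>)"
      using \<nu>(2) close intg\<nu> intP\<nu>
      by (intro order_trans[OF integral_abs_bound] integral_mono_AE) auto
    hence 2: "\<bar>(\<integral>x. g x \<partial>\<nu>) - (\<integral>x. P x \<partial>\<nu>)\<bar> \<le> e / 3"
      using intg\<nu> intP\<nu> \<nu>.prob_space by simp
    show "norm (expectation (\<lambda>\<omega>. g (X N \<omega>)) - (\<integral>x. g x \<partial>\<nu>)) < e"
      using 1 2 N0[OF N] by (simp add: abs_if split: if_splits)
  qed
qed

theorem square_norm_cts_step_tendsto_chi2:
  assumes [measurable]: "\<And>N j. j < k \<Longrightarrow> Z N j \<in> borel_measurable M" and k: "k \<ge> 1"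
    and lim: "\<And>\<xi>. (\<lambda>N. \<integral>\<omega>. iexp (\<Sum>j<k. \<xi> j * Z N j \<omega>) \<partial>M) \<longlonglongrightarrow> exp (- (\<Sum>j<k. (\<xi> j)\<^sup>2) / 2)"
    and ab: "a < b"
  shows "(\<lambda>N. expectation (\<lambda>\<omega>. cts_step a b (\<Sum>j<k. (Z N j \<omega>)\<^sup>2))) \<longlonglongrightarrow> (\<integral>x. cts_step a b x \<partial>chi2 k)"
proof -
  obtain f where f: "continuous_on {0..1} f" "\<And>x. cts_step a b x = f (exp (- x))"
    by (rule cts_step_eq_exp_minus[OF ab]) (rule that)
  show ?thesis
  proof (rule laplace_tendsto_imp_integral_tendsto[OF _ _ real_distribution_chi2[OF k] AE_chi2_nonneg _ f(1)])
    show "(\<lambda>N. expectation (\<lambda>\<omega>. exp (- real m * (\<Sum>j<k. (Z N j \<omega>)\<^sup>2)))) \<longlonglongrightarrow> (\<integral>x. exp (- real m * x) \<partial>chi2 k)" for m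
      unfolding chi2_laplace[OF k, of "real m", simplified]
      using laplace_square_norm_tendsto[OF assms(1) _ lim, of "real m"] chi2_laplace[OF k, of "real m"] by simp
    show "cts_step a b \<in> borel_measurable borel"
      using ab by (auto simp: cts_step_def[abs_def])
  qed (auto intro: sum_nonneg f(2))
qed

end

section \<open>Bounded independent arrays and convergence in probability\<close>

lemma abs_exp_minus_linear:
  assumes "y \<ge> (0::real)"
  shows "\<bar>exp (- y) - (1 - y)\<bar> \<le> y\<^sup>2 / 2"
proof -
  let ?h = "\<lambda>y::real. 1 - y + y\<^sup>2 / 2 - exp (- y)"
  have "?h 0 \<le> ?h y"
  proof (rule DERIV_nonneg_imp_nondecreasing[OF assms])
    fix x :: real assume "0 \<le> x"
    have "(?h has_real_derivative (x - 1 + exp (- x))) (at x)"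
      by (auto intro!: derivative_eq_intros)
    moreover have "x - 1 + exp (- x) \<ge> 0" using exp_ge_add_one_self[of "- x"] by simp
    ultimately show "\<exists>y. (?h has_real_derivative y) (at x) \<and> 0 \<le> y" by blast
  qed
  thus ?thesis using exp_ge_add_one_self[of "- y"] by simp
qed

lemma abs_exp_linear:
  assumes "\<bar>z\<bar> \<le> (1::real)" shows "\<bar>exp z - 1 - z\<bar> \<le> z\<^sup>2"
proof -
  have "exp z - 1 - z \<le> z\<^sup>2"
  proof (cases "z \<ge> 0")
    case True
    thus ?thesis using exp_bound[of z] assms by simp
  next
    case False
    hence "\<bar>exp z - (1 + z)\<bar> \<le> z\<^sup>2 / 2" using abs_exp_minus_linear[of "- z"] by simp
    thus ?thesis using zero_le_power2[of z] by linarith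
  qed
  thus ?thesis using exp_ge_add_one_self[of z] by linarith
qed

section \<open>Central limit theorem for bounded independent arrays\<close>

context prob_space begin

text \<open>Both terms are compared with \<open>1 - t\<^sup>2 * v / 2\<close>. The characteristic
  function contributes the third-moment error, bounded through \<open>B ^ 3\<close>; the exponential
  contributes its second-order error, bounded through \<open>v \<le> B\<^sup>2\<close>.\<close>

lemma char_bounded_approx:
  assumes [measurable]: "X \<in> borel_measurable M" and B: "\<And>\<omega>. \<omega> \<in> space M \<Longrightarrow> \<bar>X \<omega>\<bar> \<le> B"
    and mean: "expectation X = 0" and v: "expectation (\<lambda>\<omega>. (X \<omega>)\<^sup>2) = v"
  shows "cmod (char (distr M borel X) t - exp (- (t\<^sup>2 * v) / 2)) \<le> \<bar>t\<bar> ^ 3 * B ^ 3 / 6 + t ^ 4 * B ^ 4 / 8"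
proof -
  have B0: "B \<ge> 0" using B not_empty by force
  have sq: "(X \<omega>)\<^sup>2 \<le> B\<^sup>2" if "\<omega> \<in> space M" for \<omega>
    using power_mono[OF B[OF that], of 2] by simp
  have intX: "integrable M X" using B by (intro integrable_const_bound[where B=B]) auto
  have intX2: "integrable M (\<lambda>\<omega>. (X \<omega>)\<^sup>2)" using sq by (intro integrable_const_bound[where B="B\<^sup>2"]) auto
  have "v \<le> expectation (\<lambda>\<omega>. B\<^sup>2)"
    unfolding v[symmetric] using intX2 sq by (intro integral_mono) auto
  hence vB: "v \<le> B\<^sup>2" by (simp add: prob_space)
  have v0: "v \<ge> 0" unfolding v[symmetric] by (intro integral_nonneg_AE) auto
  have "cmod (char (distr M borel X) t - (1 - t\<^sup>2 * v / 2))
      \<le> (t\<^sup>2 / 6) * expectation (\<lambda>\<omega>. min (6 * (X \<omega>)\<^sup>2) (\<bar>t\<bar> * \<bar>X \<omega>\<bar> ^ 3))"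
    using intX intX2 mean v by (intro char_approx3') auto
  also have "expectation (\<lambda>\<omega>. min (6 * (X \<omega>)\<^sup>2) (\<bar>t\<bar> * \<bar>X \<omega>\<bar> ^ 3)) \<le> expectation (\<lambda>\<omega>. \<bar>t\<bar> * B ^ 3)"
  proof (intro integral_mono)
    show "integrable M (\<lambda>\<omega>. min (6 * (X \<omega>)\<^sup>2) (\<bar>t\<bar> * \<bar>X \<omega>\<bar> ^ 3))"
      by (rule Bochner_Integration.integrable_bound[OF integrable_mult_right[OF intX2, of 6]]) auto
    fix \<omega> assume "\<omega> \<in> space M"
    thus "min (6 * (X \<omega>)\<^sup>2) (\<bar>t\<bar> * \<bar>X \<omega>\<bar> ^ 3) \<le> \<bar>t\<bar> * B ^ 3"
      using B by (intro min.coboundedI2 mult_left_mono power_mono) auto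
  qed simp
  hence "(t\<^sup>2 / 6) * expectation (\<lambda>\<omega>. min (6 * (X \<omega>)\<^sup>2) (\<bar>t\<bar> * \<bar>X \<omega>\<bar> ^ 3)) \<le> (t\<^sup>2 / 6) * (\<bar>t\<bar> * B ^ 3)"
    by (intro mult_left_mono) (auto simp: prob_space)
  also have "(t\<^sup>2 / 6) * (\<bar>t\<bar> * B ^ 3) = \<bar>t\<bar> ^ 3 * B ^ 3 / 6"
    by (simp add: power3_eq_cube power2_eq_square)
  finally have 1: "cmod (char (distr M borel X) t - (1 - t\<^sup>2 * v / 2)) \<le> \<bar>t\<bar> ^ 3 * B ^ 3 / 6" .
  have "\<bar>exp (- (t\<^sup>2 * v / 2)) - (1 - t\<^sup>2 * v / 2)\<bar> \<le> (t\<^sup>2 * v / 2)\<^sup>2 / 2"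
    using v0 by (intro abs_exp_minus_linear) auto
  also have "\<dots> = t ^ 4 * v\<^sup>2 / 8" by (simp add: power_divide power_mult_distrib)
  also have "\<dots> \<le> t ^ 4 * (B\<^sup>2)\<^sup>2 / 8"
    using vB v0 by (intro divide_right_mono mult_left_mono power_mono) auto
  finally have "\<bar>exp (- (t\<^sup>2 * v / 2)) - (1 - t\<^sup>2 * v / 2)\<bar> \<le> t ^ 4 * B ^ 4 / 8" by simp
  hence 2: "cmod (complex_of_real (1 - t\<^sup>2 * v / 2) - complex_of_real (exp (- (t\<^sup>2 * v) / 2))) \<le> t ^ 4 * B ^ 4 / 8"
    unfolding of_real_diff[symmetric] norm_of_real by (simp add: abs_minus_commute)
  show ?thesis
    using norm_triangle_le[OF add_mono[OF 1 2]] by simp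
qed

text \<open>Independence turns the integral into a product, and products of factors in the unit disc
  differ by at most the sum of the differences of the factors. Each difference is of order
  \<open>|a N| ^ 3\<close>, while \<open>(a N)\<^sup>2 * card (I N)\<close> is at most
  \<open>C\<close>; the total is of order \<open>|a N|\<close>. The variances \<open>v i\<close> may
  vary with the index, as unequal cluster sizes demand.\<close>

lemma bounded_array_clt:
  fixes a :: "nat \<Rightarrow> real"
  assumes indep: "indep_vars (\<lambda>_. borel) X J" and I: "\<And>N. finite (I N)" "\<And>N. I N \<subseteq> J"
    and B: "\<And>i \<omega>. i \<in> J \<Longrightarrow> \<omega> \<in> space M \<Longrightarrow> \<bar>X i \<omega>\<bar> \<le> B"
    and mean: "\<And>i. i \<in> J \<Longrightarrow> expectation (X i) = 0"
    and v: "\<And>i. i \<in> J \<Longrightarrow> expectation (\<lambda>\<omega>. (X i \<omega>)\<^sup>2) = v i"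
    and a: "a \<longlonglongrightarrow> 0" and C: "\<And>N. (a N)\<^sup>2 * real (card (I N)) \<le> C"
    and V: "(\<lambda>N. (a N)\<^sup>2 * (\<Sum>i\<in>I N. v i)) \<longlonglongrightarrow> V"
  shows "(\<lambda>N. \<integral>\<omega>. iexp (a N * (\<Sum>i\<in>I N. X i \<omega>)) \<partial>M) \<longlonglongrightarrow> exp (- V / 2)"
proof -
  have rv: "X i \<in> borel_measurable M" if "i \<in> J" for i
    using indep that by (auto simp: indep_vars_def2)
  have meas: "(\<lambda>\<omega>. \<Sum>i\<in>I N. X i \<omega>) \<in> borel_measurable M" for N
    using rv I by (intro borel_measurable_sum) auto
  define c where "c i t = char (distr M borel (X i)) t" for i t
  have char_eq: "(\<integral>\<omega>. iexp (a N * (\<Sum>i\<in>I N. X i \<omega>)) \<partial>M) = (\<Prod>i\<in>I N. c i (a N))" for N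
  proof -
    have "(\<integral>\<omega>. iexp (a N * (\<Sum>i\<in>I N. X i \<omega>)) \<partial>M) = char (distr M borel (\<lambda>\<omega>. \<Sum>i\<in>I N. X i \<omega>)) (a N)"
      unfolding char_def using meas by (subst integral_distr) auto
    also have "\<dots> = (\<Prod>i\<in>I N. c i (a N))"
      unfolding c_def by (intro char_distr_sum indep_vars_subset[OF indep] I)
    finally show ?thesis .
  qed
  have J0: "B \<ge> 0" "v i \<ge> 0" if "i \<in> J" for i
  proof -
    show "B \<ge> 0" using B[OF that] not_empty by force
    show "v i \<ge> 0" unfolding v[OF that, symmetric] by (intro integral_nonneg_AE) auto
  qed
  have C0: "C \<ge> 0" using C[of 0] by (meson mult_nonneg_nonneg of_nat_0_le_iff order_trans zero_le_power2)
  define E where "E N = C * (\<bar>a N\<bar> * B ^ 3 / 6 + (a N)\<^sup>2 * B ^ 4 / 8)" for N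
  \<comment> \<open>The absolute value covers an empty \<open>J\<close>, where nothing forces
    \<open>B\<close> to be nonnegative and \<open>E N\<close> may be negative.\<close>
  have bound: "cmod ((\<Prod>i\<in>I N. c i (a N)) - complex_of_real (exp (- ((a N)\<^sup>2 * (\<Sum>i\<in>I N. v i)) / 2))) \<le> \<bar>E N\<bar>" for N
  proof -
    have "complex_of_real (exp (- ((a N)\<^sup>2 * (\<Sum>i\<in>I N. v i)) / 2)) = (\<Prod>i\<in>I N. exp (- ((a N)\<^sup>2 * v i) / 2))"
      unfolding of_real_prod[symmetric] using I by (simp add: exp_sum[symmetric] sum_divide_distrib sum_negf sum_distrib_left)
    hence "cmod ((\<Prod>i\<in>I N. c i (a N)) - complex_of_real (exp (- ((a N)\<^sup>2 * (\<Sum>i\<in>I N. v i)) / 2)))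
       = cmod ((\<Prod>i\<in>I N. c i (a N)) - (\<Prod>i\<in>I N. complex_of_real (exp (- ((a N)\<^sup>2 * v i) / 2))))" by simp
    also have "\<dots> \<le> (\<Sum>i\<in>I N. cmod (c i (a N) - exp (- ((a N)\<^sup>2 * v i) / 2)))"
    proof (intro norm_prod_diff)
      fix i assume "i \<in> I N"
      hence i: "i \<in> J" using I by auto
      interpret R: real_distribution "distr M borel (X i)" using rv[OF i] by (rule real_distribution_distr)
      show "norm (c i (a N)) \<le> 1" unfolding c_def by (rule R.cmod_char_le_1)
      show "norm (complex_of_real (exp (- ((a N)\<^sup>2 * v i) / 2))) \<le> 1"
        using J0(2)[OF i] by simp
    qed
    also have "\<dots> \<le> (\<Sum>i\<in>I N. \<bar>a N\<bar> ^ 3 * B ^ 3 / 6 + (a N) ^ 4 * B ^ 4 / 8)"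
      unfolding c_def using I B mean v rv by (intro sum_mono char_bounded_approx) (auto dest!: subsetD[OF I(2)])
    also have "\<dots> = ((a N)\<^sup>2 * real (card (I N))) * (\<bar>a N\<bar> * B ^ 3 / 6 + (a N)\<^sup>2 * B ^ 4 / 8)"
      by (simp add: algebra_simps power3_eq_cube power2_eq_square power4_eq_xxxx)
    also have "\<dots> \<le> \<bar>E N\<bar>"
    proof (cases "I N = {}")
      case False
      then obtain i where "i \<in> J" using I by auto
      hence "((a N)\<^sup>2 * real (card (I N))) * (\<bar>a N\<bar> * B ^ 3 / 6 + (a N)\<^sup>2 * B ^ 4 / 8) \<le> E N"
        unfolding E_def using J0(1) C by (intro mult_right_mono) auto
      thus ?thesis by simp
    qed simp
    finally show ?thesis .
  qed
  have "E \<longlonglongrightarrow> C * (\<bar>0\<bar> * B ^ 3 / 6 + 0\<^sup>2 * B ^ 4 / 8)"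
    unfolding E_def[abs_def] by (intro tendsto_intros a) auto
  hence "(\<lambda>N. \<bar>E N\<bar>) \<longlonglongrightarrow> 0" by (simp add: tendsto_rabs_zero)
  hence "(\<lambda>N. (\<Prod>i\<in>I N. c i (a N)) - complex_of_real (exp (- ((a N)\<^sup>2 * (\<Sum>i\<in>I N. v i)) / 2))) \<longlonglongrightarrow> 0"
    by (rule Lim_null_comparison[OF always_eventually, rotated]) (use bound in auto)
  moreover have "(\<lambda>N. complex_of_real (exp (- ((a N)\<^sup>2 * (\<Sum>i\<in>I N. v i)) / 2))) \<longlonglongrightarrow> complex_of_real (exp (- V / 2))"
    by (intro tendsto_intros V) auto
  ultimately have "(\<lambda>N. ((\<Prod>i\<in>I N. c i (a N)) - complex_of_real (exp (- ((a N)\<^sup>2 * (\<Sum>i\<in>I N. v i)) / 2)))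
      + complex_of_real (exp (- ((a N)\<^sup>2 * (\<Sum>i\<in>I N. v i)) / 2))) \<longlonglongrightarrow> 0 + complex_of_real (exp (- V / 2))"
    by (rule tendsto_add)
  thus ?thesis unfolding char_eq by simp
qed

section \<open>Convergence in probability\<close>

definition null_in_prob :: "(nat \<Rightarrow> 'a \<Rightarrow> real) \<Rightarrow> bool" where
  "null_in_prob X \<longleftrightarrow> (\<forall>e>0. (\<lambda>N. prob {\<omega> \<in> space M. \<bar>X N \<omega>\<bar> \<ge> e}) \<longlonglongrightarrow> 0)"

lemma hoeffding_sum:
  fixes X :: "'i \<Rightarrow> 'a \<Rightarrow> real"
  assumes indep: "indep_vars (\<lambda>_. borel) X I" and fin: "finite I" and ne: "I \<noteq> {}" and B: "B > 0"
    and X: "\<And>i \<omega>. i \<in> I \<Longrightarrow> \<omega> \<in> space M \<Longrightarrow> X i \<omega> \<in> {0..B}" and e: "e \<ge> 0"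
  shows "prob {\<omega> \<in> space M. \<bar>(\<Sum>i\<in>I. X i \<omega> - expectation (X i))\<bar> \<ge> e}
     \<le> 2 * exp (- 2 * e\<^sup>2 / (real (card I) * B\<^sup>2))"
proof -
  interpret Hoeffding_ineq M I X "\<lambda>_. 0" "\<lambda>_. B" "\<Sum>i\<in>I. expectation (X i)"
    using assms by unfold_locales auto
  have "(\<Sum>i\<in>I. (B - 0)\<^sup>2) = real (card I) * B\<^sup>2" by simp
  thus ?thesis
    using Hoeffding_ineq_abs_ge[OF e] fin ne B by (simp add: sum_subtractf card_gt_0_iff)
qed

text \<open>At deviation \<open>e * card (I N)\<close> Hoeffding's exponent is linear in
  \<open>card (I N)\<close>, so the tail decays exponentially.\<close>

lemma bounded_weak_lln:
  assumes indep: "indep_vars (\<lambda>_. borel) X J" and I: "\<And>N. finite (I N)" "\<And>N. I N \<subseteq> J" and B: "B > 0"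
    and X: "\<And>i \<omega>. i \<in> J \<Longrightarrow> \<omega> \<in> space M \<Longrightarrow> X i \<omega> \<in> {0..B}"
    and mean: "\<And>i. i \<in> J \<Longrightarrow> expectation (X i) = \<mu>"
    and card: "filterlim (\<lambda>N. real (card (I N))) at_top sequentially"
  shows "null_in_prob (\<lambda>N \<omega>. (\<Sum>i\<in>I N. X i \<omega> - \<mu>) / real (card (I N)))"
  unfolding null_in_prob_def
proof (intro allI impI)
  fix e :: real assume e: "e > 0"
  have "filterlim (\<lambda>N. 2 * e\<^sup>2 / B\<^sup>2 * real (card (I N))) at_top sequentially"
    using e B by (intro filterlim_tendsto_pos_mult_at_top[OF tendsto_const _ card]) auto
  hence "filterlim (\<lambda>N. - (2 * e\<^sup>2 / B\<^sup>2 * real (card (I N)))) at_bot sequentially"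
    by (simp add: filterlim_uminus_at_bot)
  from filterlim_compose[OF exp_at_bot this]
  have "(\<lambda>N. exp (- (2 * e\<^sup>2 / B\<^sup>2 * real (card (I N))))) \<longlonglongrightarrow> 0" .
  hence lim: "(\<lambda>N. 2 * exp (- (2 * e\<^sup>2 / B\<^sup>2 * real (card (I N))))) \<longlonglongrightarrow> 0"
    using tendsto_mult_right_zero by blast
  have "\<forall>\<^sub>F N in sequentially. real (card (I N)) > 0"
    using card[unfolded filterlim_at_top_dense] by blast
  hence "\<forall>\<^sub>F N in sequentially. norm (prob {\<omega> \<in> space M. \<bar>(\<Sum>i\<in>I N. X i \<omega> - \<mu>) / real (card (I N))\<bar> \<ge> e})
     \<le> 2 * exp (- (2 * e\<^sup>2 / B\<^sup>2 * real (card (I N))))"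
  proof eventually_elim
    case (elim N)
    let ?n = "real (card (I N))"
    have "{\<omega> \<in> space M. \<bar>(\<Sum>i\<in>I N. X i \<omega> - \<mu>) / ?n\<bar> \<ge> e}
       = {\<omega> \<in> space M. \<bar>(\<Sum>i\<in>I N. X i \<omega> - expectation (X i))\<bar> \<ge> e * ?n}"
      using elim mean I(2)[of N] by (auto simp: field_simps subset_iff)
    moreover have "prob {\<omega> \<in> space M. \<bar>(\<Sum>i\<in>I N. X i \<omega> - expectation (X i))\<bar> \<ge> e * ?n}
        \<le> 2 * exp (- 2 * (e * ?n)\<^sup>2 / (?n * B\<^sup>2))"
      using elim e X I(2)[of N] by (intro hoeffding_sum[OF indep_vars_subset[OF indep I(2)] I(1) _ B]) auto
    ultimately have "prob {\<omega> \<in> space M. \<bar>(\<Sum>i\<in>I N. X i \<omega> - \<mu>) / ?n\<bar> \<ge> e} \<le> 2 * exp (- 2 * (e * ?n)\<^sup>2 / (?n * B\<^sup>2))"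
      by simp
    also have "- 2 * (e * ?n)\<^sup>2 / (?n * B\<^sup>2) = - (2 * e\<^sup>2 / B\<^sup>2 * ?n)"
      using elim B by (simp add: power2_eq_square field_simps)
    finally show ?case by simp
  qed
  from Lim_null_comparison[OF this lim] show "(\<lambda>N. prob {\<omega> \<in> space M. \<bar>(\<Sum>i\<in>I N. X i \<omega> - \<mu>) / real (card (I N))\<bar> \<ge> e}) \<longlonglongrightarrow> 0" .
qed

text \<open>Stochastic statements are reduced to deterministic ones along selected sample points:
  if the conclusion failed, offending sample points could be picked with all \<open>R i\<close> bounded and
  all \<open>D i\<close> vanishing.\<close>

lemma null_in_prob_by_selection:
  fixes R :: "'i \<Rightarrow> nat \<Rightarrow> 'a \<Rightarrow> real" and D :: "'k \<Rightarrow> nat \<Rightarrow> 'a \<Rightarrow> real"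
  assumes fin: "finite A" "finite B"
    and R_meas: "\<And>i N. i \<in> A \<Longrightarrow> R i N \<in> borel_measurable M"
    and D_meas: "\<And>i N. i \<in> B \<Longrightarrow> D i N \<in> borel_measurable M"
    and tight: "\<And>i e. i \<in> A \<Longrightarrow> e > 0 \<Longrightarrow> \<exists>K. \<forall>\<^sub>F N in sequentially. prob {\<omega> \<in> space M. \<bar>R i N \<omega>\<bar> \<ge> K} \<le> e"
    and D: "\<And>i. i \<in> B \<Longrightarrow> null_in_prob (D i)"
    and seq: "\<And>K f w. filterlim f at_top sequentially \<Longrightarrow> (\<And>j. f j > 0) \<Longrightarrow> (\<And>j. w j \<in> space M) \<Longrightarrow>
        (\<And>i j. i \<in> A \<Longrightarrow> \<bar>R i (f j) (w j)\<bar> \<le> K i) \<Longrightarrow>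
        (\<And>i. i \<in> B \<Longrightarrow> (\<lambda>j. D i (f j) (w j)) \<longlonglongrightarrow> 0) \<Longrightarrow> (\<lambda>j. H (f j) (w j)) \<longlonglongrightarrow> 0"
  shows "null_in_prob H"
  unfolding null_in_prob_def
proof (intro allI impI)
  fix e :: real assume e: "e > 0"
  \<comment> \<open>A uniform pointwise form of \<open>seq\<close>: for given bounds
    \<open>K\<close>, one threshold \<open>d\<close> for all \<open>D i\<close> and one
    \<open>N0\<close> force \<open>H\<close> below \<open>e\<close>.\<close>
  have det: "\<exists>d>0. \<exists>N0. \<forall>N\<ge>N0. \<forall>\<omega>\<in>space M. (\<forall>i\<in>A. \<bar>R i N \<omega>\<bar> \<le> K i) \<and> (\<forall>i\<in>B. \<bar>D i N \<omega>\<bar> \<le> d) \<longrightarrow> \<bar>H N \<omega>\<bar> < e" for K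
  proof (rule ccontr)
    assume neg: "\<not> ?thesis"
    \<comment> \<open>The negation is used with threshold \<open>inverse (real (Suc j))\<close>.
      Demanding \<open>N \<ge> Suc j\<close> makes the selected sizes diverge and keeps them
      positive, both of which \<open>seq\<close> asks for.\<close>
    have "\<exists>N \<omega>. N \<ge> Suc j \<and> \<omega> \<in> space M \<and> (\<forall>i\<in>A. \<bar>R i N \<omega>\<bar> \<le> K i) \<and> (\<forall>i\<in>B. \<bar>D i N \<omega>\<bar> \<le> inverse (real (Suc j))) \<and> \<bar>H N \<omega>\<bar> \<ge> e" for j
    proof -
      have "inverse (real (Suc j)) > 0" by simp
      with neg show ?thesis by (meson not_less)
    qed
    then obtain f w where fw: "\<And>j. f j \<ge> Suc j" "\<And>j. w j \<in> space M" "\<And>i j. i \<in> A \<Longrightarrow> \<bar>R i (f j) (w j)\<bar> \<le> K i"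
      "\<And>i j. i \<in> B \<Longrightarrow> \<bar>D i (f j) (w j)\<bar> \<le> inverse (real (Suc j))" "\<And>j. \<bar>H (f j) (w j)\<bar> \<ge> e"
      by metis
    have f: "filterlim f at_top sequentially"
      using fw(1) by (intro filterlim_at_top_mono[OF filterlim_Suc]) auto
    have fpos: "f j > 0" for j using fw(1)[of j] by simp
    have "(\<lambda>j. D i (f j) (w j)) \<longlonglongrightarrow> 0" if "i \<in> B" for i
      using fw(4)[OF that] by (intro Lim_null_comparison[OF _ LIMSEQ_inverse_real_of_nat]) auto
    from seq[OF f fpos fw(2,3) this] have "(\<lambda>j. H (f j) (w j)) \<longlonglongrightarrow> 0" .
    from LIMSEQ_D[OF this e] show False using fw(5) by (auto simp: not_less[symmetric])
  qed
  show "(\<lambda>N. prob {\<omega> \<in> space M. \<bar>H N \<omega>\<bar> \<ge> e}) \<longlonglongrightarrow> 0"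
  proof (rule tendstoI)
    fix \<eta> :: real assume \<eta>: "\<eta> > 0"
    \<comment> \<open>There are at most \<open>card A + card B\<close> exceptional events, each of
      probability at most \<open>\<eta>'\<close>. The factor 2 and the summand 1 make the total
      strictly less than \<open>\<eta>\<close> and keep the denominator positive when both index
      sets are empty.\<close>
    define \<eta>' where "\<eta>' = \<eta> / (2 * (real (card A) + real (card B) + 1))"
    have \<eta>': "\<eta>' > 0" using \<eta> by (simp add: \<eta>'_def add_nonneg_pos)
    obtain K where K: "\<And>i. i \<in> A \<Longrightarrow> \<forall>\<^sub>F N in sequentially. prob {\<omega> \<in> space M. \<bar>R i N \<omega>\<bar> \<ge> K i} \<le> \<eta>'"
    proof -
      have "\<forall>i\<in>A. \<exists>K. \<forall>\<^sub>F N in sequentially. prob {\<omega> \<in> space M. \<bar>R i N \<omega>\<bar> \<ge> K} \<le> \<eta>'"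
        using tight[OF _ \<eta>'] by blast
      from bchoice[OF this] show ?thesis using that by blast
    qed
    obtain d N0 where d: "d > 0" and N0: "\<And>N \<omega>. N \<ge> N0 \<Longrightarrow> \<omega> \<in> space M \<Longrightarrow>
        (\<And>i. i \<in> A \<Longrightarrow> \<bar>R i N \<omega>\<bar> \<le> K i) \<Longrightarrow> (\<And>i. i \<in> B \<Longrightarrow> \<bar>D i N \<omega>\<bar> \<le> d) \<Longrightarrow> \<bar>H N \<omega>\<bar> < e"
      using det[of K] by metis
    have evD: "\<forall>\<^sub>F N in sequentially. prob {\<omega> \<in> space M. \<bar>D i N \<omega>\<bar> \<ge> d} \<le> \<eta>'" if "i \<in> B" for i
      using order_tendstoD(2)[OF D[OF that, unfolded null_in_prob_def, rule_format, OF d] \<eta>']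
      by eventually_elim simp
    have "\<forall>\<^sub>F N in sequentially. \<forall>i\<in>A. prob {\<omega> \<in> space M. \<bar>R i N \<omega>\<bar> \<ge> K i} \<le> \<eta>'"
      using K fin by (intro eventually_ball_finite) auto
    moreover have "\<forall>\<^sub>F N in sequentially. \<forall>i\<in>B. prob {\<omega> \<in> space M. \<bar>D i N \<omega>\<bar> \<ge> d} \<le> \<eta>'"
      using evD fin by (intro eventually_ball_finite) auto
    moreover have "\<forall>\<^sub>F N in sequentially. N \<ge> N0" by (rule eventually_ge_at_top)
    ultimately show "\<forall>\<^sub>F N in sequentially. dist (prob {\<omega> \<in> space M. \<bar>H N \<omega>\<bar> \<ge> e}) 0 < \<eta>"
    proof eventually_elim
      case (elim N)
      have mR: "{\<omega> \<in> space M. \<bar>R i N \<omega>\<bar> \<ge> K i} \<in> events" if "i \<in> A" for i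
        using R_meas[OF that] by measurable
      have mD: "{\<omega> \<in> space M. \<bar>D i N \<omega>\<bar> \<ge> d} \<in> events" if "i \<in> B" for i
        using D_meas[OF that] by measurable
      let ?U = "(\<Union>i\<in>A. {\<omega> \<in> space M. \<bar>R i N \<omega>\<bar> \<ge> K i})" and ?V = "(\<Union>i\<in>B. {\<omega> \<in> space M. \<bar>D i N \<omega>\<bar> \<ge> d})"
      have ev: "?U \<in> events" "?V \<in> events" using fin mR mD by auto
      \<comment> \<open>Monotonicity of the measure asks for measurability of the covering union,
        which comes from that of the \<open>R i\<close> and \<open>D i\<close>.\<close>
      have "prob {\<omega> \<in> space M. \<bar>H N \<omega>\<bar> \<ge> e} \<le> prob (?U \<union> ?V)"
      proof (rule finite_measure_mono)
        show "{\<omega> \<in> space M. \<bar>H N \<omega>\<bar> \<ge> e} \<subseteq> ?U \<union> ?V"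
          using N0[OF elim(3)] by (force simp: not_le)
      qed (use ev in auto)
      also have "\<dots> \<le> prob ?U + prob ?V" using ev by (intro measure_Un_le) auto
      also have "prob ?U \<le> (\<Sum>i\<in>A. prob {\<omega> \<in> space M. \<bar>R i N \<omega>\<bar> \<ge> K i})"
        using fin mR by (intro finite_measure_subadditive_finite) auto
      also have "\<dots> \<le> (\<Sum>i\<in>A. \<eta>')" using elim by (intro sum_mono) auto
      also have "prob ?V \<le> (\<Sum>i\<in>B. prob {\<omega> \<in> space M. \<bar>D i N \<omega>\<bar> \<ge> d})"
        using fin mD by (intro finite_measure_subadditive_finite) auto
      also have "\<dots> \<le> (\<Sum>i\<in>B. \<eta>')" using elim by (intro sum_mono) auto
      also have "(\<Sum>i\<in>A. \<eta>') + (\<Sum>i\<in>B. \<eta>') = (real (card A) + real (card B)) * \<eta>'" by (simp add: algebra_simps)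
      also have "\<dots> < (2 * (real (card A) + real (card B) + 1)) * \<eta>'"
        using \<eta>' by (intro mult_strict_right_mono) auto
      also have "\<dots> = \<eta>" by (simp add: \<eta>'_def field_simps)
      finally show ?case by simp
    qed
  qed
qed

text \<open>\<open>cts_step a b\<close> has Lipschitz constant \<open>1 / (b - a)\<close> and values
  in the unit interval. With \<open>d = e * (b - a) / 2\<close> the integrands differ by at most
  \<open>e / 2\<close> where \<open>X\<close> and \<open>X'\<close> are within \<open>d\<close>, and
  by at most 1 on the remaining set, whose probability vanishes.\<close>

lemma cts_step_slutsky:
  assumes [measurable]: "\<And>N. X N \<in> borel_measurable M" "\<And>N. X' N \<in> borel_measurable M"
    and null: "null_in_prob (\<lambda>N \<omega>. X N \<omega> - X' N \<omega>)" and ab: "a < b"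
    and lim: "(\<lambda>N. expectation (\<lambda>\<omega>. cts_step a b (X' N \<omega>))) \<longlonglongrightarrow> L"
  shows "(\<lambda>N. expectation (\<lambda>\<omega>. cts_step a b (X N \<omega>))) \<longlonglongrightarrow> L"
proof -
  have [measurable]: "cts_step a b \<in> borel_measurable borel" using ab by (auto simp: cts_step_def[abs_def])
  have int: "integrable M (\<lambda>\<omega>. cts_step a b (Z \<omega>))" if [measurable]: "Z \<in> borel_measurable M" for Z
    using ab by (intro integrable_const_bound[where B=1]) (auto simp: cts_step_def field_simps)
  have "(\<lambda>N. expectation (\<lambda>\<omega>. cts_step a b (X N \<omega>)) - expectation (\<lambda>\<omega>. cts_step a b (X' N \<omega>))) \<longlonglongrightarrow> 0"
  proof (rule tendstoI)
    fix e :: real assume e: "e > 0"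
    define d where "d = e * (b - a) / 2"
    have d: "d > 0" using e ab by (simp add: d_def)
    have "\<forall>\<^sub>F N in sequentially. prob {\<omega> \<in> space M. \<bar>X N \<omega> - X' N \<omega>\<bar> \<ge> d} < e / 2"
      using null[unfolded null_in_prob_def, rule_format, OF d] e by (intro order_tendstoD(2)) auto
    thus "\<forall>\<^sub>F N in sequentially. dist (expectation (\<lambda>\<omega>. cts_step a b (X N \<omega>)) - expectation (\<lambda>\<omega>. cts_step a b (X' N \<omega>))) 0 < e"
    proof eventually_elim
      case (elim N)
      let ?S = "{\<omega> \<in> space M. \<bar>X N \<omega> - X' N \<omega>\<bar> \<ge> d}"
      have S: "?S \<in> events" by measurable
      have "\<bar>expectation (\<lambda>\<omega>. cts_step a b (X N \<omega>) - cts_step a b (X' N \<omega>))\<bar> \<le> expectation (\<lambda>\<omega>. e / 2 + indicator ?S \<omega>)"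
      proof (intro order_trans[OF integral_abs_bound] integral_mono)
        fix \<omega> assume \<omega>: "\<omega> \<in> space M"
        have "0 \<le> cts_step a b z \<and> cts_step a b z \<le> 1" for z
          using ab by (auto simp: cts_step_def field_simps)
        from this[of "X N \<omega>"] this[of "X' N \<omega>"]
        have le1: "\<bar>cts_step a b (X N \<omega>) - cts_step a b (X' N \<omega>)\<bar> \<le> 1" by linarith
        show "\<bar>cts_step a b (X N \<omega>) - cts_step a b (X' N \<omega>)\<bar> \<le> e / 2 + indicator ?S \<omega>"
        proof (cases "\<omega> \<in> ?S")
          case True
          thus ?thesis using le1 e by simp
        next
          case False
          hence "\<bar>X N \<omega> - X' N \<omega>\<bar> / (b - a) \<le> d / (b - a)" using \<omega> ab by (intro divide_right_mono) auto
          also have "\<dots> = e / 2" unfolding d_def using ab by (simp add: divide_simps)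
          finally have "\<bar>X N \<omega> - X' N \<omega>\<bar> / (b - a) \<le> e / 2" .
          from order_trans[OF cts_step_lipschitz[OF ab] this] show ?thesis using False by simp
        qed
      qed (use int S in \<open>auto intro!: integrable_real_indicator simp: emeasure_eq_measure\<close>)
      also have "\<dots> = e / 2 + prob ?S" using S by (simp add: prob_space emeasure_eq_measure)
      also have "\<dots> < e" using elim by simp
      finally show ?case using int by simp
    qed
  qed
  from tendsto_add[OF this lim] show ?thesis by simp
qed

end

section \<open>Admissible divergences\<close>

text \<open>The real-valued divergence in which all estimates are made. At model points, whose
  entries are positive, it agrees with \<open>dphi\<close>; see
  \<open>dphi_eq_phidiv\<close>.\<close>

definition phidiv :: "(real \<Rightarrow> real) \<Rightarrow> nat \<Rightarrow> (nat \<Rightarrow> real) \<Rightarrow> (nat \<Rightarrow> real) \<Rightarrow> real" where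
  "phidiv \<phi> M x q = (\<Sum>r<M. q r * \<phi> (x r / q r))"

section \<open>An admissible function near 1 and far from 1\<close>

lemma admissible_deriv:
  assumes "admissible \<phi>" "u > 0"
  shows "(\<phi> has_real_derivative deriv \<phi> u) (at u)"
  using assms by (auto simp: admissible_def DERIV_deriv_iff_real_differentiable)

lemma admissible_isCont: "admissible \<phi> \<Longrightarrow> u > 0 \<Longrightarrow> isCont \<phi> u"
  using admissible_deriv DERIV_isCont by blast

lemma admissible_nonneg:
  assumes \<phi>: "admissible \<phi>" and u: "u > 0"
  shows "\<phi> u \<ge> 0"
proof -
  have "\<phi> u - \<phi> 1 \<ge> 0 * (u - 1)"
  proof (rule convex_on_imp_above_tangent)
    show "convex_on {0<..} \<phi>" using \<phi> by (simp add: admissible_def)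
    have "(\<phi> has_real_derivative 0) (at 1)"
      using admissible_deriv[OF \<phi>, of 1] \<phi> by (simp add: admissible_def)
    thus "(\<phi> has_real_derivative 0) (at 1 within {0<..})" by (rule has_field_derivative_at_within)
  qed (use u in \<open>auto simp: interior_open\<close>)
  thus ?thesis using \<phi> by (simp add: admissible_def)
qed

text \<open>Since \<open>deriv \<phi> 1 = 0\<close>, one application of l'Hopital's rule leaves half
  the difference quotient of \<open>deriv \<phi>\<close> at 1.\<close>

lemma admissible_quadratic:
  assumes \<phi>: "admissible \<phi>"
  shows "((\<lambda>u. \<phi> u / (u - 1)\<^sup>2) \<longlongrightarrow> deriv (deriv \<phi>) 1 / 2) (at 1)"
proof (rule lhopital)
  have "\<phi> \<midarrow>1\<rightarrow> \<phi> 1" using admissible_isCont[OF \<phi>, of 1] by (simp add: isCont_def)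
  thus "\<phi> \<midarrow>1\<rightarrow> 0" using \<phi> by (simp add: admissible_def)
  have "((\<lambda>u::real. (u - 1)\<^sup>2) \<longlongrightarrow> (1 - 1)\<^sup>2) (at 1)" by (intro tendsto_intros)
  thus "((\<lambda>u::real. (u - 1)\<^sup>2) \<longlongrightarrow> 0) (at 1)" by simp
  have ne: "\<forall>\<^sub>F u in at (1::real). u \<noteq> 1" by (simp add: eventually_at_filter)
  show "\<forall>\<^sub>F u in at (1::real). (u - 1)\<^sup>2 \<noteq> 0" using ne by eventually_elim simp
  show "\<forall>\<^sub>F u in at (1::real). 2 * (u - 1) \<noteq> 0" using ne by eventually_elim simp
  have "\<forall>\<^sub>F u in nhds (1::real). u > 0"
    using eventually_nhds_in_open[of "{0<..}" "1::real"] by simp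
  hence "\<forall>\<^sub>F u in at (1::real). u > 0" by (simp add: eventually_at_filter eventually_mono)
  thus "\<forall>\<^sub>F u in at 1. (\<phi> has_real_derivative deriv \<phi> u) (at u)"
    by eventually_elim (rule admissible_deriv[OF \<phi>])
  show "\<forall>\<^sub>F u in at 1. ((\<lambda>u. (u - 1)\<^sup>2) has_real_derivative 2 * (u - 1)) (at u)"
    by (intro always_eventually allI) (auto intro!: derivative_eq_intros)
  have "(deriv \<phi> has_real_derivative deriv (deriv \<phi>) 1) (at 1)"
    using \<phi> by (auto simp: admissible_def DERIV_deriv_iff_real_differentiable)
  hence "((\<lambda>u. (deriv \<phi> u - deriv \<phi> 1) / (u - 1)) \<longlongrightarrow> deriv (deriv \<phi>) 1) (at 1)"
    by (simp add: has_field_derivative_iff)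
  hence "((\<lambda>u. 1 / 2 * ((deriv \<phi> u - deriv \<phi> 1) / (u - 1))) \<longlongrightarrow> 1 / 2 * deriv (deriv \<phi>) 1) (at 1)"
    by (intro tendsto_intros)
  thus "((\<lambda>u. deriv \<phi> u / (2 * (u - 1))) \<longlongrightarrow> deriv (deriv \<phi>) 1 / 2) (at 1)"
    using \<phi> by (simp add: admissible_def field_simps)
qed

lemma admissible_convex_to_1:
  assumes \<phi>: "admissible \<phi>" and u: "u > 0" and t: "0 \<le> t" "t \<le> 1"
  shows "\<phi> (1 + t * (u - 1)) \<le> t * \<phi> u"
proof -
  have "convex_on {0<..} \<phi>" using \<phi> by (simp add: admissible_def)
  from convex_onD[OF this t, of 1 u] u have "\<phi> ((1 - t) *\<^sub>R 1 + t *\<^sub>R u) \<le> (1 - t) * \<phi> 1 + t * \<phi> u" by simp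
  moreover have "(1 - t) *\<^sub>R 1 + t *\<^sub>R u = 1 + t * (u - 1)" by (simp add: algebra_simps)
  moreover have "\<phi> 1 = 0" using \<phi> by (simp add: admissible_def)
  ultimately show ?thesis by (simp only: mult_zero_right add_0_left)
qed

text \<open>The quadratic limit gives positivity near 1 only. Shrinking \<open>u - 1\<close> by a
  factor \<open>t\<close> that reaches this neighbourhood, and applying
  \<open>admissible_convex_to_1\<close>, carries it to every \<open>u\<close>.\<close>

lemma admissible_pos:
  assumes \<phi>: "admissible \<phi>" and u: "u > 0" "u \<noteq> 1"
  shows "\<phi> u > 0"
proof -
  have "deriv (deriv \<phi>) 1 / 2 > 0" using \<phi> by (simp add: admissible_def)
  from order_tendstoD(1)[OF admissible_quadratic[OF \<phi>] this]
  obtain d where d: "d > 0" "\<And>v. v \<noteq> 1 \<Longrightarrow> dist v 1 < d \<Longrightarrow> \<phi> v / (v - 1)\<^sup>2 > 0"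
    by (auto simp: eventually_at)
  define t where "t = min 1 (d / (2 * \<bar>u - 1\<bar>))"
  have t: "0 < t" "t \<le> 1" using d u by (auto simp: t_def)
  have "t * \<bar>u - 1\<bar> \<le> d / (2 * \<bar>u - 1\<bar>) * \<bar>u - 1\<bar>" by (intro mult_right_mono) (auto simp: t_def)
  also have "\<dots> < d" using d u by simp
  finally have "dist (1 + t * (u - 1)) 1 < d" using t by (simp add: dist_real_def abs_mult)
  hence "\<phi> (1 + t * (u - 1)) > 0" using d(2)[of "1 + t * (u - 1)"] t u by (simp add: zero_less_divide_iff)
  also have "\<dots> \<le> t * \<phi> u" using t u by (intro admissible_convex_to_1[OF \<phi>]) auto
  finally show ?thesis using t by (simp add: zero_less_mult_iff)
qed

text \<open>Convexity and \<open>\<phi> 1 = 0\<close> make the slope of the chord from 1 grow away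
  from 1, so the values at \<open>1 + e\<close> and \<open>1 - e\<close> bound it below. The
  condition \<open>e < 1\<close> keeps \<open>1 - e\<close> in the domain.\<close>

lemma admissible_linear_growth:
  assumes \<phi>: "admissible \<phi>" and e: "0 < e" "e < 1"
  shows "\<exists>c>0. \<forall>u>0. \<bar>u - 1\<bar> \<ge> e \<longrightarrow> \<phi> u \<ge> c * \<bar>u - 1\<bar>"
proof (intro exI conjI allI impI)
  let ?c = "min (\<phi> (1 + e)) (\<phi> (1 - e)) / e"
  show "?c > 0" using e admissible_pos[OF \<phi>, of "1 + e"] admissible_pos[OF \<phi>, of "1 - e"] by simp
  fix u :: real assume u: "u > 0" "\<bar>u - 1\<bar> \<ge> e"
  define t where "t = e / \<bar>u - 1\<bar>"
  have t: "0 < t" "t \<le> 1" using u e by (auto simp: t_def)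
  have "1 + t * (u - 1) \<in> {1 + e, 1 - e}"
    using u e by (cases "u \<ge> 1") (auto simp: t_def field_simps)
  hence "min (\<phi> (1 + e)) (\<phi> (1 - e)) \<le> \<phi> (1 + t * (u - 1))" by auto
  also have "\<dots> \<le> t * \<phi> u" using t u by (intro admissible_convex_to_1[OF \<phi>]) auto
  finally show "?c * \<bar>u - 1\<bar> \<le> \<phi> u" using e u by (simp add: t_def field_simps)
qed

text \<open>The bound has to be uniform as \<open>q\<close> approaches 0, because model
  probabilities degenerate when parameters run to infinity. Linear growth survives this, since
  \<open>q * (c * |x / q - 1|)\<close> equals \<open>c * |x - q|\<close>; and
  \<open>q \<le> 1\<close> guarantees that \<open>x / q\<close> is at distance at least
  \<open>e\<close> from 1.\<close>

lemma divergence_separates: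
  assumes \<phi>: "admissible \<phi>" and e: "0 < e" "e < 1"
  shows "\<exists>c>0. \<forall>x q. 0 < x \<and> 0 < q \<and> q \<le> 1 \<and> \<bar>x - q\<bar> \<ge> e \<longrightarrow> q * \<phi> (x / q) \<ge> c"
proof -
  obtain c where c: "c > 0" "\<And>u. u > 0 \<Longrightarrow> \<bar>u - 1\<bar> \<ge> e \<Longrightarrow> \<phi> u \<ge> c * \<bar>u - 1\<bar>"
    using admissible_linear_growth[OF assms] by blast
  have "q * \<phi> (x / q) \<ge> c * e" if x: "0 < x" and q: "0 < q" "q \<le> 1" and d: "\<bar>x - q\<bar> \<ge> e" for x q
  proof -
    have u: "\<bar>x / q - 1\<bar> = \<bar>x - q\<bar> / q" using q by (simp add: diff_divide_distrib[symmetric] field_simps)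
    have "e * q \<le> \<bar>x - q\<bar>" using d mult_left_mono[OF q(2) less_imp_le[OF e(1)]] by linarith
    hence "\<bar>x / q - 1\<bar> \<ge> e" unfolding u using q by (simp add: field_simps)
    hence "\<phi> (x / q) \<ge> c * (\<bar>x - q\<bar> / q)" using c(2)[of "x / q"] x q u by simp
    hence "q * \<phi> (x / q) \<ge> q * (c * (\<bar>x - q\<bar> / q))" using q by (intro mult_left_mono) auto
    also have "q * (c * (\<bar>x - q\<bar> / q)) = c * \<bar>x - q\<bar>" using q by simp
    finally show ?thesis using mult_left_mono[OF d less_imp_le[OF c(1)]] by linarith
  qed
  thus ?thesis using c(1) e by (intro exI[of _ "c * e"]) auto
qed

text \<open>\<open>\<psi>\<close> is the normalised quotient of \<open>\<phi> u\<close> by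
  \<open>(u - 1)\<^sup>2\<close>, its singularity at 1 filled with the limit. The identity is exact,
  so continuity of \<open>\<psi>\<close> at 1 takes the place of a Taylor remainder.\<close>

lemma divergence_term_quadratic:
  assumes \<phi>: "admissible \<phi>"
  shows "\<exists>\<psi>. isCont \<psi> 1 \<and> \<psi> 1 = 1 \<and>
    (\<forall>x q. q > 0 \<longrightarrow> 2 / deriv (deriv \<phi>) 1 * (q * \<phi> (x / q)) = \<psi> (x / q) * ((x - q)\<^sup>2 / q))"
proof -
  let ?c = "deriv (deriv \<phi>) 1"
  have c: "?c > 0" and \<phi>1: "\<phi> 1 = 0" using \<phi> by (auto simp: admissible_def)
  define \<psi> where "\<psi> u = (if u = 1 then 1 else 2 / ?c * (\<phi> u / (u - 1)\<^sup>2))" for u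
  have "((\<lambda>u. 2 / ?c * (\<phi> u / (u - 1)\<^sup>2)) \<longlongrightarrow> 2 / ?c * (?c / 2)) (at 1)"
    by (intro tendsto_intros admissible_quadratic \<phi>)
  hence "\<psi> \<midarrow>1\<rightarrow> 1" using c
    by (subst tendsto_cong[of _ "\<lambda>u. 2 / ?c * (\<phi> u / (u - 1)\<^sup>2)"]) (auto simp: \<psi>_def eventually_at_filter)
  hence "isCont \<psi> 1" by (simp add: isCont_def \<psi>_def)
  moreover have "2 / ?c * (q * \<phi> (x / q)) = \<psi> (x / q) * ((x - q)\<^sup>2 / q)" if q: "q > 0" for x q
  proof (cases "x = q")
    case True
    thus ?thesis using q \<phi>1 by simp
  next
    case False
    have "x / q - 1 = (x - q) / q" using q by (simp add: field_simps)
    thus ?thesis using False q by (simp add: \<psi>_def power_divide power2_eq_square)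
  qed
  ultimately show ?thesis by (intro exI[of _ \<psi>]) (auto simp: \<psi>_def)
qed

text \<open>The bound puts \<open>z j\<close> at order \<open>1 / sqrt (S j)\<close>. The remainder
  is at most \<open>(z j)\<^sup>2\<close>, so after scaling it is at most
  \<open>K * |z j|\<close>.\<close>

lemma scaled_exp_linear:
  fixes S z :: "nat \<Rightarrow> real"
  assumes S: "filterlim S at_top sequentially" and z: "\<forall>\<^sub>F j in sequentially. \<bar>sqrt (S j) * z j\<bar> \<le> K"
  shows "(\<lambda>j. sqrt (S j) * (exp (z j) - 1 - z j)) \<longlonglongrightarrow> 0" and "z \<longlonglongrightarrow> 0"
proof -
  have sq: "filterlim (\<lambda>j. sqrt (S j)) at_top sequentially"
    by (rule filterlim_compose[OF sqrt_at_top S])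
  have inv: "(\<lambda>j. inverse (sqrt (S j))) \<longlonglongrightarrow> 0"
    by (rule filterlim_compose[OF tendsto_inverse_0_at_top[OF filterlim_ident] sq])
  have pos: "\<forall>\<^sub>F j in sequentially. sqrt (S j) > 0"
    using sq[unfolded filterlim_at_top_dense] by blast
  show z0: "z \<longlonglongrightarrow> 0"
  proof (rule Lim_null_comparison)
    show "\<forall>\<^sub>F j in sequentially. norm (z j) \<le> K * inverse (sqrt (S j))"
      using pos z
    proof eventually_elim
      case (elim j)
      thus ?case by (simp add: abs_mult field_simps)
    qed
    show "(\<lambda>j. K * inverse (sqrt (S j))) \<longlonglongrightarrow> 0" using tendsto_mult_right_zero[OF inv] by simp
  qed
  have "\<forall>\<^sub>F j in sequentially. \<bar>z j\<bar> < 1" using order_tendstoD(2)[OF tendsto_rabs_zero[OF z0], of 1] by simp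
  hence ev: "\<forall>\<^sub>F j in sequentially. norm (sqrt (S j) * (exp (z j) - 1 - z j)) \<le> K * \<bar>z j\<bar>"
    using pos z
  proof eventually_elim
    case (elim j)
    have "\<bar>sqrt (S j) * (exp (z j) - 1 - z j)\<bar> = sqrt (S j) * \<bar>exp (z j) - 1 - z j\<bar>"
      using elim by (simp add: abs_mult)
    also have "\<dots> \<le> sqrt (S j) * (z j)\<^sup>2"
      using elim by (intro mult_left_mono abs_exp_linear) auto
    also have "\<dots> = \<bar>sqrt (S j) * z j\<bar> * \<bar>z j\<bar>" using elim by (simp add: abs_mult power2_eq_square)
    also have "\<dots> \<le> K * \<bar>z j\<bar>" using elim by (intro mult_right_mono) auto
    finally show ?case by simp
  qed
  have "(\<lambda>j. K * \<bar>z j\<bar>) \<longlonglongrightarrow> K * \<bar>0\<bar>" using z0 by (intro tendsto_intros)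
  hence "(\<lambda>j. K * \<bar>z j\<bar>) \<longlonglongrightarrow> 0" by simp
  from Lim_null_comparison[OF ev this] show "(\<lambda>j. sqrt (S j) * (exp (z j) - 1 - z j)) \<longlonglongrightarrow> 0" .
qed

lemma tendsto_of_sqrt_rate:
  fixes S x :: "nat \<Rightarrow> real"
  assumes "filterlim S at_top sequentially" "\<And>j. \<bar>sqrt (S j) * (x j - p)\<bar> \<le> K"
  shows "x \<longlonglongrightarrow> p"
proof -
  have "(\<lambda>j. x j - p) \<longlonglongrightarrow> 0"
    using assms by (intro scaled_exp_linear(2)[where K=K] always_eventually) auto
  from tendsto_add[OF this tendsto_const[of p]] show ?thesis by simp
qed

lemma null_mult_bounded:
  fixes f g :: "nat \<Rightarrow> real"
  assumes "f \<longlonglongrightarrow> 0" "\<forall>\<^sub>F j in sequentially. \<bar>g j\<bar> \<le> K"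
  shows "(\<lambda>j. f j * g j) \<longlonglongrightarrow> 0"
  using assms by (intro lim_null_mult_right_bounded[where B=K]) auto

lemma diff_squares_null:
  fixes f g :: "nat \<Rightarrow> real"
  assumes d: "(\<lambda>j. f j - g j) \<longlonglongrightarrow> 0" and g: "\<forall>\<^sub>F j in sequentially. \<bar>g j\<bar> \<le> K"
  shows "(\<lambda>j. (f j)\<^sup>2 - (g j)\<^sup>2) \<longlonglongrightarrow> 0"
proof -
  have "\<forall>\<^sub>F j in sequentially. \<bar>2 * g j\<bar> \<le> 2 * K" using g by eventually_elim (simp add: abs_mult)
  hence "(\<lambda>j. (f j - g j)\<^sup>2 + (f j - g j) * (2 * g j)) \<longlonglongrightarrow> 0\<^sup>2 + 0"
    by (intro tendsto_intros d null_mult_bounded[OF d])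
  moreover have "(f j - g j)\<^sup>2 + (f j - g j) * (2 * g j) = (f j)\<^sup>2 - (g j)\<^sup>2" for j
    by (simp add: power2_eq_square algebra_simps)
  ultimately show ?thesis by simp
qed

text \<open>Admissibility constrains \<open>\<phi>\<close> on positive arguments only, whereas an
  empty cell produces the argument 0. There the composite takes the single value
  \<open>\<phi> 0\<close>, which does not disturb measurability.\<close>

lemma admissible_measurable_nonneg:
  assumes \<phi>: "admissible \<phi>" and f: "f \<in> borel_measurable M" and nn: "\<And>x. x \<in> space M \<Longrightarrow> f x \<ge> 0"
  shows "(\<lambda>x. \<phi> (f x)) \<in> borel_measurable M"
proof -
  have "continuous_on {0<..} \<phi>"
    using admissible_isCont[OF \<phi>] by (auto intro!: continuous_at_imp_continuous_on)
  hence m: "(\<lambda>u. if u \<in> {0<..} then \<phi> u else \<phi> 0) \<in> borel_measurable borel"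
    by (intro borel_measurable_continuous_on_if) auto
  have "(\<lambda>x. if f x \<in> {0<..} then \<phi> (f x) else \<phi> 0) \<in> borel_measurable M"
    by (rule measurable_compose[OF f m])
  also have "?this \<longleftrightarrow> ?thesis"
  proof (rule measurable_cong)
    fix x assume "x \<in> space M"
    thus "(if f x \<in> {0<..} then \<phi> (f x) else \<phi> 0) = \<phi> (f x)" using nn[of x] by (cases "f x = 0") auto
  qed
  finally show ?thesis .
qed

section \<open>Minimum divergence estimation in the log-linear model\<close>

lemma phidiv_nonneg_term:
  assumes "admissible \<phi>" "\<And>r. r < M \<Longrightarrow> x r > 0" "\<And>r. r < M \<Longrightarrow> q r > 0" "r < M"
  shows "q r * \<phi> (x r / q r) \<le> phidiv \<phi> M x q"
  unfolding phidiv_def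
proof (rule member_le_sum[of r "{..<M}" "\<lambda>r. q r * \<phi> (x r / q r)"])
  fix s assume "s \<in> {..<M} - {r}"
  hence "0 < x s / q s" "0 < q s" using assms(2,3) by auto
  thus "0 \<le> q s * \<phi> (x s / q s)" using admissible_nonneg[OF assms(1)] by simp
qed (use assms(4) in auto)

locale loglinear =
  fixes M M0 :: nat and W :: "nat \<Rightarrow> nat \<Rightarrow> real" and \<theta>0 :: "nat \<Rightarrow> real"
  assumes M_pos: "M > 0"
    and indep: "\<And>a c. (\<forall>r<M. a + (\<Sum>s<M0. W r s * c s) = 0) \<Longrightarrow> a = 0 \<and> (\<forall>s<M0. c s = 0)"
begin

section \<open>The model as an exponential family and its tangent space\<close>

abbreviation pm :: "(nat \<Rightarrow> real) \<Rightarrow> nat \<Rightarrow> real" where "pm \<equiv> pmodel M M0 W"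
abbreviation p0 :: "nat \<Rightarrow> real" where "p0 \<equiv> pmodel M M0 W \<theta>0"
abbreviation dof :: nat where "dof \<equiv> M - M0 - 1"
abbreviation lin :: "(nat \<Rightarrow> real) \<Rightarrow> nat \<Rightarrow> real" where "lin c r \<equiv> \<Sum>s<M0. W r s * c s"

lemma denom_pos: "(\<Sum>r<M. exp (lin \<theta> r)) > 0"
  using M_pos by (intro sum_pos) auto

lemma pm_pos: "pm \<theta> r > 0"
  using denom_pos by (simp add: pmodel_def)

lemma pm_sum: "(\<Sum>r<M. pm \<theta> r) = 1"
  using denom_pos[of \<theta>] unfolding pmodel_def sum_divide_distrib[symmetric] by simp

lemma pm_le_1: "r < M \<Longrightarrow> pm \<theta> r \<le> 1"
  using member_le_sum[of r "{..<M}" "pm \<theta>"] pm_pos pm_sum by (auto intro: less_imp_le)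

lemma pm_cong: "(\<And>s. s < M0 \<Longrightarrow> \<theta> s = \<theta>' s) \<Longrightarrow> pm \<theta> = pm \<theta>'"
  by (simp add: pmodel_def fun_eq_iff)

text \<open>Moving the parameter tilts \<open>p0\<close> exponentially and renormalises, so
  linearising the model around \<open>p0\<close> only involves \<open>exp\<close>.\<close>

lemma pm_shift:
  "pm (\<lambda>s. \<theta>0 s + c s) r = p0 r * exp (lin c r) / (\<Sum>r'<M. p0 r' * exp (lin c r'))"
proof -
  let ?D = "\<Sum>r'<M. exp (lin \<theta>0 r')"
  have D: "?D > 0" by (rule denom_pos)
  have e: "exp (\<Sum>s<M0. W r s * (\<theta>0 s + c s)) = ?D * (p0 r * exp (lin c r))" for r
    using D by (simp add: pmodel_def distrib_left sum.distrib exp_add)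
  show ?thesis using D unfolding pmodel_def[of M M0 W "\<lambda>s. \<theta>0 s + c s"] e sum_distrib_left[symmetric] by simp
qed

text \<open>The constant \<open>a\<close> is the difference of the logarithms of the two
  normalisers. The log ratio is exactly, not only to first order, in the space whose weighted
  version \<open>tangent_complement\<close> annihilates.\<close>

lemma ln_pm_ratio:
  "\<exists>a. \<forall>r. ln (pm \<theta> r / p0 r) = a + (\<Sum>s<M0. W r s * (\<theta> s - \<theta>0 s))"
proof (intro exI allI)
  fix r
  let ?D = "\<lambda>\<theta>. \<Sum>r'<M. exp (lin \<theta> r')"
  have "ln (pm \<theta> r) = lin \<theta> r - ln (?D \<theta>)" for \<theta>
    using denom_pos[of \<theta>] by (simp add: pmodel_def ln_div)
  thus "ln (pm \<theta> r / p0 r) = (ln (?D \<theta>0) - ln (?D \<theta>)) + (\<Sum>s<M0. W r s * (\<theta> s - \<theta>0 s))"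
    using pm_pos[of \<theta> r] pm_pos[of \<theta>0 r] by (simp add: ln_div right_diff_distrib sum_subtractf)
qed

lemma dphi_eq_phidiv: "dphi \<phi> M x (pm \<theta>) = ereal (phidiv \<phi> M x (pm \<theta>))"
  using pm_pos[of \<theta>] by (simp add: dphi_def phidiv_def less_imp_neq[symmetric])

text \<open>Weighted by \<open>sqrt (p0 r)\<close>, the constants and the columns of
  \<open>W\<close> span the tangent space of the model together with the normal direction of the
  simplex. \<open>b\<close> is an orthonormal basis of the orthogonal complement; \<open>C 0\<close>
  and \<open>C (Suc s)\<close> read off the coefficients of the constant and of column
  \<open>s\<close>.\<close>

definition tangent_complement :: "(nat \<Rightarrow> nat \<Rightarrow> real) \<Rightarrow> (nat \<Rightarrow> nat \<Rightarrow> real) \<Rightarrow> bool" where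
  "tangent_complement b C \<longleftrightarrow> orthonormal M dof b
     \<and> (\<forall>j<dof. \<forall>a c. (\<Sum>r<M. b j r * (sqrt (p0 r) * (a + lin c r))) = 0)
     \<and> (\<forall>y. \<forall>r<M. y r = sqrt (p0 r) * (dotp M (C 0) y + (\<Sum>s<M0. W r s * dotp M (C (Suc s)) y))
          + (\<Sum>j<dof. dotp M (b j) y * b j r))"

lemma ex_tangent_complement: "\<exists>b C. tangent_complement b C"
proof -
  define u where "u i r = sqrt (p0 r) * (case i of 0 \<Rightarrow> 1 | Suc s \<Rightarrow> W r s)" for i r
  have expand: "(\<Sum>i<Suc M0. c i * u i r) = sqrt (p0 r) * (c 0 + (\<Sum>s<M0. W r s * c (Suc s)))" for c :: "nat \<Rightarrow> real" and r
    unfolding sum.lessThan_Suc_shift u_def by (simp add: algebra_simps sum_distrib_left)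
  have "\<forall>c. (\<forall>r<M. (\<Sum>i<Suc M0. c i * u i r) = 0) \<longrightarrow> (\<forall>i<Suc M0. c i = 0)"
  proof (intro allI impI)
    fix c i assume h: "\<forall>r<M. (\<Sum>i<Suc M0. c i * u i r) = 0" "i < Suc M0"
    hence "\<forall>r<M. c 0 + (\<Sum>s<M0. W r s * c (Suc s)) = 0"
      using pm_pos[of \<theta>0] unfolding expand by (auto simp: less_imp_neq[symmetric])
    from indep[OF this] h(2) show "c i = 0" by (cases i) auto
  qed
  from orthonormal_complement[OF this] obtain b C where b: "orthonormal M (M - Suc M0) b"
    "\<forall>j<M - Suc M0. \<forall>i<Suc M0. dotp M (b j) (u i) = 0"
    "\<forall>y. \<forall>r<M. y r = (\<Sum>i<Suc M0. dotp M (C i) y * u i r) + (\<Sum>j<M - Suc M0. dotp M (b j) y * b j r)"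
    by (elim exE conjE)
  have "(\<Sum>r<M. b j r * (sqrt (p0 r) * (a + lin c r))) = 0" if j: "j < M - Suc M0" for j a c
  proof -
    let ?c = "case_nat a c"
    have "(\<Sum>r<M. b j r * (sqrt (p0 r) * (a + lin c r))) = dotp M (b j) (\<lambda>r. \<Sum>i<Suc M0. ?c i * u i r)"
      unfolding expand by (simp add: dotp_def)
    also have "\<dots> = (\<Sum>i<Suc M0. ?c i * dotp M (b j) (u i))" by (rule dotp_sum_right)
    also have "\<dots> = 0" using b(2) j by (intro sum.neutral) auto
    finally show ?thesis .
  qed
  moreover have "M - Suc M0 = dof" by simp
  ultimately have "tangent_complement b C"
    unfolding tangent_complement_def using b(1) b(3)[unfolded expand]
    by (metis (no_types, lifting))
  thus ?thesis by blast
qed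

text \<open>The weighted vector of the values \<open>a + lin c r\<close> has no component along
  \<open>b\<close>, so independence identifies \<open>c s\<close> with its inner product with
  \<open>C (Suc s)\<close>. This converts bounds on log ratios into a box for the
  parameters.\<close>

lemma coefficients_bounded:
  "\<exists>C\<ge>0. \<forall>a c B. (\<forall>r<M. \<bar>a + lin c r\<bar> \<le> B) \<longrightarrow> (\<forall>s<M0. \<bar>c s\<bar> \<le> C * B)"
proof -
  obtain b C where bC: "tangent_complement b C" using ex_tangent_complement by blast
  define K where "K = (\<Sum>s<M0. \<Sum>r<M. \<bar>C (Suc s) r\<bar>)"
  have "\<bar>c s\<bar> \<le> K * B" if B: "\<forall>r<M. \<bar>a + lin c r\<bar> \<le> B" and s: "s < M0" for a c B s
  proof -
    define y where "y r = sqrt (p0 r) * (a + lin c r)" for r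
    have B0: "B \<ge> 0" using B M_pos by force
    have by0: "dotp M (b j) y = 0" if "j < dof" for j
      using bC that unfolding tangent_complement_def dotp_def y_def by simp
    have "y r = sqrt (p0 r) * (dotp M (C 0) y + (\<Sum>s<M0. W r s * dotp M (C (Suc s)) y))
          + (\<Sum>j<dof. dotp M (b j) y * b j r)" if "r < M" for r
      using bC[unfolded tangent_complement_def] that by blast
    hence "y r = sqrt (p0 r) * (dotp M (C 0) y + (\<Sum>s<M0. W r s * dotp M (C (Suc s)) y))" if "r < M" for r
      using by0 that by simp
    hence eq: "sqrt (p0 r) * (a + lin c r) = sqrt (p0 r) * (dotp M (C 0) y + (\<Sum>s<M0. W r s * dotp M (C (Suc s)) y))"
      if "r < M" for r
      using that unfolding y_def by simp
    have "a + lin c r = dotp M (C 0) y + (\<Sum>s<M0. W r s * dotp M (C (Suc s)) y)" if "r < M" for r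
    proof -
      have "sqrt (p0 r) \<noteq> 0" using pm_pos[of \<theta>0 r] by simp
      thus ?thesis using eq[OF that] by (metis mult_left_cancel)
    qed
    hence "\<forall>r<M. (a - dotp M (C 0) y) + (\<Sum>s<M0. W r s * (c s - dotp M (C (Suc s)) y)) = 0"
      unfolding right_diff_distrib sum_subtractf by (simp add: algebra_simps)
    from indep[OF this] s have "c s = dotp M (C (Suc s)) y" by simp
    hence "\<bar>c s\<bar> \<le> (\<Sum>r<M. \<bar>C (Suc s) r * y r\<bar>)" unfolding dotp_def by simp
    also have "\<dots> \<le> (\<Sum>r<M. \<bar>C (Suc s) r\<bar> * B)"
    proof (rule sum_mono)
      fix r assume "r \<in> {..<M}"
      hence r: "r < M" by simp
      have "\<bar>y r\<bar> = sqrt (p0 r) * \<bar>a + lin c r\<bar>"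
        using pm_pos[of \<theta>0 r] by (simp add: y_def abs_mult)
      also have "\<dots> \<le> 1 * B" using B r pm_le_1[OF r, of \<theta>0] pm_pos[of \<theta>0 r] by (intro mult_mono) auto
      finally show "\<bar>C (Suc s) r * y r\<bar> \<le> \<bar>C (Suc s) r\<bar> * B" by (auto simp: abs_mult intro: mult_left_mono)
    qed
    also have "\<dots> = (\<Sum>r<M. \<bar>C (Suc s) r\<bar>) * B" by (simp add: sum_distrib_right)
    also have "\<dots> \<le> K * B"
      unfolding K_def using s B0
      by (intro mult_right_mono member_le_sum[of s _ "\<lambda>s. \<Sum>r<M. \<bar>C (Suc s) r\<bar>"]) (auto intro: sum_nonneg)
    finally show ?thesis .
  qed
  moreover have "K \<ge> 0" by (auto simp: K_def intro!: sum_nonneg)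
  ultimately show ?thesis by blast
qed

section \<open>Existence and consistency of the minimiser\<close>

lemma phidiv_attains_min_on_box:
  fixes x :: "nat \<Rightarrow> real"
  assumes \<phi>: "admissible \<phi>" and x: "\<And>r. r < M \<Longrightarrow> x r > 0" and K: "K \<ge> 0"
  shows "\<exists>\<theta>. \<forall>\<theta>'. (\<forall>s<M0. \<bar>\<theta>' s - \<theta>0 s\<bar> \<le> K) \<longrightarrow> phidiv \<phi> M x (pm \<theta>) \<le> phidiv \<phi> M x (pm \<theta>')"
proof -
  \<comment> \<open>Parameters are functions on all natural numbers. Coordinates from
    \<open>M0\<close> on, which \<open>pm\<close> ignores, are pinned to 0, so that the box is a
    product of compact sets and compact by Tychonoff.\<close>
  define I where "I s = (if s < M0 then {\<theta>0 s - K..\<theta>0 s + K} else {0})" for s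
  have "compactin (product_topology (\<lambda>_. euclidean) UNIV) (PiE UNIV I)"
    by (auto simp: compactin_PiE I_def)
  hence comp: "compact (PiE UNIV I)" by (simp add: euclidean_product_topology)
  define tr where "tr \<theta> s = (if s < M0 then \<theta> s else 0)" for \<theta> :: "nat \<Rightarrow> real" and s
  have tr: "pm (tr \<theta>) = pm \<theta>" for \<theta> by (rule pm_cong) (simp add: tr_def)
  have "tr \<theta>0 \<in> PiE UNIV I" using K by (auto simp: tr_def I_def)
  hence ne: "PiE UNIV I \<noteq> {}" by blast
  have cpm: "continuous_on UNIV (\<lambda>\<theta>. pm \<theta> r)" for r
    unfolding pmodel_def
    by (intro continuous_intros continuous_on_product_coordinates) (use denom_pos in \<open>auto simp: less_imp_neq[symmetric]\<close>)
  have c\<phi>: "continuous_on {0<..} \<phi>"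
    using admissible_isCont[OF \<phi>] by (auto intro!: continuous_at_imp_continuous_on)
  have "continuous_on UNIV (\<lambda>\<theta>. \<phi> (x r / pm \<theta> r))" if "r < M" for r
  proof (rule continuous_on_compose2[OF c\<phi>])
    show "continuous_on UNIV (\<lambda>\<theta>. x r / pm \<theta> r)"
      using pm_pos by (intro continuous_intros cpm) (auto simp: less_imp_neq[symmetric])
  qed (use that x pm_pos in auto)
  hence "continuous_on UNIV (\<lambda>\<theta>. phidiv \<phi> M x (pm \<theta>))"
    unfolding phidiv_def by (intro continuous_intros cpm) auto
  hence "continuous_on (PiE UNIV I) (\<lambda>\<theta>. phidiv \<phi> M x (pm \<theta>))"
    by (rule continuous_on_subset) auto
  from continuous_attains_inf[OF comp ne this] obtain \<theta>
    where \<theta>: "\<And>\<theta>'. \<theta>' \<in> PiE UNIV I \<Longrightarrow> phidiv \<phi> M x (pm \<theta>) \<le> phidiv \<phi> M x (pm \<theta>')" by blast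
  show ?thesis
  proof (intro exI[of _ \<theta>] allI impI)
    fix \<theta>' :: "nat \<Rightarrow> real" assume "\<forall>s<M0. \<bar>\<theta>' s - \<theta>0 s\<bar> \<le> K"
    hence "tr \<theta>' \<in> PiE UNIV I" by (auto simp: tr_def I_def abs_le_iff)
    from \<theta>[OF this] show "phidiv \<phi> M x (pm \<theta>) \<le> phidiv \<phi> M x (pm \<theta>')" by (simp add: tr)
  qed
qed

lemma phidiv_p0_null:
  fixes x :: "nat \<Rightarrow> nat \<Rightarrow> real"
  assumes \<phi>: "admissible \<phi>" and x: "\<forall>r<M. (\<lambda>j. x j r) \<longlonglongrightarrow> p0 r"
  shows "(\<lambda>j. phidiv \<phi> M (x j) p0) \<longlonglongrightarrow> 0"
proof -
  have "(\<lambda>j. phidiv \<phi> M (x j) p0) \<longlonglongrightarrow> (\<Sum>r<M. p0 r * \<phi> 1)"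
    unfolding phidiv_def
  proof (intro tendsto_intros isCont_tendsto_compose[OF admissible_isCont[OF \<phi>]])
    fix r assume "r \<in> {..<M}"
    hence "(\<lambda>j. x j r / p0 r) \<longlonglongrightarrow> p0 r / p0 r"
      using pm_pos[of \<theta>0 r] x[rule_format, of r] by (intro tendsto_intros) (auto simp: less_imp_neq[symmetric])
    thus "(\<lambda>j. x j r / p0 r) \<longlonglongrightarrow> 1" using pm_pos[of \<theta>0 r] by (simp add: less_imp_neq[symmetric])
  qed auto
  thus ?thesis using \<phi> by (simp add: admissible_def)
qed

lemma eventually_pos:
  fixes x :: "nat \<Rightarrow> nat \<Rightarrow> real"
  assumes x: "\<forall>r<M. (\<lambda>j. x j r) \<longlonglongrightarrow> p0 r"
  shows "\<forall>\<^sub>F j in sequentially. \<forall>r<M. x j r > 0"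
proof -
  have "\<forall>\<^sub>F j in sequentially. \<forall>r\<in>{..<M}. x j r > 0"
    using order_tendstoD(1)[OF x[rule_format] pm_pos] by (intro eventually_ball_finite) auto
  thus ?thesis by eventually_elim simp
qed

text \<open>All terms of the divergence are nonnegative, so a single cell at distance
  \<open>e\<close> already costs the constant of \<open>divergence_separates\<close>, while the
  divergence at \<open>p0\<close> tends to 0. The index from which this holds does not depend on
  \<open>\<theta>\<close>.\<close>

lemma eventually_close_of_small_phidiv:
  fixes x :: "nat \<Rightarrow> nat \<Rightarrow> real"
  assumes \<phi>: "admissible \<phi>" and x: "\<forall>r<M. (\<lambda>j. x j r) \<longlonglongrightarrow> p0 r" and e: "0 < e" "e < 1"
  shows "\<forall>\<^sub>F j in sequentially. \<forall>\<theta>. phidiv \<phi> M (x j) (pm \<theta>) \<le> phidiv \<phi> M (x j) p0 \<longrightarrow> (\<forall>r<M. \<bar>x j r - pm \<theta> r\<bar> < e)"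
proof -
  obtain c where c: "c > 0" "\<And>x q. 0 < x \<Longrightarrow> 0 < q \<Longrightarrow> q \<le> 1 \<Longrightarrow> \<bar>x - q\<bar> \<ge> e \<Longrightarrow> q * \<phi> (x / q) \<ge> c"
    using divergence_separates[OF \<phi> e] by blast
  have "\<forall>\<^sub>F j in sequentially. phidiv \<phi> M (x j) p0 < c"
    by (rule order_tendstoD(2)[OF phidiv_p0_null[OF \<phi> x] c(1)])
  with eventually_pos[OF x] show ?thesis
  proof eventually_elim
    case (elim j)
    show ?case
    proof (intro allI impI)
      fix \<theta> r assume h: "phidiv \<phi> M (x j) (pm \<theta>) \<le> phidiv \<phi> M (x j) p0" "r < M"
      have "pm \<theta> r * \<phi> (x j r / pm \<theta> r) \<le> phidiv \<phi> M (x j) (pm \<theta>)"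
        using elim(1) h(2) pm_pos by (intro phidiv_nonneg_term[OF \<phi>]) auto
      hence "pm \<theta> r * \<phi> (x j r / pm \<theta> r) < c" using h(1) elim(2) by linarith
      thus "\<bar>x j r - pm \<theta> r\<bar> < e"
        using c(2)[of "x j r" "pm \<theta> r"] elim(1) h(2) pm_pos[of \<theta> r] pm_le_1[OF h(2), of \<theta>] by force
    qed
  qed
qed

text \<open>A competitor at least as good as \<open>\<theta>0\<close> has cell probabilities at
  least half those of \<open>p0\<close>; its log ratios are then bounded and its parameters lie in a
  fixed box. The minimum over that box is therefore global.\<close>

lemma eventually_minimiser_exists:
  fixes x :: "nat \<Rightarrow> nat \<Rightarrow> real"
  assumes \<phi>: "admissible \<phi>" and x: "\<forall>r<M. (\<lambda>j. x j r) \<longlonglongrightarrow> p0 r"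
  shows "\<forall>\<^sub>F j in sequentially. \<exists>\<theta>. \<forall>\<theta>'. phidiv \<phi> M (x j) (pm \<theta>) \<le> phidiv \<phi> M (x j) (pm \<theta>')"
proof -
  define m where "m = Min (p0 ` {..<M})"
  have fin: "finite (p0 ` {..<M})" "p0 ` {..<M} \<noteq> {}" using M_pos by auto
  have m: "0 < m" "\<And>r. r < M \<Longrightarrow> m \<le> p0 r"
    using fin pm_pos by (auto simp: m_def)
  have m1: "m \<le> 1" using m(2)[of 0] pm_le_1[of 0 \<theta>0] M_pos by simp
  obtain C where C: "C \<ge> 0" "\<And>a c B s. (\<forall>r<M. \<bar>a + lin c r\<bar> \<le> B) \<Longrightarrow> s < M0 \<Longrightarrow> \<bar>c s\<bar> \<le> C * B"
    using coefficients_bounded by blast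
  \<comment> \<open>\<open>ln 2\<close> controls the log ratio from below, by
    \<open>pm \<theta> r \<ge> p0 r / 2\<close>; \<open>ln (1 / m)\<close> controls it from above,
    by \<open>pm \<theta> r \<le> 1\<close> and \<open>p0 r \<ge> m\<close>.\<close>
  define B where "B = max (ln 2) (ln (1 / m))"
  have B: "B \<ge> 0" by (simp add: B_def le_max_iff_disj)
  have box: "\<bar>\<theta> s - \<theta>0 s\<bar> \<le> C * B" if big: "\<And>r. r < M \<Longrightarrow> pm \<theta> r \<ge> p0 r / 2" and s: "s < M0" for \<theta> s
  proof -
    obtain a where a: "\<And>r. ln (pm \<theta> r / p0 r) = a + (\<Sum>s<M0. W r s * (\<theta> s - \<theta>0 s))"
      using ln_pm_ratio by blast
    have "\<bar>ln (pm \<theta> r / p0 r)\<bar> \<le> B" if r: "r < M" for r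
    proof -
      have "1 / 2 \<le> pm \<theta> r / p0 r" using big[OF r] pm_pos[of \<theta>0 r] by (simp add: field_simps)
      hence "ln (1 / 2) \<le> ln (pm \<theta> r / p0 r)" using pm_pos by (subst ln_le_cancel_iff) auto
      moreover have "pm \<theta> r / p0 r \<le> 1 / m"
        using m(1) m(2)[OF r] pm_le_1[OF r, of \<theta>] pm_pos[of \<theta> r] by (intro frac_le) auto
      hence "ln (pm \<theta> r / p0 r) \<le> ln (1 / m)" using pm_pos m by (subst ln_le_cancel_iff) auto
      moreover have "ln (1 / 2 :: real) = - ln 2" by (simp add: ln_div)
      ultimately show ?thesis unfolding B_def by linarith
    qed
    hence "\<forall>r<M. \<bar>a + (\<Sum>s<M0. W r s * (\<theta> s - \<theta>0 s))\<bar> \<le> B" by (simp add: a)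
    from C(2)[OF this s] show ?thesis .
  qed
  \<comment> \<open>Two deviations of \<open>m / 4\<close> leave a competitor at least
    \<open>p0 r - m / 2\<close>, which is at least \<open>p0 r / 2\<close>.\<close>
  have close: "\<forall>\<^sub>F j in sequentially. \<forall>r\<in>{..<M}. \<bar>x j r - p0 r\<bar> < m / 4"
  proof (intro eventually_ball_finite ballI)
    fix r assume "r \<in> {..<M}"
    thus "\<forall>\<^sub>F j in sequentially. \<bar>x j r - p0 r\<bar> < m / 4"
      using tendstoD[OF x[rule_format, of r], of "m / 4"] m(1) by (simp add: dist_real_def)
  qed simp
  have "\<forall>\<^sub>F j in sequentially. \<forall>\<theta>. phidiv \<phi> M (x j) (pm \<theta>) \<le> phidiv \<phi> M (x j) p0 \<longrightarrow> (\<forall>r<M. \<bar>x j r - pm \<theta> r\<bar> < m / 4)"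
    using m(1) m1 by (intro eventually_close_of_small_phidiv[OF \<phi> x]) auto
  with close eventually_pos[OF x] show ?thesis
  proof eventually_elim
    case (elim j)
    obtain \<theta> where \<theta>: "\<And>\<theta>'. (\<forall>s<M0. \<bar>\<theta>' s - \<theta>0 s\<bar> \<le> C * B) \<Longrightarrow> phidiv \<phi> M (x j) (pm \<theta>) \<le> phidiv \<phi> M (x j) (pm \<theta>')"
      using phidiv_attains_min_on_box[OF \<phi>, of "x j" "C * B"] elim(2) B C(1) by auto
    show ?case
    proof (intro exI[of _ \<theta>] allI)
      fix \<theta>' :: "nat \<Rightarrow> real"
      show "phidiv \<phi> M (x j) (pm \<theta>) \<le> phidiv \<phi> M (x j) (pm \<theta>')"
      proof (cases "phidiv \<phi> M (x j) (pm \<theta>') \<le> phidiv \<phi> M (x j) p0")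
        case True
        have "pm \<theta>' r \<ge> p0 r / 2" if r: "r < M" for r
        proof -
          have "\<bar>x j r - pm \<theta>' r\<bar> < m / 4" "\<bar>x j r - p0 r\<bar> < m / 4" using elim(1,3) True r by auto
          thus ?thesis using m(2)[OF r] by linarith
        qed
        thus ?thesis by (intro \<theta> allI impI box) auto
      next
        case False
        have "phidiv \<phi> M (x j) (pm \<theta>) \<le> phidiv \<phi> M (x j) p0" using B C(1) by (intro \<theta>) auto
        thus ?thesis using False by simp
      qed
    qed
  qed
qed

lemma minimiser_consistent:
  fixes x :: "nat \<Rightarrow> nat \<Rightarrow> real" and \<theta> :: "nat \<Rightarrow> nat \<Rightarrow> real"
  assumes \<phi>: "admissible \<phi>" and x: "\<forall>r<M. (\<lambda>j. x j r) \<longlonglongrightarrow> p0 r"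
    and min: "\<forall>\<^sub>F j in sequentially. \<forall>\<theta>'. phidiv \<phi> M (x j) (pm (\<theta> j)) \<le> phidiv \<phi> M (x j) (pm \<theta>')"
    and r: "r < M"
  shows "(\<lambda>j. pm (\<theta> j) r) \<longlonglongrightarrow> p0 r"
proof -
  have "(\<lambda>j. x j r - pm (\<theta> j) r) \<longlonglongrightarrow> 0"
  proof (rule tendstoI)
    fix e :: real assume e: "e > 0"
    have "\<forall>\<^sub>F j in sequentially. \<forall>\<theta>. phidiv \<phi> M (x j) (pm \<theta>) \<le> phidiv \<phi> M (x j) p0 \<longrightarrow> (\<forall>r<M. \<bar>x j r - pm \<theta> r\<bar> < min e (1/2))"
      using e by (intro eventually_close_of_small_phidiv[OF \<phi> x]) auto
    with min show "\<forall>\<^sub>F j in sequentially. dist (x j r - pm (\<theta> j) r) 0 < e"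
      by eventually_elim (use r in \<open>auto simp: dist_real_def\<close>)
  qed
  from tendsto_diff[OF x[rule_format, OF r] this] show ?thesis by simp
qed

section \<open>Quadratic expansion of the divergence and rate of the minimiser\<close>

lemma phidiv_expansion:
  fixes x q :: "nat \<Rightarrow> nat \<Rightarrow> real"
  assumes \<phi>: "admissible \<phi>"
    and x: "\<forall>r<M. (\<lambda>j. x j r) \<longlonglongrightarrow> p0 r" and q: "\<forall>r<M. (\<lambda>j. q j r) \<longlonglongrightarrow> p0 r"
    and qpos: "\<And>j r. q j r > 0"
    and bd: "\<forall>r<M. \<forall>\<^sub>F j in sequentially. \<bar>S j * (x j r - q j r)\<^sup>2\<bar> \<le> K"
  shows "(\<lambda>j. S j * (2 / deriv (deriv \<phi>) 1 * phidiv \<phi> M (x j) (q j)) - S j * (\<Sum>r<M. (x j r - q j r)\<^sup>2 / p0 r)) \<longlonglongrightarrow> 0"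
proof -
  obtain \<psi> where \<psi>: "isCont \<psi> 1" "\<psi> 1 = 1"
    "\<And>x q. q > 0 \<Longrightarrow> 2 / deriv (deriv \<phi>) 1 * (q * \<phi> (x / q)) = \<psi> (x / q) * ((x - q)\<^sup>2 / q)"
    using divergence_term_quadratic[OF \<phi>] by blast
  \<comment> \<open>In this exact form the first factor of each summand tends to 0 and the second is
    bounded by \<open>bd\<close>.\<close>
  have eq: "S j * (2 / deriv (deriv \<phi>) 1 * phidiv \<phi> M (x j) (q j)) - S j * (\<Sum>r<M. (x j r - q j r)\<^sup>2 / p0 r)
     = (\<Sum>r<M. (\<psi> (x j r / q j r) / q j r - 1 / p0 r) * (S j * (x j r - q j r)\<^sup>2))" for j
  proof -
    have "2 / deriv (deriv \<phi>) 1 * phidiv \<phi> M (x j) (q j) = (\<Sum>r<M. \<psi> (x j r / q j r) * ((x j r - q j r)\<^sup>2 / q j r))"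
      unfolding phidiv_def sum_distrib_left by (intro sum.cong refl \<psi>(3) qpos)
    thus ?thesis by (simp add: sum_distrib_left sum_subtractf[symmetric] algebra_simps)
  qed
  have "(\<lambda>j. \<Sum>r<M. (\<psi> (x j r / q j r) / q j r - 1 / p0 r) * (S j * (x j r - q j r)\<^sup>2)) \<longlonglongrightarrow> (\<Sum>r<M. 0)"
  proof (intro tendsto_sum)
    fix r assume "r \<in> {..<M}"
    hence r: "r < M" by simp
    have p: "p0 r \<noteq> 0" using pm_pos[of \<theta>0 r] by simp
    have "(\<lambda>j. x j r / q j r) \<longlonglongrightarrow> p0 r / p0 r"
      using x[rule_format, OF r] q[rule_format, OF r] p by (intro tendsto_intros)
    hence "(\<lambda>j. \<psi> (x j r / q j r)) \<longlonglongrightarrow> \<psi> 1"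
      using p by (intro isCont_tendsto_compose[OF \<psi>(1)]) simp
    hence "(\<lambda>j. \<psi> (x j r / q j r) / q j r - 1 / p0 r) \<longlonglongrightarrow> \<psi> 1 / p0 r - 1 / p0 r"
      using q[rule_format, OF r] p by (intro tendsto_intros)
    hence "(\<lambda>j. \<psi> (x j r / q j r) / q j r - 1 / p0 r) \<longlonglongrightarrow> 0" by (simp add: \<psi>(2))
    from null_mult_bounded[OF this bd[rule_format, OF r]]
    show "(\<lambda>j. (\<psi> (x j r / q j r) / q j r - 1 / p0 r) * (S j * (x j r - q j r)\<^sup>2)) \<longlonglongrightarrow> 0" .
  qed
  thus ?thesis unfolding eq by simp
qed

text \<open>The expansion bounds the scaled divergence at \<open>p0\<close>, and minimality passes
  the bound on to \<open>q j\<close>. Once \<open>\<psi>\<close> exceeds 1/2, and since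
  \<open>q j r \<le> 1\<close>, each scaled square is at most twice the scaled divergence.\<close>

lemma minimiser_rate:
  fixes x q :: "nat \<Rightarrow> nat \<Rightarrow> real"
  assumes \<phi>: "admissible \<phi>" and S0: "\<And>j. S j \<ge> 0"
    and x: "\<forall>r<M. (\<lambda>j. x j r) \<longlonglongrightarrow> p0 r" and q: "\<forall>r<M. (\<lambda>j. q j r) \<longlonglongrightarrow> p0 r"
    and qpos: "\<And>j r. q j r > 0" and q1: "\<And>j r. r < M \<Longrightarrow> q j r \<le> 1"
    and bd: "\<And>j r. r < M \<Longrightarrow> \<bar>sqrt (S j) * (x j r - p0 r)\<bar> \<le> K"
    and min: "\<forall>\<^sub>F j in sequentially. phidiv \<phi> M (x j) (q j) \<le> phidiv \<phi> M (x j) p0"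
  shows "\<exists>K'. \<forall>r<M. \<forall>\<^sub>F j in sequentially. \<bar>S j * (x j r - q j r)\<^sup>2\<bar> \<le> K'"
proof -
  let ?c = "2 / deriv (deriv \<phi>) 1"
  have c: "?c > 0" using \<phi> by (simp add: admissible_def)
  obtain \<psi> where \<psi>: "isCont \<psi> 1" "\<psi> 1 = 1"
    "\<And>x q. q > 0 \<Longrightarrow> ?c * (q * \<phi> (x / q)) = \<psi> (x / q) * ((x - q)\<^sup>2 / q)"
    using divergence_term_quadratic[OF \<phi>] by blast
  have K0: "K \<ge> 0" using bd[of 0 0] M_pos by simp
  have bd2: "S j * (x j r - p0 r)\<^sup>2 \<le> K\<^sup>2" if "r < M" for j r
  proof -
    have "(\<bar>sqrt (S j) * (x j r - p0 r)\<bar>)\<^sup>2 \<le> K\<^sup>2" using bd[OF that] by (intro power_mono) auto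
    thus ?thesis using S0[of j] by (simp add: power_mult_distrib)
  qed
  have "(\<lambda>j. S j * (?c * phidiv \<phi> M (x j) p0) - S j * (\<Sum>r<M. (x j r - p0 r)\<^sup>2 / p0 r)) \<longlonglongrightarrow> 0"
    using bd2 S0 pm_pos
    by (intro phidiv_expansion[OF \<phi> x, where K="K\<^sup>2"]) (auto intro!: always_eventually simp: abs_mult)
  from order_tendstoD(2)[OF this, of 1]
  have ev1: "\<forall>\<^sub>F j in sequentially. S j * (?c * phidiv \<phi> M (x j) p0) - S j * (\<Sum>r<M. (x j r - p0 r)\<^sup>2 / p0 r) < 1" by simp
  define B where "B = 1 + (\<Sum>r<M. K\<^sup>2 / p0 r)"
  have "\<forall>\<^sub>F j in sequentially. \<bar>S j * (x j r - q j r)\<^sup>2\<bar> \<le> 2 * B" if r: "r < M" for r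
  proof -
    have p: "p0 r \<noteq> 0" using pm_pos[of \<theta>0 r] by simp
    have "(\<lambda>j. x j r / q j r) \<longlonglongrightarrow> p0 r / p0 r"
      using x[rule_format, OF r] q[rule_format, OF r] p by (intro tendsto_intros)
    hence "(\<lambda>j. \<psi> (x j r / q j r)) \<longlonglongrightarrow> \<psi> 1"
      using p by (intro isCont_tendsto_compose[OF \<psi>(1)]) simp
    from order_tendstoD(1)[OF this, of "1 / 2"]
    have "\<forall>\<^sub>F j in sequentially. \<psi> (x j r / q j r) > 1 / 2" using \<psi>(2) by simp
    thus ?thesis using ev1 min eventually_pos[OF x]
    proof eventually_elim
      case (elim j)
      have "S j * (\<Sum>r<M. (x j r - p0 r)\<^sup>2 / p0 r) = (\<Sum>r<M. S j * (x j r - p0 r)\<^sup>2 / p0 r)"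
        by (simp add: sum_distrib_left)
      also have "\<dots> \<le> (\<Sum>r<M. K\<^sup>2 / p0 r)"
        using bd2 pm_pos by (intro sum_mono divide_right_mono) (auto intro: less_imp_le)
      finally have 1: "S j * (?c * phidiv \<phi> M (x j) p0) \<le> B" using elim(2) by (simp add: B_def)
      have "1 / 2 * (x j r - q j r)\<^sup>2 \<le> \<psi> (x j r / q j r) * ((x j r - q j r)\<^sup>2 / q j r)"
      proof (rule mult_mono)
        have "(x j r - q j r)\<^sup>2 / 1 \<le> (x j r - q j r)\<^sup>2 / q j r"
          using qpos[of j r] q1[OF r, of j] by (intro divide_left_mono) auto
        thus "(x j r - q j r)\<^sup>2 \<le> (x j r - q j r)\<^sup>2 / q j r" by simp
      qed (use elim(1) in auto)
      also have "\<dots> = ?c * (q j r * \<phi> (x j r / q j r))" by (rule \<psi>(3)[OF qpos, symmetric])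
      also have "\<dots> \<le> ?c * phidiv \<phi> M (x j) (q j)"
        using c elim(4) qpos r by (intro mult_left_mono phidiv_nonneg_term[OF \<phi>]) auto
      also have "\<dots> \<le> ?c * phidiv \<phi> M (x j) p0" using c elim(3) by (intro mult_left_mono) auto
      finally have "S j * (1 / 2 * (x j r - q j r)\<^sup>2) \<le> S j * (?c * phidiv \<phi> M (x j) p0)"
        using S0 by (intro mult_left_mono) auto
      thus ?case using 1 S0[of j] by (simp add: abs_mult)
    qed
  qed
  thus ?thesis by blast
qed

section \<open>Distance to the model surface against distance to the tangent space\<close>

context
  fixes b C :: "nat \<Rightarrow> nat \<Rightarrow> real" and S :: "nat \<Rightarrow> real" and x :: "nat \<Rightarrow> nat \<Rightarrow> real" and K :: real
  assumes bC: "tangent_complement b C"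
    and S: "filterlim S at_top sequentially" and S0: "\<And>j. S j \<ge> 0"
    and bd: "\<And>j r. r < M \<Longrightarrow> \<bar>sqrt (S j) * (x j r - p0 r)\<bar> \<le> K"
    and xsum: "\<And>j. (\<Sum>r<M. x j r) = 1"
begin

private definition y where "y j r = (x j r - p0 r) / sqrt (p0 r)"

private lemma sqp: "sqrt (p0 r) > 0" "sqrt (p0 r) * sqrt (p0 r) = p0 r"
  using pm_pos[of \<theta>0 r] by auto

private lemma scaled_residual:
  "c * (x j r - p0 r * t) / sqrt (p0 r) = c * (y j r - sqrt (p0 r) * (t - 1))"
proof -
  have "p0 r / sqrt (p0 r) = sqrt (p0 r)" using pm_pos[of \<theta>0 r] by (intro real_div_sqrt) auto
  hence "(x j r - p0 r * t) / sqrt (p0 r) = y j r - sqrt (p0 r) * (t - 1)"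
    unfolding y_def diff_divide_distrib by (simp add: right_diff_distrib times_divide_eq_left[symmetric] del: times_divide_eq_left)
  thus ?thesis unfolding times_divide_eq_right[symmetric] by (simp only:)
qed

private lemma x_lim: "\<forall>r<M. (\<lambda>j. x j r) \<longlonglongrightarrow> p0 r"
  using bd by (intro allI impI tendsto_of_sqrt_rate[OF S])

private lemma dotp_y_bounded: "\<exists>B. \<forall>j. \<bar>sqrt (S j) * dotp M v (y j)\<bar> \<le> B"
proof (intro exI allI)
  fix j
  have "\<bar>sqrt (S j) * dotp M v (y j)\<bar> = \<bar>\<Sum>r<M. v r / sqrt (p0 r) * (sqrt (S j) * (x j r - p0 r))\<bar>"
    unfolding dotp_def y_def sum_distrib_left by (intro arg_cong[where f=abs] sum.cong) auto
  also have "\<dots> \<le> (\<Sum>r<M. \<bar>v r / sqrt (p0 r) * (sqrt (S j) * (x j r - p0 r))\<bar>)" by (rule sum_abs)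
  also have "\<dots> \<le> (\<Sum>r<M. \<bar>v r / sqrt (p0 r)\<bar> * K)"
    unfolding abs_mult[of "v _ / sqrt (p0 _)"] using bd by (intro sum_mono mult_left_mono) auto
  finally show "\<bar>sqrt (S j) * dotp M v (y j)\<bar> \<le> (\<Sum>r<M. \<bar>v r / sqrt (p0 r)\<bar> * K)" .
qed

private lemma b_orth_tangent:
  assumes "i < dof"
  shows "(\<Sum>r<M. b i r * (sqrt (p0 r) * (a + lin c r))) = 0"
  using bC assms unfolding tangent_complement_def by blast

text \<open>The competitor shifts \<open>\<theta>0\<close> by the tangential coefficients
  \<open>c j\<close> of \<open>y j\<close>. To first order its tilt is
  \<open>1 + z j r - zb j\<close>, where \<open>zb j\<close> comes from the normaliser, so the
  deviation of the data from it is asymptotically the component along \<open>b\<close>, with squared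
  length \<open>d j\<close>.\<close>

private lemma tangent_point:
  defines "d \<equiv> (\<lambda>j. S j * (\<Sum>i<dof. (dotp M (b i) (y j))\<^sup>2))"
  shows "\<exists>\<theta>'. (\<forall>r<M. (\<lambda>j. pm (\<theta>' j) r) \<longlonglongrightarrow> p0 r)
     \<and> (\<exists>K'. \<forall>r<M. \<forall>\<^sub>F j in sequentially. \<bar>S j * (x j r - pm (\<theta>' j) r)\<^sup>2\<bar> \<le> K')
     \<and> (\<lambda>j. S j * (\<Sum>r<M. (x j r - pm (\<theta>' j) r)\<^sup>2 / p0 r) - d j) \<longlonglongrightarrow> 0"
proof -
  define c where "c j s = dotp M (C (Suc s)) (y j)" for j s
  define z where "z j r = (lin (c j) r)" for j r
  define a where "a j = dotp M (C 0) (y j)" for j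
  define Bv where "Bv j r = (\<Sum>i<dof. (sqrt (S j) * dotp M (b i) (y j)) * b i r)" for j r
  define zb where "zb j = (\<Sum>r<M. p0 r * z j r)" for j
  define E where "E j = (\<Sum>r<M. p0 r * exp (z j r))" for j
  define q where "q j r = pm (\<lambda>s. \<theta>0 s + c j s) r" for j r
  have q: "q j r = p0 r * exp (z j r) / E j" for j r
    unfolding q_def pm_shift E_def z_def ..
  have dec: "y j r = sqrt (p0 r) * (a j + z j r) + (\<Sum>i<dof. dotp M (b i) (y j) * b i r)" if "r < M" for j r
    using bC[unfolded tangent_complement_def, THEN conjunct2, THEN conjunct2, rule_format, of r "y j"] that
    unfolding a_def z_def c_def by blast
  \<comment> \<open>Pairing the decomposition with \<open>sqrt (p0 r)\<close> kills the
    \<open>b\<close> part by orthogonality, and the left side because \<open>x j\<close> and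
    \<open>p0\<close> both sum to 1. Thus the coefficient of the constant equals the first-order
    effect of the normaliser.\<close>
  have a: "a j = - zb j" for j
  proof -
    have "0 = (\<Sum>r<M. sqrt (p0 r) * y j r)"
      using xsum[of j] pm_sum[of \<theta>0] sqp(1)[THEN less_imp_neq] by (simp add: y_def sum_subtractf)
    also have "\<dots> = (\<Sum>r<M. p0 r * (a j + z j r) + (\<Sum>i<dof. dotp M (b i) (y j) * (b i r * sqrt (p0 r))))"
    proof (rule sum.cong[OF refl])
      fix r assume "r \<in> {..<M}"
      hence "sqrt (p0 r) * y j r = sqrt (p0 r) * (sqrt (p0 r) * (a j + z j r) + (\<Sum>i<dof. dotp M (b i) (y j) * b i r))"
        using dec by simp
      also have "\<dots> = (sqrt (p0 r) * sqrt (p0 r)) * (a j + z j r) + (\<Sum>i<dof. dotp M (b i) (y j) * (b i r * sqrt (p0 r)))"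
        by (simp only: distrib_left sum_distrib_left mult_ac)
      finally show "sqrt (p0 r) * y j r = p0 r * (a j + z j r) + (\<Sum>i<dof. dotp M (b i) (y j) * (b i r * sqrt (p0 r)))"
        unfolding sqp(2) .
    qed
    also have "\<dots> = (\<Sum>r<M. p0 r) * a j + zb j + (\<Sum>r<M. \<Sum>i<dof. dotp M (b i) (y j) * (b i r * sqrt (p0 r)))"
      by (simp add: sum.distrib distrib_left zb_def sum_distrib_right)
    also have "(\<Sum>r<M. \<Sum>i<dof. dotp M (b i) (y j) * (b i r * sqrt (p0 r))) = (\<Sum>i<dof. dotp M (b i) (y j) * (\<Sum>r<M. b i r * sqrt (p0 r)))"
      by (subst sum.swap) (simp add: sum_distrib_left)
    also have "\<dots> = 0"
      using b_orth_tangent[of _ 1 "\<lambda>_. 0"] by (intro sum.neutral) auto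
    finally show ?thesis by (simp add: pm_sum)
  qed
  have "\<forall>v. \<exists>B. \<forall>j. \<bar>sqrt (S j) * dotp M v (y j)\<bar> \<le> B" using dotp_y_bounded by blast
  then obtain Bf where Bf: "\<And>v j. \<bar>sqrt (S j) * dotp M v (y j)\<bar> \<le> Bf v" by metis
  have "\<exists>Kz. \<forall>j. \<bar>sqrt (S j) * z j r\<bar> \<le> Kz" for r
  proof -
    define B where "B s = Bf (C (Suc s))" for s
    have B: "\<bar>sqrt (S j) * c j s\<bar> \<le> B s" for s j unfolding c_def B_def by (rule Bf)
    have "\<bar>sqrt (S j) * z j r\<bar> \<le> (\<Sum>s<M0. \<bar>W r s\<bar> * B s)" for j
    proof -
      have "sqrt (S j) * z j r = (\<Sum>s<M0. W r s * (sqrt (S j) * c j s))"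
        by (simp add: z_def sum_distrib_left mult_ac)
      also have "\<bar>\<dots>\<bar> \<le> (\<Sum>s<M0. \<bar>W r s * (sqrt (S j) * c j s)\<bar>)" by (rule sum_abs)
      also have "\<dots> \<le> (\<Sum>s<M0. \<bar>W r s\<bar> * B s)"
        unfolding abs_mult[of "W _ _"] using B by (intro sum_mono mult_left_mono) auto
      finally show ?thesis .
    qed
    thus ?thesis by blast
  qed
  then obtain Kz where Kz: "\<And>r j. \<bar>sqrt (S j) * z j r\<bar> \<le> Kz r" by metis
  have ez: "(\<lambda>j. sqrt (S j) * (exp (z j r) - 1 - z j r)) \<longlonglongrightarrow> 0" and z0: "(\<lambda>j. z j r) \<longlonglongrightarrow> 0" for r
    using scaled_exp_linear[OF S, of "\<lambda>j. z j r" "Kz r"] Kz by auto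
  have E1: "E \<longlonglongrightarrow> 1"
  proof -
    have "E \<longlonglongrightarrow> (\<Sum>r<M. p0 r * exp 0)" unfolding E_def[abs_def] by (intro tendsto_intros z0)
    thus ?thesis by (simp add: pm_sum)
  qed
  have Epos: "E j > 0" for j unfolding E_def using M_pos pm_pos by (intro sum_pos) auto
  have eE: "(\<lambda>j. sqrt (S j) * (E j - 1 - zb j)) \<longlonglongrightarrow> 0"
  proof -
    have "E j - 1 - zb j = (\<Sum>r<M. p0 r * (exp (z j r) - 1 - z j r))" for j
      by (simp add: E_def zb_def right_diff_distrib sum_subtractf pm_sum)
    hence "sqrt (S j) * (E j - 1 - zb j) = (\<Sum>r<M. p0 r * (sqrt (S j) * (exp (z j r) - 1 - z j r)))" for j
      by (simp add: sum_distrib_left mult_ac)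
    moreover have "(\<lambda>j. \<Sum>r<M. p0 r * (sqrt (S j) * (exp (z j r) - 1 - z j r))) \<longlonglongrightarrow> (\<Sum>r<M. p0 r * 0)"
      by (intro tendsto_intros ez)
    ultimately show ?thesis by simp
  qed
  have zbb: "\<bar>sqrt (S j) * (z j r - zb j)\<bar> \<le> Kz r + (\<Sum>r<M. p0 r * Kz r)" for j r
  proof -
    have "sqrt (S j) * zb j = (\<Sum>r<M. p0 r * (sqrt (S j) * z j r))" by (simp add: zb_def sum_distrib_left mult_ac)
    also have "\<bar>\<dots>\<bar> \<le> (\<Sum>r<M. \<bar>p0 r * (sqrt (S j) * z j r)\<bar>)" by (rule sum_abs)
    also have "\<dots> \<le> (\<Sum>r<M. p0 r * Kz r)"
      unfolding abs_mult[of "p0 _"] using Kz pm_pos by (intro sum_mono mult_mono) (auto simp: less_imp_le)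
    finally show ?thesis using Kz[of j r] unfolding right_diff_distrib by linarith
  qed
  \<comment> \<open>Multiplying by \<open>E j\<close> splits the error into the linearisation errors
    of \<open>exp (z j r)\<close> and of \<open>E j\<close> and the product of
    \<open>E j - 1\<close> with a bounded sequence.\<close>
  have lin: "(\<lambda>j. sqrt (S j) * (exp (z j r) / E j - 1 - (z j r - zb j))) \<longlonglongrightarrow> 0" for r
  proof -
    have "(\<lambda>j. (E j - 1) * (sqrt (S j) * (z j r - zb j))) \<longlonglongrightarrow> 0"
    proof (rule null_mult_bounded)
      show "(\<lambda>j. E j - 1) \<longlonglongrightarrow> 0" using tendsto_diff[OF E1 tendsto_const[of 1]] by simp
    qed (use zbb in \<open>auto intro: always_eventually\<close>)
    hence "(\<lambda>j. (sqrt (S j) * (exp (z j r) - 1 - z j r) - sqrt (S j) * (E j - 1 - zb j)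
        - (E j - 1) * (sqrt (S j) * (z j r - zb j))) / E j) \<longlonglongrightarrow> (0 - 0 - 0) / 1"
      by (intro tendsto_intros ez eE E1) auto
    moreover have "(sqrt (S j) * (exp (z j r) - 1 - z j r) - sqrt (S j) * (E j - 1 - zb j)
        - (E j - 1) * (sqrt (S j) * (z j r - zb j))) / E j = sqrt (S j) * (exp (z j r) / E j - 1 - (z j r - zb j))" for j
      using Epos[of j] by (simp add: field_simps)
    ultimately show ?thesis by simp
  qed
  define A where "A j r = sqrt (S j) * (x j r - q j r) / sqrt (p0 r)" for j r
  \<comment> \<open>\<open>A\<close> is the scaled deviation from the model point, \<open>Bv\<close>
    the one from its linearisation; the previous limit is their difference up to the factor
    \<open>- sqrt (p0 r)\<close>.\<close>
  have AB: "(\<lambda>j. A j r - Bv j r) \<longlonglongrightarrow> 0" if r: "r < M" for r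
  proof -
    have "A j r - Bv j r = - sqrt (p0 r) * (sqrt (S j) * (exp (z j r) / E j - 1 - (z j r - zb j)))" for j
    proof -
      have "Bv j r = sqrt (S j) * (\<Sum>i<dof. dotp M (b i) (y j) * b i r)"
        by (simp add: Bv_def sum_distrib_left mult_ac)
      also have "(\<Sum>i<dof. dotp M (b i) (y j) * b i r) = y j r - sqrt (p0 r) * (z j r - zb j)"
        using dec[OF r, of j] a[of j] by (simp add: algebra_simps)
      finally have 1: "Bv j r = sqrt (S j) * (y j r - sqrt (p0 r) * (z j r - zb j))" .
      have "q j r = p0 r * (exp (z j r) / E j)" unfolding q by simp
      hence 2: "A j r = sqrt (S j) * (y j r - sqrt (p0 r) * (exp (z j r) / E j - 1))"
        unfolding A_def by (simp only: scaled_residual)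
      show ?thesis unfolding 1 2 by (simp add: algebra_simps)
    qed
    moreover have "(\<lambda>j. - sqrt (p0 r) * (sqrt (S j) * (exp (z j r) / E j - 1 - (z j r - zb j)))) \<longlonglongrightarrow> - sqrt (p0 r) * 0"
      by (intro tendsto_intros lin)
    ultimately show ?thesis by simp
  qed
  have "\<exists>KB. \<forall>j. \<bar>Bv j r\<bar> \<le> KB" for r
  proof -
    define B where "B i = Bf (b i)" for i
    have B: "\<bar>sqrt (S j) * dotp M (b i) (y j)\<bar> \<le> B i" for i j unfolding B_def by (rule Bf)
    have "\<bar>Bv j r\<bar> \<le> (\<Sum>i<dof. B i * \<bar>b i r\<bar>)" for j
    proof -
      have "\<bar>Bv j r\<bar> \<le> (\<Sum>i<dof. \<bar>(sqrt (S j) * dotp M (b i) (y j)) * b i r\<bar>)" unfolding Bv_def by (rule sum_abs)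
      also have "\<dots> \<le> (\<Sum>i<dof. B i * \<bar>b i r\<bar>)"
        unfolding abs_mult[of _ "b _ r"] using B by (intro sum_mono mult_right_mono) auto
      finally show ?thesis .
    qed
    thus ?thesis by blast
  qed
  then obtain KB where KB: "\<And>r j. \<bar>Bv j r\<bar> \<le> KB r" by metis
  have A2: "(A j r)\<^sup>2 = S j * ((x j r - q j r)\<^sup>2 / p0 r)" for j r
    using S0[of j] pm_pos[of \<theta>0 r] by (simp add: A_def power_divide power_mult_distrib)
  have d: "d j = (\<Sum>r<M. (Bv j r)\<^sup>2)" for j
  proof -
    have "(\<Sum>r<M. (Bv j r)\<^sup>2) = (\<Sum>i<dof. (sqrt (S j) * dotp M (b i) (y j))\<^sup>2)"
      unfolding Bv_def using bC unfolding tangent_complement_def by (intro orthonormal_norm_combination) blast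
    thus ?thesis using S0[of j] by (simp add: d_def power_mult_distrib sum_distrib_left)
  qed
  have "(\<lambda>j. \<Sum>r<M. (A j r)\<^sup>2 - (Bv j r)\<^sup>2) \<longlonglongrightarrow> (\<Sum>r<M. 0)"
    using KB by (intro tendsto_sum diff_squares_null[OF AB]) (auto intro: always_eventually)
  hence 3: "(\<lambda>j. S j * (\<Sum>r<M. (x j r - q j r)\<^sup>2 / p0 r) - d j) \<longlonglongrightarrow> 0"
    unfolding d A2 sum_subtractf by (simp add: sum_distrib_left)
  have 1: "(\<lambda>j. q j r) \<longlonglongrightarrow> p0 r" for r
  proof -
    have "(\<lambda>j. q j r) \<longlonglongrightarrow> p0 r * exp 0 / 1" unfolding q by (intro tendsto_intros z0 E1) auto
    thus ?thesis by simp
  qed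
  have 2: "\<forall>\<^sub>F j in sequentially. \<bar>S j * (x j r - q j r)\<^sup>2\<bar> \<le> (\<Sum>r<M. (KB r + 1)\<^sup>2)" if r: "r < M" for r
  proof -
    have "\<forall>\<^sub>F j in sequentially. \<bar>A j r - Bv j r\<bar> < 1"
      using order_tendstoD(2)[OF tendsto_rabs_zero[OF AB[OF r]], of 1] by simp
    thus ?thesis
    proof eventually_elim
      case (elim j)
      have "\<bar>A j r\<bar> \<le> KB r + 1" using elim KB[of j r] by linarith
      hence "(A j r)\<^sup>2 \<le> (KB r + 1)\<^sup>2" using abs_le_square_iff[of "A j r" "KB r + 1"] by simp
      moreover have "S j * (x j r - q j r)\<^sup>2 = p0 r * (A j r)\<^sup>2" using pm_pos[of \<theta>0 r] by (simp add: A2)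
      moreover have "p0 r * (A j r)\<^sup>2 \<le> 1 * (A j r)\<^sup>2" using pm_le_1[OF r] by (intro mult_right_mono) auto
      moreover have "(KB r + 1)\<^sup>2 \<le> (\<Sum>r<M. (KB r + 1)\<^sup>2)"
        using r by (intro member_le_sum[of r "{..<M}" "\<lambda>r. (KB r + 1)\<^sup>2"]) auto
      moreover have "S j * (x j r - q j r)\<^sup>2 \<ge> 0" using S0[of j] by simp
      ultimately show ?case by linarith
    qed
  qed
  show ?thesis
    using 1 2 3 unfolding q_def by (intro exI[of _ "\<lambda>j s. \<theta>0 s + c j s"]) blast
qed

text \<open>By \<open>ln_pm_ratio\<close>, subtracting the weighted log ratio \<open>z\<close> from
  \<open>y\<close> leaves the coordinates along \<open>b\<close> unchanged, so Bessel bounds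
  \<open>d j\<close> by the squared norm of \<open>B j\<close>. That norm differs from the scaled
  Pearson distance only through the linearisation error of \<open>exp\<close>.\<close>

private lemma model_distance_lower:
  fixes \<theta> :: "nat \<Rightarrow> nat \<Rightarrow> real"
  defines "d \<equiv> (\<lambda>j. S j * (\<Sum>i<dof. (dotp M (b i) (y j))\<^sup>2))"
  assumes q: "\<forall>r<M. (\<lambda>j. pm (\<theta> j) r) \<longlonglongrightarrow> p0 r"
    and qb: "\<forall>r<M. \<forall>\<^sub>F j in sequentially. \<bar>S j * (x j r - pm (\<theta> j) r)\<^sup>2\<bar> \<le> K'"
  shows "\<exists>g. g \<longlonglongrightarrow> 0 \<and> (\<forall>j. S j * (\<Sum>r<M. (x j r - pm (\<theta> j) r)\<^sup>2 / p0 r) - d j \<ge> g j)"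
proof -
  define z where "z j r = ln (pm (\<theta> j) r / p0 r)" for j r
  have qz: "pm (\<theta> j) r = p0 r * exp (z j r)" for j r
    using pm_pos[of "\<theta> j" r] pm_pos[of \<theta>0 r] by (simp add: z_def)
  define A where "A j r = sqrt (S j) * (x j r - pm (\<theta> j) r) / sqrt (p0 r)" for j r
  define B where "B j r = sqrt (S j) * (y j r - sqrt (p0 r) * z j r)" for j r
  have xq: "\<forall>\<^sub>F j in sequentially. \<bar>sqrt (S j) * (x j r - pm (\<theta> j) r)\<bar> \<le> sqrt K'" if r: "r < M" for r
    using qb[rule_format, OF r]
  proof eventually_elim
    case (elim j)
    have "sqrt (S j * (x j r - pm (\<theta> j) r)\<^sup>2) \<le> sqrt K'" using elim S0[of j] by (intro real_sqrt_le_mono) (simp add: abs_mult)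
    thus ?case using S0[of j] by (simp add: real_sqrt_mult abs_mult)
  qed
  \<comment> \<open>For \<open>|t| < 1 / 2\<close> the logarithm satisfies
    \<open>|ln (1 + t)| \<le> 2 * |t|\<close>. With \<open>t\<close> the relative deviation of the
    model point from \<open>p0\<close>, the triangle inequality through \<open>x\<close> gives the
    constant.\<close>
  have zb: "\<forall>\<^sub>F j in sequentially. \<bar>sqrt (S j) * z j r\<bar> \<le> 2 * (sqrt K' + K) / p0 r" if r: "r < M" for r
  proof -
    have p: "p0 r > 0" by (rule pm_pos)
    have "(\<lambda>j. pm (\<theta> j) r / p0 r - 1) \<longlonglongrightarrow> p0 r / p0 r - 1"
      using q[rule_format, OF r] p by (intro tendsto_intros) auto
    hence "(\<lambda>j. \<bar>pm (\<theta> j) r / p0 r - 1\<bar>) \<longlonglongrightarrow> 0" using p by (intro tendsto_rabs_zero) simp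
    from order_tendstoD(2)[OF this, of "1 / 2"]
    have "\<forall>\<^sub>F j in sequentially. \<bar>pm (\<theta> j) r / p0 r - 1\<bar> < 1 / 2" by simp
    thus ?thesis using xq[OF r]
    proof eventually_elim
      case (elim j)
      let ?t = "pm (\<theta> j) r / p0 r - 1"
      have "\<bar>ln (1 + ?t) - ?t\<bar> \<le> 2 * ?t\<^sup>2" using elim(1) by (intro abs_ln_one_plus_x_minus_x_bound) auto
      also have "2 * ?t\<^sup>2 = 2 * \<bar>?t\<bar> * \<bar>?t\<bar>" by (simp add: power2_eq_square)
      also have "\<dots> \<le> 1 * \<bar>?t\<bar>" using elim(1) by (intro mult_right_mono) auto
      finally have "\<bar>ln (1 + ?t) - ?t\<bar> \<le> \<bar>?t\<bar>" by simp
      moreover have "z j r = ln (1 + ?t)" by (simp add: z_def)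
      moreover have "\<bar>u\<bar> \<le> 2 * \<bar>t\<bar>" if "\<bar>u - t\<bar> \<le> \<bar>t\<bar>" for u t :: real using that by linarith
      ultimately have zt: "\<bar>z j r\<bar> \<le> 2 * \<bar>?t\<bar>" by (simp only:)
      have t: "?t = (pm (\<theta> j) r - p0 r) / p0 r" using p by (simp add: field_simps)
      have "\<bar>sqrt (S j) * z j r\<bar> \<le> sqrt (S j) * (2 * \<bar>?t\<bar>)"
        using zt S0[of j] by (auto simp: abs_mult intro: mult_left_mono)
      also have "\<dots> = 2 * \<bar>sqrt (S j) * (pm (\<theta> j) r - p0 r)\<bar> / p0 r"
        unfolding t using p S0[of j] by (simp add: abs_mult)
      also have "\<dots> \<le> 2 * (sqrt K' + K) / p0 r"
      proof -
        have "sqrt (S j) * (pm (\<theta> j) r - p0 r) = sqrt (S j) * (x j r - p0 r) - sqrt (S j) * (x j r - pm (\<theta> j) r)"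
          by (simp add: algebra_simps)
        hence "\<bar>sqrt (S j) * (pm (\<theta> j) r - p0 r)\<bar> \<le> sqrt K' + K" using elim(2) bd[OF r, of j] by linarith
        thus ?thesis using p by (intro divide_right_mono) auto
      qed
      finally show ?case .
    qed
  qed
  have BA: "(\<lambda>j. B j r - A j r) \<longlonglongrightarrow> 0" if r: "r < M" for r
  proof -
    have "(\<lambda>j. sqrt (p0 r) * (sqrt (S j) * (exp (z j r) - 1 - z j r))) \<longlonglongrightarrow> sqrt (p0 r) * 0"
      by (intro tendsto_intros scaled_exp_linear(1)[OF S zb[OF r]])
    moreover have "B j r - A j r = sqrt (p0 r) * (sqrt (S j) * (exp (z j r) - 1 - z j r))" for j
    proof -
      have "A j r = sqrt (S j) * (y j r - sqrt (p0 r) * (exp (z j r) - 1))"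
        unfolding A_def qz by (rule scaled_residual)
      thus ?thesis by (simp add: B_def algebra_simps)
    qed
    ultimately show ?thesis by simp
  qed
  have Ab: "\<forall>\<^sub>F j in sequentially. \<bar>A j r\<bar> \<le> sqrt K' / sqrt (p0 r)" if r: "r < M" for r
    using xq[OF r]
  proof eventually_elim
    case (elim j)
    have "\<bar>A j r\<bar> = \<bar>sqrt (S j) * (x j r - pm (\<theta> j) r)\<bar> / sqrt (p0 r)"
      using sqp(1)[of r] by (simp add: A_def)
    also have "\<dots> \<le> sqrt K' / sqrt (p0 r)" using elim sqp(1)[of r] by (intro divide_right_mono) auto
    finally show ?case .
  qed
  define g where "g j = - (\<Sum>r<M. (B j r)\<^sup>2 - (A j r)\<^sup>2)" for j
  have "(\<lambda>j. - (\<Sum>r<M. (B j r)\<^sup>2 - (A j r)\<^sup>2)) \<longlonglongrightarrow> - (\<Sum>r<M. 0)"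
    by (intro tendsto_intros diff_squares_null[OF BA Ab]) auto
  hence g0: "g \<longlonglongrightarrow> 0" by (simp add: g_def[abs_def])
  have A2: "(A j r)\<^sup>2 = S j * ((x j r - pm (\<theta> j) r)\<^sup>2 / p0 r)" for j r
    using S0[of j] pm_pos[of \<theta>0 r] by (simp add: A_def power_divide power_mult_distrib)
  have dB: "d j \<le> (\<Sum>r<M. (B j r)\<^sup>2)" for j
  proof -
    obtain a where a: "\<And>r. z j r = a + (\<Sum>s<M0. W r s * (\<theta> j s - \<theta>0 s))"
      unfolding z_def using ln_pm_ratio by blast
    have bB: "dotp M (b i) (B j) = sqrt (S j) * dotp M (b i) (y j)" if "i < dof" for i
    proof -
      have "dotp M (b i) (B j) = sqrt (S j) * (dotp M (b i) (y j) - (\<Sum>r<M. b i r * (sqrt (p0 r) * z j r)))"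
        by (simp add: dotp_def B_def sum_distrib_left sum_subtractf algebra_simps)
      thus ?thesis unfolding a b_orth_tangent[OF that] by simp
    qed
    have "d j = (\<Sum>i<dof. (dotp M (b i) (B j))\<^sup>2)"
      using S0[of j] bB by (simp add: d_def power_mult_distrib sum_distrib_left)
    also have "\<dots> \<le> dotp M (B j) (B j)"
      using bC unfolding tangent_complement_def by (intro bessel) blast
    finally show ?thesis by (simp add: dotp_def power2_eq_square)
  qed
  have "g j \<le> S j * (\<Sum>r<M. (x j r - pm (\<theta> j) r)\<^sup>2 / p0 r) - d j" for j
    using dB[of j] unfolding g_def sum_subtractf A2 by (simp add: sum_distrib_left)
  thus ?thesis using g0 by blast
qed

text \<open>Minimality is available for \<open>\<phi>2\<close> only, so the sandwich for the Pearson
  distance \<open>Q\<close> is run with \<open>\<phi>2\<close>: bounded below by \<open>d\<close> up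
  to a null sequence at any point with the right rate, and above by comparison with the tangential
  competitor. The expansion for \<open>\<phi>1\<close> then transfers the result to the
  statistic.\<close>

theorem divergence_statistic_asymptotics:
  fixes \<theta> :: "nat \<Rightarrow> nat \<Rightarrow> real"
  assumes \<phi>1: "admissible \<phi>1" and \<phi>2: "admissible \<phi>2"
    and min: "\<forall>\<^sub>F j in sequentially. \<forall>\<theta>'. phidiv \<phi>2 M (x j) (pm (\<theta> j)) \<le> phidiv \<phi>2 M (x j) (pm \<theta>')"
  shows "(\<lambda>j. S j * (2 / deriv (deriv \<phi>1) 1 * phidiv \<phi>1 M (x j) (pm (\<theta> j)))
     - S j * (\<Sum>i<dof. (dotp M (b i) (\<lambda>r. (x j r - p0 r) / sqrt (p0 r)))\<^sup>2)) \<longlonglongrightarrow> 0"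
proof -
  define d where "d j = S j * (\<Sum>i<dof. (dotp M (b i) (y j))\<^sup>2)" for j
  have q: "\<forall>r<M. (\<lambda>j. pm (\<theta> j) r) \<longlonglongrightarrow> p0 r"
    using minimiser_consistent[OF \<phi>2 x_lim min] by blast
  have "\<forall>\<^sub>F j in sequentially. phidiv \<phi>2 M (x j) (pm (\<theta> j)) \<le> phidiv \<phi>2 M (x j) p0"
    using min by eventually_elim blast
  then obtain K' where K': "\<forall>r<M. \<forall>\<^sub>F j in sequentially. \<bar>S j * (x j r - pm (\<theta> j) r)\<^sup>2\<bar> \<le> K'"
    using minimiser_rate[OF \<phi>2 S0 x_lim q pm_pos pm_le_1 bd] by blast
  obtain \<theta>' Ku where t1: "\<forall>r<M. (\<lambda>j. pm (\<theta>' j) r) \<longlonglongrightarrow> p0 r"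
    and t2: "\<forall>r<M. \<forall>\<^sub>F j in sequentially. \<bar>S j * (x j r - pm (\<theta>' j) r)\<^sup>2\<bar> \<le> Ku"
    and t3: "(\<lambda>j. S j * (\<Sum>r<M. (x j r - pm (\<theta>' j) r)\<^sup>2 / p0 r) - d j) \<longlonglongrightarrow> 0"
    using tangent_point unfolding d_def by blast
  obtain g where g: "g \<longlonglongrightarrow> 0" "\<And>j. S j * (\<Sum>r<M. (x j r - pm (\<theta> j) r)\<^sup>2 / p0 r) - d j \<ge> g j"
    using model_distance_lower[OF q K'] unfolding d_def by blast
  define P where "P \<phi> \<theta> j = S j * (2 / deriv (deriv \<phi>) 1 * phidiv \<phi> M (x j) (pm (\<theta> j)))" for \<phi> and \<theta> :: "nat \<Rightarrow> nat \<Rightarrow> real" and j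
  define Q where "Q \<theta> j = S j * (\<Sum>r<M. (x j r - pm (\<theta> j) r)\<^sup>2 / p0 r)" for \<theta> :: "nat \<Rightarrow> nat \<Rightarrow> real" and j
  have PQ1: "(\<lambda>j. P \<phi>1 \<theta> j - Q \<theta> j) \<longlonglongrightarrow> 0"
    unfolding P_def Q_def by (rule phidiv_expansion[OF \<phi>1 x_lim q pm_pos K'])
  have PQ2: "(\<lambda>j. P \<phi>2 \<theta> j - Q \<theta> j) \<longlonglongrightarrow> 0"
    unfolding P_def Q_def by (rule phidiv_expansion[OF \<phi>2 x_lim q pm_pos K'])
  have PQ3: "(\<lambda>j. P \<phi>2 \<theta>' j - Q \<theta>' j) \<longlonglongrightarrow> 0"
    unfolding P_def Q_def by (rule phidiv_expansion[OF \<phi>2 x_lim t1 pm_pos t2])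
  have Qd: "(\<lambda>j. Q \<theta>' j - d j) \<longlonglongrightarrow> 0" using t3 by (simp add: Q_def)
  have c2: "2 / deriv (deriv \<phi>2) 1 \<ge> 0" using \<phi>2 by (simp add: admissible_def)
  have "(\<lambda>j. Q \<theta> j - d j) \<longlonglongrightarrow> 0"
  proof (rule tendsto_sandwich[OF _ _ g(1)])
    show "\<forall>\<^sub>F j in sequentially. g j \<le> Q \<theta> j - d j" using g(2) by (simp add: Q_def)
    show "\<forall>\<^sub>F j in sequentially. Q \<theta> j - d j \<le> - (P \<phi>2 \<theta> j - Q \<theta> j) + (P \<phi>2 \<theta>' j - Q \<theta>' j) + (Q \<theta>' j - d j)"
      using min
    proof eventually_elim
      case (elim j)
      hence "P \<phi>2 \<theta> j \<le> P \<phi>2 \<theta>' j" unfolding P_def using S0 c2 by (intro mult_left_mono) auto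
      thus ?case by linarith
    qed
    have "(\<lambda>j. - (P \<phi>2 \<theta> j - Q \<theta> j) + (P \<phi>2 \<theta>' j - Q \<theta>' j) + (Q \<theta>' j - d j)) \<longlonglongrightarrow> - 0 + 0 + 0"
      by (intro tendsto_intros PQ2 PQ3 Qd)
    thus "(\<lambda>j. - (P \<phi>2 \<theta> j - Q \<theta> j) + (P \<phi>2 \<theta>' j - Q \<theta>' j) + (Q \<theta>' j - d j)) \<longlonglongrightarrow> 0" by simp
  qed
  from tendsto_add[OF PQ1 this] have "(\<lambda>j. P \<phi>1 \<theta> j - d j) \<longlonglongrightarrow> 0" by simp
  thus ?thesis unfolding P_def d_def y_def[abs_def] .
qed

end

end

section \<open>Cluster samples with unequal cluster sizes\<close>

text \<open>One infinite array of clusters on a single probability space serves every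
  \<open>N\<close>: sample \<open>N\<close> consists of the first \<open>Ns N g\<close> clusters of
  each group \<open>g\<close>.\<close>

locale cluster_sample = loglinear M M0 W \<theta>0 + prob_space \<Omega>
  for M M0 :: nat and W :: "nat \<Rightarrow> nat \<Rightarrow> real" and \<theta>0 :: "nat \<Rightarrow> real" and \<Omega> :: "'a measure" +
  fixes G :: nat and n :: "nat \<Rightarrow> nat" and Ns :: "nat \<Rightarrow> nat \<Rightarrow> nat" and Nstar :: "nat \<Rightarrow> real"
    and Y :: "nat \<Rightarrow> nat \<Rightarrow> 'a \<Rightarrow> nat \<Rightarrow> nat" and rho2 :: real
  assumes M_ge: "M \<ge> 3" and M0_less: "M0 < M - 1"
    and G: "G \<ge> 1"
    and n_ge2: "\<And>g. g < G \<Longrightarrow> n g \<ge> 2"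
    and N_sum: "\<And>N. (\<Sum>g<G. Ns N g) = N"
    and N_lim: "\<And>g. g < G \<Longrightarrow> (\<lambda>N. real (Ns N g) / real N) \<longlonglongrightarrow> Nstar g"
    and Nstar: "\<And>g. g < G \<Longrightarrow> 0 < Nstar g"
    and Y_meas: "\<And>g l. g < G \<Longrightarrow>
        (\<lambda>\<omega>. restrict (Y g l \<omega>) {..<M}) \<in> measurable \<Omega> (Pi\<^sub>M {..<M} (\<lambda>_. count_space UNIV))"
    and Y_indep: "indep_vars (\<lambda>_. Pi\<^sub>M {..<M} (\<lambda>_. count_space UNIV))
        (\<lambda>(g, l) \<omega>. restrict (Y g l \<omega>) {..<M}) ({..<G} \<times> UNIV)"
    and Y_sum: "\<And>g l \<omega>. g < G \<Longrightarrow> \<omega> \<in> space \<Omega> \<Longrightarrow> (\<Sum>r<M. Y g l \<omega> r) = n g"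
    and Y_mean: "\<And>g l r. g < G \<Longrightarrow> r < M \<Longrightarrow> expectation (\<lambda>\<omega>. real (Y g l \<omega> r)) = real (n g) * p0 r"
    and rho2: "rho2 \<ge> 0"
    and Y_cov: "\<And>g l r s. g < G \<Longrightarrow> r < M \<Longrightarrow> s < M \<Longrightarrow>
        expectation (\<lambda>\<omega>. (real (Y g l \<omega> r) - real (n g) * p0 r) * (real (Y g l \<omega> s) - real (n g) * p0 s))
        = (1 + (real (n g) - 1) * rho2) * real (n g) * ((if r = s then p0 r else 0) - p0 r * p0 s)"
begin

abbreviation dv :: "nat \<Rightarrow> nat \<Rightarrow> nat \<Rightarrow> 'a \<Rightarrow> real" where
  "dv g l r \<omega> \<equiv> real (Y g l \<omega> r) - real (n g) * p0 r"

section \<open>Sample sizes, weights and their limits\<close>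

definition S :: "nat \<Rightarrow> real" where "S N = real (\<Sum>h<G. n h * Ns N h)"

definition phat :: "nat \<Rightarrow> 'a \<Rightarrow> nat \<Rightarrow> real" where
  "phat N \<omega> r = real (\<Sum>g<G. \<Sum>l<Ns N g. Y g l \<omega> r) / S N"

definition vt :: "nat \<Rightarrow> real" where "vt g = 1 + (real (n g) - 1) * rho2"

text \<open>The limit of \<open>Ns N g / S N\<close>. Hence \<open>real (n g) * cstar g\<close> is
  the limiting weight of group \<open>g\<close>, and \<open>vstar\<close> the limit of the weighted
  design effect.\<close>

definition cstar :: "nat \<Rightarrow> real" where "cstar g = Nstar g / (\<Sum>h<G. real (n h) * Nstar h)"

definition vstar :: real where "vstar = (\<Sum>g<G. real (n g) * cstar g * vt g)"

definition nb :: real where "nb = (\<Sum>g<G. real (n g))"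

definition idx :: "nat \<Rightarrow> (nat \<times> nat) set" where "idx N = Sigma {..<G} (\<lambda>g. {..<Ns N g})"

lemma idx: "finite (idx N)" "idx N \<subseteq> {..<G} \<times> UNIV" "card (idx N) = N"
  using N_sum[of N] by (auto simp: idx_def)

lemma sum_idx: "(\<Sum>i\<in>idx N. f i) = (\<Sum>g<G. \<Sum>l<Ns N g. f (g, l))"
  unfolding idx_def by (subst sum.Sigma) auto

lemma n_le_nb: "g < G \<Longrightarrow> real (n g) \<le> nb"
  unfolding nb_def by (intro member_le_sum[of g _ "\<lambda>g. real (n g)"]) auto

lemma nb_pos: "nb > 0"
  using n_le_nb[of 0] n_ge2[of 0] G by simp

lemma S_nonneg: "S N \<ge> 0" unfolding S_def by (rule of_nat_0_le_iff)

lemma S_ge: "S N \<ge> real N"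
proof -
  have "N = (\<Sum>g<G. 1 * Ns N g)" using N_sum[of N] by simp
  also have "\<dots> \<le> (\<Sum>g<G. n g * Ns N g)" using n_ge2 by (intro sum_mono mult_right_mono) force+
  finally show ?thesis unfolding S_def by (rule of_nat_mono)
qed

lemma S_pos: "N > 0 \<Longrightarrow> S N > 0" using S_ge[of N] by simp

lemma S_at_top: "filterlim S at_top sequentially"
  by (rule filterlim_at_top_mono[OF filterlim_real_sequentially]) (simp add: S_ge)

lemma Ns_at_top:
  assumes "g < G" shows "filterlim (\<lambda>N. real (Ns N g)) at_top sequentially"
proof -
  have "filterlim (\<lambda>N. real (Ns N g) / real N * real N) at_top sequentially"
    by (rule filterlim_tendsto_pos_mult_at_top[OF N_lim[OF assms] Nstar[OF assms] filterlim_real_sequentially])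
  thus ?thesis
  proof (rule filterlim_cong[OF refl refl, THEN iffD1, rotated])
    show "\<forall>\<^sub>F N in sequentially. real (Ns N g) / real N * real N = real (Ns N g)"
      using eventually_gt_at_top[of 0] by eventually_elim simp
  qed
qed

lemma denom_star_pos: "(\<Sum>h<G. real (n h) * Nstar h) > 0"
  using G Nstar n_ge2 by (intro sum_pos) (auto intro!: mult_pos_pos simp: lessThan_empty_iff, force)

lemma Ns_ratio:
  assumes "g < G" shows "(\<lambda>N. real (Ns N g) / S N) \<longlonglongrightarrow> cstar g"
proof -
  have "(\<lambda>N. (real (Ns N g) / real N) / (\<Sum>h<G. real (n h) * (real (Ns N h) / real N))) \<longlonglongrightarrow> cstar g"
    unfolding cstar_def using denom_star_pos assms by (intro tendsto_intros N_lim) auto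
  thus ?thesis
  proof (rule Lim_transform_eventually)
    show "\<forall>\<^sub>F N in sequentially. (real (Ns N g) / real N) / (\<Sum>h<G. real (n h) * (real (Ns N h) / real N)) = real (Ns N g) / S N"
      using eventually_gt_at_top[of 0]
    proof eventually_elim
      case (elim N)
      have "(\<Sum>h<G. real (n h) * (real (Ns N h) / real N)) = S N / real N"
        by (simp add: S_def sum_divide_distrib)
      thus ?case using elim by simp
    qed
  qed
qed

lemma vt_ge_1: "g < G \<Longrightarrow> vt g \<ge> 1"
  using n_ge2[of g] rho2 by (simp add: vt_def)

lemma vstar_pos: "vstar > 0"
  unfolding vstar_def
proof (rule sum_pos)
  fix g assume "g \<in> {..<G}"
  hence g: "g < G" by simp
  show "0 < real (n g) * cstar g * vt g"
    using n_ge2[OF g] vt_ge_1[OF g] Nstar[OF g] denom_star_pos by (simp add: cstar_def)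
qed (use G in \<open>auto simp: lessThan_empty_iff\<close>)

section \<open>Range, independence and moments of the cluster counts\<close>

lemma Y_le: "g < G \<Longrightarrow> r < M \<Longrightarrow> \<omega> \<in> space \<Omega> \<Longrightarrow> Y g l \<omega> r \<le> n g"
  using Y_sum[of g \<omega> l] member_le_sum[of r "{..<M}" "Y g l \<omega>"] by auto

lemma coord_measurable:
  assumes "r < M"
  shows "(\<lambda>f. h (f r) :: real) \<in> borel_measurable (Pi\<^sub>M {..<M} (\<lambda>_. count_space (UNIV :: nat set)))"
  by (rule measurable_compose[OF measurable_component_singleton[of r "{..<M}" "\<lambda>_. count_space UNIV"]])
     (use assms in auto)

lemma Y_coord_measurable:
  assumes "g < G" "r < M" shows "(\<lambda>\<omega>. h (Y g l \<omega> r) :: real) \<in> borel_measurable \<Omega>"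
proof -
  have "(\<lambda>\<omega>. h (restrict (Y g l \<omega>) {..<M} r)) \<in> borel_measurable \<Omega>"
    by (rule measurable_compose[OF Y_meas[OF assms(1)] coord_measurable[OF assms(2)]])
  thus ?thesis using assms(2) by simp
qed

lemma Y_compose_indep:
  assumes "\<And>g. g < G \<Longrightarrow> F g \<in> borel_measurable (Pi\<^sub>M {..<M} (\<lambda>_. count_space UNIV))"
  shows "indep_vars (\<lambda>_. borel) (\<lambda>i \<omega>. F (fst i) (restrict (Y (fst i) (snd i) \<omega>) {..<M}) :: real) ({..<G} \<times> UNIV)"
proof -
  have "indep_vars (\<lambda>_. borel) (\<lambda>i \<omega>. F (fst i) ((case i of (g, l) \<Rightarrow> \<lambda>\<omega>. restrict (Y g l \<omega>) {..<M}) \<omega>)) ({..<G} \<times> UNIV)"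
    by (rule indep_vars_compose2[OF Y_indep]) (use assms in auto)
  thus ?thesis by (simp add: case_prod_beta)
qed

lemma coord_indep:
  assumes "r < M"
  shows "indep_vars (\<lambda>_. borel) (\<lambda>i \<omega>. h (fst i) (Y (fst i) (snd i) \<omega> r) :: real) ({..<G} \<times> UNIV)"
  using Y_compose_indep[of "\<lambda>g f. h g (f r)", OF coord_measurable[OF assms]] assms by simp

definition X :: "(nat \<Rightarrow> real) \<Rightarrow> nat \<times> nat \<Rightarrow> 'a \<Rightarrow> real" where
  "X v i \<omega> = (\<Sum>r<M. v r * dv (fst i) (snd i) r \<omega>)"

lemma X_indep: "indep_vars (\<lambda>_. borel) (X v) ({..<G} \<times> UNIV)"
proof -
  have "indep_vars (\<lambda>_. borel) (\<lambda>i \<omega>. (\<lambda>g f. \<Sum>r<M. v r * (real (f r) - real (n g) * p0 r)) (fst i)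
      (restrict (Y (fst i) (snd i) \<omega>) {..<M})) ({..<G} \<times> UNIV)"
    by (rule Y_compose_indep) (auto intro!: borel_measurable_sum borel_measurable_times borel_measurable_diff coord_measurable)
  thus ?thesis unfolding X_def[abs_def] by simp
qed

lemma dev_bounded:
  assumes "g < G" "r < M" "\<omega> \<in> space \<Omega>"
  shows "\<bar>dv g l r \<omega>\<bar> \<le> real (n g)"
proof -
  have "0 \<le> real (n g) * p0 r" "real (n g) * p0 r \<le> real (n g) * 1"
    using pm_pos[of \<theta>0 r] pm_le_1[OF assms(2), of \<theta>0] by (auto intro: mult_left_mono simp del: mult_1_right)
  moreover have "real (Y g l \<omega> r) \<le> real (n g)" using Y_le[OF assms, of l] by simp
  ultimately show ?thesis by (simp add: abs_le_iff)
qed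

lemma X_bounded:
  assumes "i \<in> {..<G} \<times> UNIV" "\<omega> \<in> space \<Omega>"
  shows "\<bar>X v i \<omega>\<bar> \<le> (\<Sum>r<M. \<bar>v r\<bar> * nb)"
proof -
  have "\<bar>X v i \<omega>\<bar> \<le> (\<Sum>r<M. \<bar>v r * dv (fst i) (snd i) r \<omega>\<bar>)"
    unfolding X_def by (rule sum_abs)
  also have "\<dots> \<le> (\<Sum>r<M. \<bar>v r\<bar> * nb)"
    unfolding abs_mult using assms
    by (intro sum_mono mult_left_mono order_trans[OF dev_bounded n_le_nb]) auto
  finally show ?thesis .
qed

lemma dev_integrable:
  assumes "g < G" "r < M" shows "integrable \<Omega> (\<lambda>\<omega>. dv g l r \<omega>)"
  using dev_bounded[OF assms] Y_coord_measurable[OF assms, of "\<lambda>y. real y - real (n g) * p0 r" l]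
  by (intro integrable_const_bound[where B="real (n g)"]) auto

lemma dev_mult_integrable:
  assumes "g < G" "r < M" "s < M"
  shows "integrable \<Omega> (\<lambda>\<omega>. dv g l r \<omega> * dv g l s \<omega>)"
proof (rule integrable_const_bound[where B="real (n g) * real (n g)"])
  show "AE \<omega> in \<Omega>. norm (dv g l r \<omega> * dv g l s \<omega>) \<le> real (n g) * real (n g)"
    using dev_bounded[OF assms(1)] assms by (intro AE_I2) (auto simp: abs_mult intro!: mult_mono)
  show "(\<lambda>\<omega>. dv g l r \<omega> * dv g l s \<omega>) \<in> borel_measurable \<Omega>"
    using assms by (intro borel_measurable_times Y_coord_measurable)
qed

lemma dev_mean: "g < G \<Longrightarrow> r < M \<Longrightarrow> expectation (\<lambda>\<omega>. dv g l r \<omega>) = 0"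
  using dev_integrable[of g r l] Y_mean[of g r l]
    Bochner_Integration.integrable_add[OF dev_integrable[of g r l] integrable_const[of "real (n g) * p0 r"]]
  by (subst Bochner_Integration.integral_diff) (auto simp: prob_space)

lemma X_mean:
  assumes "i \<in> {..<G} \<times> UNIV" shows "expectation (X v i) = 0"
  unfolding X_def[abs_def] using assms
  by (subst Bochner_Integration.integral_sum) (auto intro!: dev_integrable sum.neutral simp: dev_mean)

text \<open>The bracket is the quadratic form of \<open>diag(p0) - p0 p0^T\<close>. Its subtracted
  square disappears for weights \<open>v\<close> orthogonal to \<open>p0\<close>, which is the case
  used later.\<close>

lemma X_variance:
  assumes i: "i \<in> {..<G} \<times> UNIV"
  shows "expectation (\<lambda>\<omega>. (X v i \<omega>)\<^sup>2) = vt (fst i) * real (n (fst i)) * ((\<Sum>r<M. (v r)\<^sup>2 * p0 r) - (\<Sum>r<M. v r * p0 r)\<^sup>2)"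
proof -
  obtain g l where gl: "i = (g, l)" and g: "g < G" using i by auto
  let ?d = "\<lambda>r \<omega>. dv g l r \<omega>"
  have "expectation (\<lambda>\<omega>. (X v i \<omega>)\<^sup>2) = expectation (\<lambda>\<omega>. \<Sum>r<M. \<Sum>s<M. v r * v s * (?d r \<omega> * ?d s \<omega>))"
    by (simp add: X_def gl power2_eq_square sum_product mult_ac)
  also have "\<dots> = (\<Sum>r<M. \<Sum>s<M. v r * v s * expectation (\<lambda>\<omega>. ?d r \<omega> * ?d s \<omega>))"
  proof -
    have int: "integrable \<Omega> (\<lambda>\<omega>. v r * v s * (?d r \<omega> * ?d s \<omega>))" if "r < M" "s < M" for r s
      using that by (intro integrable_mult_right dev_mult_integrable g)
    have "expectation (\<lambda>\<omega>. \<Sum>r<M. \<Sum>s<M. v r * v s * (?d r \<omega> * ?d s \<omega>))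
        = (\<Sum>r<M. expectation (\<lambda>\<omega>. \<Sum>s<M. v r * v s * (?d r \<omega> * ?d s \<omega>)))"
      by (rule Bochner_Integration.integral_sum) (intro Bochner_Integration.integrable_sum int, auto)
    also have "\<dots> = (\<Sum>r<M. \<Sum>s<M. expectation (\<lambda>\<omega>. v r * v s * (?d r \<omega> * ?d s \<omega>)))"
      by (intro sum.cong refl Bochner_Integration.integral_sum int) auto
    finally show ?thesis by (simp only: integral_mult_right_zero)
  qed
  also have "\<dots> = (\<Sum>r<M. \<Sum>s<M. v r * v s * (vt g * real (n g) * ((if r = s then p0 r else 0) - p0 r * p0 s)))"
    by (intro sum.cong refl) (simp add: Y_cov[OF g] vt_def)
  also have "\<dots> = vt g * real (n g) * (\<Sum>r<M. \<Sum>s<M. (if r = s then v r * v s * p0 r else 0) - (v r * p0 r) * (v s * p0 s))"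
    unfolding sum_distrib_left by (intro sum.cong refl) (simp add: algebra_simps)
  also have "(\<Sum>r<M. \<Sum>s<M. (if r = s then v r * v s * p0 r else 0) - (v r * p0 r) * (v s * p0 s))
     = (\<Sum>r<M. (v r)\<^sup>2 * p0 r) - (\<Sum>r<M. v r * p0 r)\<^sup>2"
    by (simp add: sum_subtractf power2_eq_square sum_product)
  finally show ?thesis by (simp add: gl)
qed

section \<open>Asymptotic normality along the complement of the tangent space\<close>

lemma phat_dev:
  assumes "r < M"
  shows "sqrt (S N) * (phat N \<omega> r - p0 r) = (\<Sum>i\<in>idx N. dv (fst i) (snd i) r \<omega>) / sqrt (S N)"
proof (cases "S N = 0")
  case False
  hence Sp: "S N > 0" using S_nonneg[of N] by simp
  have "(\<Sum>i\<in>idx N. dv (fst i) (snd i) r \<omega>)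
      = real (\<Sum>g<G. \<Sum>l<Ns N g. Y g l \<omega> r) - S N * p0 r"
    by (simp add: sum_idx sum_subtractf S_def sum_distrib_right sum_distrib_left mult_ac)
  also have "\<dots> = S N * (phat N \<omega> r - p0 r)"
    using Sp by (simp add: phat_def right_diff_distrib)
  finally have e: "(\<Sum>i\<in>idx N. dv (fst i) (snd i) r \<omega>) = S N * (phat N \<omega> r - p0 r)" .
  have "S N / sqrt (S N) = sqrt (S N)" using Sp by (intro real_div_sqrt) auto
  thus ?thesis unfolding e by (metis times_divide_eq_left)
qed simp

text \<open>Coordinates of the scaled deviation along \<open>b\<close>, divided by the root of the
  limiting design effect so that the limit is standard normal.\<close>

definition Z :: "(nat \<Rightarrow> nat \<Rightarrow> real) \<Rightarrow> nat \<Rightarrow> nat \<Rightarrow> 'a \<Rightarrow> real" where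
  "Z b N i \<omega> = sqrt (S N) / sqrt vstar * dotp M (b i) (\<lambda>r. (phat N \<omega> r - p0 r) / sqrt (p0 r))"

lemma phat_measurable: "r < M \<Longrightarrow> (\<lambda>\<omega>. phat N \<omega> r) \<in> borel_measurable \<Omega>"
  unfolding phat_def of_nat_sum
  by (intro borel_measurable_divide borel_measurable_sum borel_measurable_const Y_coord_measurable) auto

lemma Z_measurable: "Z b N i \<in> borel_measurable \<Omega>"
  unfolding Z_def[abs_def] dotp_def
  by (intro borel_measurable_times borel_measurable_sum borel_measurable_divide borel_measurable_diff
      borel_measurable_const phat_measurable) auto

lemma Z_combination:
  "(\<Sum>i<k. \<xi> i * Z b N i \<omega>) = 1 / (sqrt (S N) * sqrt vstar) * (\<Sum>i\<in>idx N. X (\<lambda>r. (\<Sum>i<k. \<xi> i * b i r) / sqrt (p0 r)) i \<omega>)"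
proof -
  let ?\<beta> = "\<lambda>r. \<Sum>i<k. \<xi> i * b i r"
  have "(\<Sum>i<k. \<xi> i * Z b N i \<omega>) = (\<Sum>i<k. \<Sum>r<M. \<xi> i * b i r * (sqrt (S N) * (phat N \<omega> r - p0 r)) / (sqrt vstar * sqrt (p0 r)))"
    by (simp add: Z_def dotp_def sum_distrib_left mult_ac)
  also have "\<dots> = (\<Sum>r<M. ?\<beta> r * (sqrt (S N) * (phat N \<omega> r - p0 r)) / (sqrt vstar * sqrt (p0 r)))"
    by (subst sum.swap) (simp add: sum_distrib_right sum_divide_distrib)
  also have "\<dots> = (\<Sum>r<M. \<Sum>i\<in>idx N. 1 / (sqrt (S N) * sqrt vstar) * (?\<beta> r / sqrt (p0 r) * dv (fst i) (snd i) r \<omega>))"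
  proof (rule sum.cong[OF refl])
    fix r assume "r \<in> {..<M}"
    hence r: "r < M" by simp
    show "?\<beta> r * (sqrt (S N) * (phat N \<omega> r - p0 r)) / (sqrt vstar * sqrt (p0 r))
      = (\<Sum>i\<in>idx N. 1 / (sqrt (S N) * sqrt vstar) * (?\<beta> r / sqrt (p0 r) * dv (fst i) (snd i) r \<omega>))"
      unfolding phat_dev[OF r] sum_distrib_left[symmetric] by (simp add: mult_ac)
  qed
  also have "\<dots> = 1 / (sqrt (S N) * sqrt vstar) * (\<Sum>i\<in>idx N. X (\<lambda>r. ?\<beta> r / sqrt (p0 r)) i \<omega>)"
    by (subst sum.swap) (simp add: X_def sum_distrib_left)
  finally show ?thesis .
qed

text \<open>For weights \<open>v = \<beta> / sqrt p0\<close> orthonormality of \<open>b\<close>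
  gives the first variance term the value \<open>Q\<close>, and orthogonality of \<open>b\<close> to
  \<open>sqrt p0\<close> removes the second. A cluster of group \<open>g\<close> then contributes
  \<open>vt g * n g * Q\<close>; averaging over groups produces \<open>vstar * Q\<close>, and the
  scaling in \<open>Z\<close> cancels \<open>vstar\<close>.\<close>

lemma Z_char_tendsto:
  assumes bC: "tangent_complement b C"
  shows "(\<lambda>N. \<integral>\<omega>. iexp (\<Sum>i<dof. \<xi> i * Z b N i \<omega>) \<partial>\<Omega>) \<longlonglongrightarrow> exp (- (\<Sum>i<dof. (\<xi> i)\<^sup>2) / 2)"
proof -
  define \<beta> where "\<beta> r = (\<Sum>i<dof. \<xi> i * b i r)" for r
  define v where "v r = \<beta> r / sqrt (p0 r)" for r
  define Q where "Q = (\<Sum>i<dof. (\<xi> i)\<^sup>2)"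
  define a where "a N = 1 / (sqrt (S N) * sqrt vstar)" for N
  have v1: "(\<Sum>r<M. (v r)\<^sup>2 * p0 r) = Q"
  proof -
    have "(v r)\<^sup>2 * p0 r = (\<beta> r)\<^sup>2" for r using pm_pos[of \<theta>0 r] by (simp add: v_def power_divide)
    hence "(\<Sum>r<M. (v r)\<^sup>2 * p0 r) = (\<Sum>r<M. (\<beta> r)\<^sup>2)" by simp
    also have "\<dots> = Q"
      unfolding Q_def \<beta>_def using bC unfolding tangent_complement_def by (intro orthonormal_norm_combination) blast
    finally show ?thesis .
  qed
  have v2: "(\<Sum>r<M. v r * p0 r) = 0"
  proof -
    have b0: "(\<Sum>r<M. b i r * sqrt (p0 r)) = 0" if "i < dof" for i
    proof -
      have "(\<Sum>r<M. b i r * (sqrt (p0 r) * (1 + (\<Sum>s<M0. W r s * 0)))) = 0"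
        using bC[unfolded tangent_complement_def, THEN conjunct2, THEN conjunct1, rule_format, OF that, of 1 "\<lambda>_. 0"] .
      thus ?thesis by simp
    qed
    have "v r * p0 r = (\<Sum>i<dof. \<xi> i * (b i r * sqrt (p0 r)))" for r
    proof -
      have "v r * p0 r = \<beta> r * (p0 r / sqrt (p0 r))" by (simp add: v_def)
      also have "p0 r / sqrt (p0 r) = sqrt (p0 r)" using pm_pos[of \<theta>0 r] by (intro real_div_sqrt) auto
      finally show ?thesis by (simp add: \<beta>_def sum_distrib_left mult_ac)
    qed
    hence "(\<Sum>r<M. v r * p0 r) = (\<Sum>i<dof. \<xi> i * (\<Sum>r<M. b i r * sqrt (p0 r)))"
      by (simp add: sum_distrib_left sum.swap[of _ "{..<M}"])
    thus ?thesis using b0 by simp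
  qed
  have "(\<lambda>N. \<integral>\<omega>. iexp (a N * (\<Sum>i\<in>idx N. X v i \<omega>)) \<partial>\<Omega>) \<longlonglongrightarrow> exp (- Q / 2)"
  proof (rule bounded_array_clt[OF X_indep idx(1,2) X_bounded X_mean])
    show "expectation (\<lambda>\<omega>. (X v i \<omega>)\<^sup>2) = vt (fst i) * real (n (fst i)) * Q" if "i \<in> {..<G} \<times> UNIV" for i
      using X_variance[OF that, of v] v1 v2 by simp
    have "filterlim (\<lambda>N. sqrt (S N)) at_top sequentially" by (rule filterlim_compose[OF sqrt_at_top S_at_top])
    hence "filterlim (\<lambda>N. sqrt vstar * sqrt (S N)) at_top sequentially"
      using vstar_pos by (intro filterlim_tendsto_pos_mult_at_top[OF tendsto_const]) auto
    from tendsto_inverse_0_at_top[OF this] show "a \<longlonglongrightarrow> 0"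
      unfolding a_def[abs_def] by (simp add: inverse_eq_divide mult.commute)
    have a2: "(a N)\<^sup>2 = 1 / (S N * vstar)" for N
      using S_nonneg[of N] vstar_pos by (simp add: a_def power_divide power_mult_distrib)
    show "(a N)\<^sup>2 * real (card (idx N)) \<le> 1 / vstar" for N
    proof (cases "N = 0")
      case False
      hence "real N / S N \<le> 1" using S_ge[of N] S_pos[of N] by simp
      hence "real N / S N / vstar \<le> 1 / vstar" using vstar_pos by (intro divide_right_mono) auto
      thus ?thesis unfolding a2 idx(3) by simp
    qed (use vstar_pos in \<open>simp add: idx(3)\<close>)
    have "(\<lambda>N. (\<Sum>g<G. real (n g) * (real (Ns N g) / S N) * vt g) / vstar * Q) \<longlonglongrightarrow> (\<Sum>g<G. real (n g) * cstar g * vt g) / vstar * Q"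
      using vstar_pos by (intro tendsto_intros Ns_ratio) auto
    moreover have "(a N)\<^sup>2 * (\<Sum>i\<in>idx N. vt (fst i) * real (n (fst i)) * Q) = (\<Sum>g<G. real (n g) * (real (Ns N g) / S N) * vt g) / vstar * Q" for N
      unfolding a2 sum_idx by (simp add: sum_divide_distrib sum_distrib_left sum_distrib_right mult_ac)
    ultimately show "(\<lambda>N. (a N)\<^sup>2 * (\<Sum>i\<in>idx N. vt (fst i) * real (n (fst i)) * Q)) \<longlonglongrightarrow> Q"
      using vstar_pos by (simp add: vstar_def[symmetric])
  qed
  thus ?thesis unfolding Z_combination Q_def a_def v_def \<beta>_def .
qed

lemma phat_tight:
  assumes r: "r < M" and e: "e > 0"
  shows "\<exists>K. \<forall>\<^sub>F N in sequentially. prob {\<omega> \<in> space \<Omega>. \<bar>sqrt (S N) * (phat N \<omega> r - p0 r)\<bar> \<ge> K} \<le> e"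
proof (intro exI)
  \<comment> \<open>With this \<open>K\<close> Hoeffding's exponent is
    \<open>- (2 / e * (S N / real N))\<close>, at most \<open>- (2 / e)\<close> as
    \<open>S N \<ge> real N\<close>; and \<open>2 * exp (- (2 / e))\<close> is at most
    \<open>2 * e / (e + 2)\<close>, hence at most \<open>e\<close>.\<close>
  define K where "K = nb / sqrt e"
  have K: "K > 0" using nb_pos e by (simp add: K_def)
  show "\<forall>\<^sub>F N in sequentially. prob {\<omega> \<in> space \<Omega>. \<bar>sqrt (S N) * (phat N \<omega> r - p0 r)\<bar> \<ge> K} \<le> e"
    using eventually_gt_at_top[of 0]
  proof eventually_elim
    case (elim N)
    have Sp: "S N > 0" using elim by (rule S_pos)
    let ?V = "\<lambda>i \<omega>. real (Y (fst i) (snd i) \<omega> r)"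
    have mean: "expectation (?V i) = real (n (fst i)) * p0 r" if "i \<in> idx N" for i
      using that r by (auto simp: idx_def Y_mean)
    have eq: "{\<omega> \<in> space \<Omega>. \<bar>sqrt (S N) * (phat N \<omega> r - p0 r)\<bar> \<ge> K}
       = {\<omega> \<in> space \<Omega>. \<bar>\<Sum>i\<in>idx N. ?V i \<omega> - expectation (?V i)\<bar> \<ge> K * sqrt (S N)}"
      unfolding phat_dev[OF r] using Sp by (auto simp: mean field_simps)
    have "prob {\<omega> \<in> space \<Omega>. \<bar>\<Sum>i\<in>idx N. ?V i \<omega> - expectation (?V i)\<bar> \<ge> K * sqrt (S N)}
        \<le> 2 * exp (- 2 * (K * sqrt (S N))\<^sup>2 / (real (card (idx N)) * nb\<^sup>2))"
    proof (rule hoeffding_sum)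
      show "indep_vars (\<lambda>_. borel) ?V (idx N)"
        by (rule indep_vars_subset[OF coord_indep[OF r, of "\<lambda>_. real"] idx(2)])
      show "idx N \<noteq> {}" using idx(3)[of N] elim by auto
      show "?V i \<omega> \<in> {0..nb}" if "i \<in> idx N" "\<omega> \<in> space \<Omega>" for i \<omega>
      proof -
        have g: "fst i < G" using that(1) by (auto simp: idx_def)
        have "real (Y (fst i) (snd i) \<omega> r) \<le> real (n (fst i))" using Y_le[OF g r that(2)] by simp
        thus ?thesis using n_le_nb[OF g] by simp
      qed
      show "finite (idx N)" by (rule idx(1))
      show "0 \<le> K * sqrt (S N)" using K Sp by simp
    qed (rule nb_pos)
    moreover have "- 2 * (K * sqrt (S N))\<^sup>2 / (real (card (idx N)) * nb\<^sup>2) = - (2 / e * (S N / real N))"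
    proof -
      have "(K * sqrt (S N))\<^sup>2 = nb\<^sup>2 * S N / e"
        using Sp e by (simp add: K_def power_mult_distrib power_divide)
      thus ?thesis using nb_pos by (simp add: idx(3))
    qed
    ultimately have 1: "prob {\<omega> \<in> space \<Omega>. \<bar>sqrt (S N) * (phat N \<omega> r - p0 r)\<bar> \<ge> K} \<le> 2 * exp (- (2 / e * (S N / real N)))"
      unfolding eq by simp
    have "2 / e * 1 \<le> 2 / e * (S N / real N)" using S_ge[of N] elim e by (intro mult_left_mono) auto
    hence 2: "exp (- (2 / e * (S N / real N))) \<le> exp (- (2 / e))" by simp
    have "exp (2 / e) \<ge> 1 + 2 / e" by (rule exp_ge_add_one_self)
    moreover have "1 + 2 / e > 0" using e by (simp add: add_pos_pos)
    ultimately have "1 / exp (2 / e) \<le> 1 / (1 + 2 / e)" by (intro divide_left_mono) auto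
    hence 3: "exp (- (2 / e)) \<le> 1 / (1 + 2 / e)" by (simp add: exp_minus inverse_eq_divide)
    have 4: "2 * (1 / (1 + 2 / e)) \<le> e" using e by (simp add: field_simps)
    show ?case using 1 2 3 4 by linarith
  qed
qed

section \<open>Consistency of the design effect estimator\<close>

definition varc :: "nat \<Rightarrow> nat \<Rightarrow> real" where "varc g r = vt g * (p0 r * (1 - p0 r)) / real (n g)"

definition dev1 :: "nat \<Rightarrow> nat \<Rightarrow> nat \<Rightarrow> 'a \<Rightarrow> real" where
  "dev1 g r N \<omega> = (\<Sum>l<Ns N g. real (Y g l \<omega> r) / real (n g) - p0 r) / real (Ns N g)"

text \<open>\<open>dev1\<close> and \<open>dev2\<close> are the law-of-large-numbers errors of the
  first two moments of a cell proportion; \<open>varc g r\<close> is the variance of that proportion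
  in one cluster.\<close>

definition dev2 :: "nat \<Rightarrow> nat \<Rightarrow> nat \<Rightarrow> 'a \<Rightarrow> real" where
  "dev2 g r N \<omega> = (\<Sum>l<Ns N g. (real (Y g l \<omega> r) / real (n g) - p0 r)\<^sup>2 - varc g r) / real (Ns N g)"

lemma group_lln:
  assumes g: "g < G" and r: "r < M"
    and h: "\<And>l \<omega>. \<omega> \<in> space \<Omega> \<Longrightarrow> h (Y g l \<omega> r) \<in> {0..1}"
    and mean: "\<And>l. expectation (\<lambda>\<omega>. h (Y g l \<omega> r)) = \<mu>"
  shows "null_in_prob (\<lambda>N \<omega>. (\<Sum>l<Ns N g. h (Y g l \<omega> r) - \<mu>) / real (Ns N g))"
proof -
  have "null_in_prob (\<lambda>N \<omega>. (\<Sum>i\<in>{g} \<times> {..<Ns N g}. h (Y (fst i) (snd i) \<omega> r) - \<mu>) / real (card ({g} \<times> {..<Ns N g})))"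
  proof (rule bounded_weak_lln[where J="{g} \<times> UNIV" and B=1])
    show "indep_vars (\<lambda>_. borel) (\<lambda>i \<omega>. h (Y (fst i) (snd i) \<omega> r)) ({g} \<times> UNIV)"
      by (rule indep_vars_subset[OF coord_indep[OF r, of "\<lambda>_. h"]]) (use g in auto)
    show "filterlim (\<lambda>N. real (card ({g} \<times> {..<Ns N g}))) at_top sequentially"
      using Ns_at_top[OF g] by simp
  qed (use h mean in auto)
  moreover have "(\<Sum>i\<in>{g} \<times> {..<Ns N g}. h (Y (fst i) (snd i) \<omega> r) - \<mu>) = (\<Sum>l<Ns N g. h (Y g l \<omega> r) - \<mu>)" for N \<omega>
  proof -
    have "{g} \<times> {..<Ns N g} = Pair g ` {..<Ns N g}" by auto
    thus ?thesis by (simp add: sum.reindex inj_on_def)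
  qed
  ultimately show ?thesis by (simp add: card_cartesian_product)
qed

lemma ratio_range:
  assumes "g < G" "r < M" "\<omega> \<in> space \<Omega>" shows "real (Y g l \<omega> r) / real (n g) \<in> {0..1}"
  using Y_le[OF assms, of l] n_ge2[OF assms(1)] by (simp add: field_simps)

lemma dev1_null:
  assumes g: "g < G" and r: "r < M" shows "null_in_prob (dev1 g r)"
  unfolding dev1_def[abs_def]
proof (rule group_lln[OF g r, of "\<lambda>y. real y / real (n g)"])
  show "expectation (\<lambda>\<omega>. real (Y g l \<omega> r) / real (n g)) = p0 r" for l
    using Y_mean[OF g r, of l] n_ge2[OF g] by simp
qed (rule ratio_range[OF g r])

lemma dev2_null:
  assumes g: "g < G" and r: "r < M" shows "null_in_prob (dev2 g r)"
  unfolding dev2_def[abs_def]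
proof (rule group_lln[OF g r, of "\<lambda>y. (real y / real (n g) - p0 r)\<^sup>2"])
  have n: "real (n g) \<noteq> 0" using n_ge2[OF g] by simp
  fix l
  have "(\<lambda>\<omega>. (real (Y g l \<omega> r) / real (n g) - p0 r)\<^sup>2)
     = (\<lambda>\<omega>. (dv g l r \<omega> * dv g l r \<omega>) / (real (n g))\<^sup>2)"
    using n by (simp add: fun_eq_iff power2_eq_square field_simps)
  hence "expectation (\<lambda>\<omega>. (real (Y g l \<omega> r) / real (n g) - p0 r)\<^sup>2)
     = (vt g * real (n g) * (p0 r - p0 r * p0 r)) / (real (n g))\<^sup>2"
    using Y_cov[OF g r r, of l] by (simp add: vt_def)
  also have "\<dots> = varc g r" using n by (simp add: varc_def power2_eq_square field_simps)
  finally show "expectation (\<lambda>\<omega>. (real (Y g l \<omega> r) / real (n g) - p0 r)\<^sup>2) = varc g r" .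
  fix \<omega> assume "\<omega> \<in> space \<Omega>"
  hence "\<bar>real (Y g l \<omega> r) / real (n g) - p0 r\<bar> \<le> 1"
    using ratio_range[OF g r, of \<omega> l] pm_pos[of \<theta>0 r] pm_le_1[OF r, of \<theta>0] unfolding atLeastAtMost_iff by linarith
  thus "(real (Y g l \<omega> r) / real (n g) - p0 r)\<^sup>2 \<in> {0..1}" by (simp add: abs_square_le_1)
qed

text \<open>The plugged-in cell probabilities \<open>q\<close> are left as an argument, so that
  convergence of the estimator separates from consistency of the fitted model.\<close>

definition vt_hat_group :: "(nat \<Rightarrow> real) \<Rightarrow> nat \<Rightarrow> 'a \<Rightarrow> nat \<Rightarrow> real" where
  "vt_hat_group q N \<omega> g = real (n g) / ((real (Ns N g) - 1) * (real M - 1))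
     * (\<Sum>r<M. 1 / q r * (\<Sum>l<Ns N g. (real (Y g l \<omega> r) / real (n g)
          - real (\<Sum>l<Ns N g. Y g l \<omega> r) / (real (n g) * real (Ns N g)))\<^sup>2))"

definition vt_hat :: "(nat \<Rightarrow> real) \<Rightarrow> nat \<Rightarrow> 'a \<Rightarrow> real" where
  "vt_hat q N \<omega> = (\<Sum>g<G. real (n g) * real (Ns N g) / S N * vt_hat_group q N \<omega> g)"

text \<open>Shifting the centre from the sample mean to a fixed \<open>c\<close>; with
  \<open>c = p0 r\<close> the right side involves only averages of independent variables.\<close>

lemma sum_square_dev:
  fixes f :: "nat \<Rightarrow> real"
  assumes "m > 0"
  shows "(\<Sum>l<m. (f l - (\<Sum>l<m. f l) / real m)\<^sup>2)
     = real m * ((\<Sum>l<m. (f l - c)\<^sup>2) / real m - ((\<Sum>l<m. f l - c) / real m)\<^sup>2)"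
proof -
  define t where "t = (\<Sum>l<m. f l - c) / real m"
  have ft: "(\<Sum>l<m. f l - c) = real m * t" using assms by (simp add: t_def)
  have "(\<Sum>l<m. f l) / real m = c + t" using assms by (simp add: t_def sum_subtractf diff_divide_distrib)
  hence "(\<Sum>l<m. (f l - (\<Sum>l<m. f l) / real m)\<^sup>2) = (\<Sum>l<m. (f l - c)\<^sup>2 - 2 * t * (f l - c) + t\<^sup>2)"
    by (intro sum.cong refl) (simp add: power2_eq_square algebra_simps)
  also have "\<dots> = (\<Sum>l<m. (f l - c)\<^sup>2) - 2 * t * (real m * t) + real m * t\<^sup>2"
    by (simp add: sum.distrib sum_subtractf sum_distrib_left[symmetric] ft[symmetric])
  also have "\<dots> = real m * ((\<Sum>l<m. (f l - c)\<^sup>2) / real m - t\<^sup>2)"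
    using assms by (simp add: power2_eq_square right_diff_distrib)
  finally show ?thesis by (simp add: t_def)
qed

text \<open>The whole dependence on the sample passes through \<open>dev1\<close>,
  \<open>dev2\<close> and \<open>q\<close>, so the limit of the estimator follows by
  continuity.\<close>

lemma vt_hat_group_eq:
  assumes "Ns N g > 0" "g < G"
  shows "vt_hat_group q N \<omega> g = real (Ns N g) / (real (Ns N g) - 1) * (real (n g) / (real M - 1)
     * (\<Sum>r<M. 1 / q r * (varc g r + dev2 g r N \<omega> - (dev1 g r N \<omega>)\<^sup>2)))"
proof -
  have "(\<Sum>l<Ns N g. (real (Y g l \<omega> r) / real (n g) - real (\<Sum>l<Ns N g. Y g l \<omega> r) / (real (n g) * real (Ns N g)))\<^sup>2)
      = real (Ns N g) * (varc g r + dev2 g r N \<omega> - (dev1 g r N \<omega>)\<^sup>2)" for r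
  proof -
    have "real (\<Sum>l<Ns N g. Y g l \<omega> r) / (real (n g) * real (Ns N g)) = (\<Sum>l<Ns N g. real (Y g l \<omega> r) / real (n g)) / real (Ns N g)"
      by (simp add: sum_divide_distrib)
    moreover have "(\<Sum>l<Ns N g. (real (Y g l \<omega> r) / real (n g) - p0 r)\<^sup>2) / real (Ns N g) = varc g r + dev2 g r N \<omega>"
      using assms(1) by (simp add: dev2_def sum_subtractf diff_divide_distrib)
    ultimately show ?thesis
      using sum_square_dev[OF assms(1), of "\<lambda>l. real (Y g l \<omega> r) / real (n g)" "p0 r"] by (simp add: dev1_def)
  qed
  thus ?thesis unfolding vt_hat_group_def by (simp add: sum_distrib_left mult_ac)
qed

lemma vt_hat_tendsto:
  assumes f: "filterlim f at_top sequentially"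
    and d1: "\<And>g r. g < G \<Longrightarrow> r < M \<Longrightarrow> (\<lambda>j. dev1 g r (f j) (w j)) \<longlonglongrightarrow> 0"
    and d2: "\<And>g r. g < G \<Longrightarrow> r < M \<Longrightarrow> (\<lambda>j. dev2 g r (f j) (w j)) \<longlonglongrightarrow> 0"
    and q: "\<And>r. r < M \<Longrightarrow> (\<lambda>j. q j r) \<longlonglongrightarrow> p0 r"
  shows "(\<lambda>j. vt_hat (q j) (f j) (w j)) \<longlonglongrightarrow> vstar"
proof -
  have "(\<lambda>j. vt_hat_group (q j) (f j) (w j) g) \<longlonglongrightarrow> vt g" if g: "g < G" for g
  proof -
    have top: "filterlim (\<lambda>j. real (Ns (f j) g)) at_top sequentially"
      by (rule filterlim_compose[OF Ns_at_top[OF g] f])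
    have "(\<lambda>j. 1 / (1 - inverse (real (Ns (f j) g)))) \<longlonglongrightarrow> 1 / (1 - 0)"
      by (intro tendsto_intros tendsto_inverse_0_at_top[OF top]) auto
    moreover have "\<forall>\<^sub>F j in sequentially. 1 / (1 - inverse (real (Ns (f j) g))) = real (Ns (f j) g) / (real (Ns (f j) g) - 1)"
      using top[unfolded filterlim_at_top_dense, rule_format, of 1] by eventually_elim (simp add: field_simps)
    ultimately have 1: "(\<lambda>j. real (Ns (f j) g) / (real (Ns (f j) g) - 1)) \<longlonglongrightarrow> 1"
      using Lim_transform_eventually by fastforce
    have "(\<lambda>j. real (Ns (f j) g) / (real (Ns (f j) g) - 1) * (real (n g) / (real M - 1)
      * (\<Sum>r<M. 1 / q j r * (varc g r + dev2 g r (f j) (w j) - (dev1 g r (f j) (w j))\<^sup>2))))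
      \<longlonglongrightarrow> 1 * (real (n g) / (real M - 1) * (\<Sum>r<M. 1 / p0 r * (varc g r + 0 - 0\<^sup>2)))"
      by (intro tendsto_intros 1 d1[OF g] d2[OF g] q) (use pm_pos[of \<theta>0] in \<open>auto simp: less_imp_neq[symmetric]\<close>)
    \<comment> \<open>Dividing the cell variances by \<open>p0 r\<close> leaves multiples of
      \<open>1 - p0 r\<close>, which sum to \<open>M - 1\<close>; the normalisation of the estimator
      cancels exactly this.\<close>
    also have "1 * (real (n g) / (real M - 1) * (\<Sum>r<M. 1 / p0 r * (varc g r + 0 - 0\<^sup>2))) = vt g"
    proof -
      have "1 / p0 r * (varc g r + 0 - 0\<^sup>2) = vt g / real (n g) * (1 - p0 r)" for r
        using pm_pos[of \<theta>0 r] by (simp add: varc_def)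
      hence "(\<Sum>r<M. 1 / p0 r * (varc g r + 0 - 0\<^sup>2)) = vt g / real (n g) * (\<Sum>r<M. 1 - p0 r)"
        by (simp only: sum_distrib_left)
      also have "(\<Sum>r<M. 1 - p0 r) = real M - 1" by (simp add: sum_subtractf pm_sum)
      finally have "(\<Sum>r<M. 1 / p0 r * (varc g r + 0 - 0\<^sup>2)) = vt g / real (n g) * (real M - 1)" .
      thus ?thesis using M_ge n_ge2[OF g] by simp
    qed
    finally show ?thesis
    proof (rule Lim_transform_eventually)
      have "\<forall>\<^sub>F j in sequentially. real (Ns (f j) g) > 0" using top[unfolded filterlim_at_top_dense] by blast
      thus "\<forall>\<^sub>F j in sequentially. real (Ns (f j) g) / (real (Ns (f j) g) - 1) * (real (n g) / (real M - 1)
        * (\<Sum>r<M. 1 / q j r * (varc g r + dev2 g r (f j) (w j) - (dev1 g r (f j) (w j))\<^sup>2))) = vt_hat_group (q j) (f j) (w j) g"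
        by eventually_elim (use vt_hat_group_eq[OF _ g] in auto)
    qed
  qed
  moreover have "(\<lambda>j. real (Ns (f j) g) / S (f j)) \<longlonglongrightarrow> cstar g" if "g < G" for g
    by (rule filterlim_compose[OF Ns_ratio[OF that] f])
  ultimately have "(\<lambda>j. \<Sum>g<G. real (n g) * (real (Ns (f j) g) / S (f j)) * vt_hat_group (q j) (f j) (w j) g)
     \<longlonglongrightarrow> (\<Sum>g<G. real (n g) * cstar g * vt g)"
    by (intro tendsto_intros) auto
  thus ?thesis by (simp add: vt_hat_def vstar_def)
qed

lemma dev_measurable:
  assumes "g < G" "r < M"
  shows "dev1 g r N \<in> borel_measurable \<Omega>" "dev2 g r N \<in> borel_measurable \<Omega>"
proof -
  have [measurable]: "(\<lambda>\<omega>. real (Y g l \<omega> r)) \<in> borel_measurable \<Omega>" for l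
    using Y_coord_measurable[OF assms] .
  show "dev1 g r N \<in> borel_measurable \<Omega>" "dev2 g r N \<in> borel_measurable \<Omega>"
    unfolding dev1_def[abs_def] dev2_def[abs_def] by measurable
qed

lemma phat_sum:
  assumes "N > 0" "\<omega> \<in> space \<Omega>" shows "(\<Sum>r<M. phat N \<omega> r) = 1"
proof -
  have "(\<Sum>r<M. \<Sum>g<G. \<Sum>l<Ns N g. Y g l \<omega> r) = (\<Sum>g<G. \<Sum>r<M. \<Sum>l<Ns N g. Y g l \<omega> r)"
    by (rule sum.swap)
  also have "\<dots> = (\<Sum>g<G. \<Sum>l<Ns N g. \<Sum>r<M. Y g l \<omega> r)"
    by (intro sum.cong refl sum.swap)
  also have "\<dots> = (\<Sum>g<G. n g * Ns N g)" using assms by (simp add: Y_sum mult.commute)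
  finally have "real (\<Sum>r<M. \<Sum>g<G. \<Sum>l<Ns N g. Y g l \<omega> r) = S N" unfolding S_def by simp
  thus ?thesis
    using S_pos[OF assms(1)] unfolding phat_def sum_divide_distrib[symmetric] of_nat_sum[symmetric] by simp
qed

section \<open>The test statistic and its limit law\<close>

definition statistic :: "(real \<Rightarrow> real) \<Rightarrow> (nat \<Rightarrow> 'a \<Rightarrow> nat \<Rightarrow> real) \<Rightarrow> nat \<Rightarrow> 'a \<Rightarrow> real" where
  "statistic \<phi> th N \<omega> = 2 * S N / deriv (deriv \<phi>) 1 * phidiv \<phi> M (phat N \<omega>) (pm (th N \<omega>))
     / vt_hat (pm (th N \<omega>)) N \<omega>"

lemma sum_Z_square:
  "S N * (\<Sum>i<k. (dotp M (b i) (\<lambda>r. (phat N \<omega> r - p0 r) / sqrt (p0 r)))\<^sup>2) = vstar * (\<Sum>i<k. (Z b N i \<omega>)\<^sup>2)"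
  using vstar_pos S_nonneg[of N] by (simp add: Z_def power_mult_distrib power_divide sum_distrib_left)

text \<open>The tight quantities are the scaled deviations of \<open>phat\<close>, the vanishing
  ones the moment errors \<open>dev1\<close> and \<open>dev2\<close>. Along a selected sequence the
  frequencies then satisfy the deterministic hypotheses of the model section.\<close>

lemma statistic_null_in_prob:
  fixes th :: "nat \<Rightarrow> 'a \<Rightarrow> nat \<Rightarrow> real"
  assumes bC: "tangent_complement b C" and \<phi>1: "admissible \<phi>1" and \<phi>2: "admissible \<phi>2"
    and th: "\<And>N \<omega>. (\<exists>\<theta>. \<forall>\<theta>'. phidiv \<phi>2 M (phat N \<omega>) (pm \<theta>) \<le> phidiv \<phi>2 M (phat N \<omega>) (pm \<theta>')) \<Longrightarrow>
        (\<forall>\<theta>'. phidiv \<phi>2 M (phat N \<omega>) (pm (th N \<omega>)) \<le> phidiv \<phi>2 M (phat N \<omega>) (pm \<theta>'))"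
  shows "null_in_prob (\<lambda>N \<omega>. statistic \<phi>1 th N \<omega> - (\<Sum>i<dof. (Z b N i \<omega>)\<^sup>2))"
proof (rule null_in_prob_by_selection[where A="{..<M}" and B="{..<G} \<times> {..<M} \<times> (UNIV :: bool set)"
      and R="\<lambda>r N \<omega>. sqrt (S N) * (phat N \<omega> r - p0 r)"
      \<comment> \<open>The boolean merges the two families of moment errors into one index
        set.\<close>
      and D="\<lambda>(g, r, first). if first then dev1 g r else dev2 g r"])
  show "finite {..<M}" "finite ({..<G} \<times> {..<M} \<times> (UNIV :: bool set))" by auto
  show "(\<lambda>\<omega>. sqrt (S N) * (phat N \<omega> r - p0 r)) \<in> borel_measurable \<Omega>" if "r \<in> {..<M}" for r N
    using that by (intro borel_measurable_times borel_measurable_diff borel_measurable_const phat_measurable) auto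
  show "(case i of (g, r, first) \<Rightarrow> if first then dev1 g r else dev2 g r) N \<in> borel_measurable \<Omega>"
    if "i \<in> {..<G} \<times> {..<M} \<times> UNIV" for i N
    using that dev_measurable by (auto split: prod.splits)
  show "null_in_prob (case i of (g, r, first) \<Rightarrow> if first then dev1 g r else dev2 g r)"
    if "i \<in> {..<G} \<times> {..<M} \<times> UNIV" for i
    using that dev1_null dev2_null by (auto split: prod.splits)
  show "\<exists>K. \<forall>\<^sub>F N in sequentially. prob {\<omega> \<in> space \<Omega>. \<bar>sqrt (S N) * (phat N \<omega> r - p0 r)\<bar> \<ge> K} \<le> e"
    if "r \<in> {..<M}" "e > 0" for r e
    using phat_tight that by auto
  fix K :: "nat \<Rightarrow> real" and f :: "nat \<Rightarrow> nat" and w :: "nat \<Rightarrow> 'a"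
  assume f: "filterlim f at_top sequentially" and fpos: "\<And>j. f j > 0" and w: "\<And>j. w j \<in> space \<Omega>"
    and R: "\<And>r j. r \<in> {..<M} \<Longrightarrow> \<bar>sqrt (S (f j)) * (phat (f j) (w j) r - p0 r)\<bar> \<le> K r"
    and D: "\<And>i. i \<in> {..<G} \<times> {..<M} \<times> UNIV \<Longrightarrow> (\<lambda>j. (case i of (g, r, first) \<Rightarrow> if first then dev1 g r else dev2 g r) (f j) (w j)) \<longlonglongrightarrow> 0"
  define x where "x j = phat (f j) (w j)" for j
  define \<theta> where "\<theta> j = th (f j) (w j)" for j
  define Sf where "Sf j = S (f j)" for j
  define KK where "KK = (\<Sum>r<M. \<bar>K r\<bar>)"
  have St: "filterlim Sf at_top sequentially" unfolding Sf_def by (rule filterlim_compose[OF S_at_top f])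
  have S0: "Sf j \<ge> 0" for j by (simp add: Sf_def S_nonneg)
  have bd: "\<bar>sqrt (Sf j) * (x j r - p0 r)\<bar> \<le> KK" if r: "r < M" for j r
  proof -
    have "\<bar>sqrt (Sf j) * (x j r - p0 r)\<bar> \<le> K r" using R[of r j] r by (simp add: Sf_def x_def)
    also have "\<dots> \<le> \<bar>K r\<bar>" by simp
    also have "\<dots> \<le> KK" unfolding KK_def using r by (intro member_le_sum[of r "{..<M}" "\<lambda>r. \<bar>K r\<bar>"]) auto
    finally show ?thesis .
  qed
  have xsum: "(\<Sum>r<M. x j r) = 1" for j unfolding x_def by (rule phat_sum[OF fpos w])
  have x_lim: "\<forall>r<M. (\<lambda>j. x j r) \<longlonglongrightarrow> p0 r"
    using bd by (intro allI impI tendsto_of_sqrt_rate[OF St])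
  \<comment> \<open>\<open>th\<close> minimises only where a minimiser exists; along the selected
    sequence existence is eventually guaranteed.\<close>
  have min: "\<forall>\<^sub>F j in sequentially. \<forall>\<theta>'. phidiv \<phi>2 M (x j) (pm (\<theta> j)) \<le> phidiv \<phi>2 M (x j) (pm \<theta>')"
    using eventually_minimiser_exists[OF \<phi>2 x_lim]
    by eventually_elim (use th in \<open>auto simp: x_def \<theta>_def\<close>)
  have q: "(\<lambda>j. pm (\<theta> j) r) \<longlonglongrightarrow> p0 r" if "r < M" for r
    by (rule minimiser_consistent[OF \<phi>2 x_lim min that])
  define T where "T j = Sf j * (2 / deriv (deriv \<phi>1) 1 * phidiv \<phi>1 M (x j) (pm (\<theta> j)))" for j
  define d where "d j = Sf j * (\<Sum>i<dof. (dotp M (b i) (\<lambda>r. (x j r - p0 r) / sqrt (p0 r)))\<^sup>2)" for j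
  have Td: "(\<lambda>j. T j - d j) \<longlonglongrightarrow> 0"
    unfolding T_def d_def by (rule divergence_statistic_asymptotics[OF bC St S0 bd xsum \<phi>1 \<phi>2 min])
  have vth: "(\<lambda>j. vt_hat (pm (\<theta> j)) (f j) (w j)) \<longlonglongrightarrow> vstar"
  proof (rule vt_hat_tendsto[OF f _ _ q])
    show "(\<lambda>j. dev1 g r (f j) (w j)) \<longlonglongrightarrow> 0" if "g < G" "r < M" for g r using D[of "(g, r, True)"] that by simp
    show "(\<lambda>j. dev2 g r (f j) (w j)) \<longlonglongrightarrow> 0" if "g < G" "r < M" for g r using D[of "(g, r, False)"] that by simp
  qed
  have "\<bar>d j\<bar> \<le> (\<Sum>r<M. KK\<^sup>2 / p0 r)" for j
  proof -
    let ?y = "\<lambda>r. (x j r - p0 r) / sqrt (p0 r)"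
    have "d j \<le> Sf j * dotp M ?y ?y"
      unfolding d_def using bC S0 unfolding tangent_complement_def by (intro mult_left_mono bessel) blast+
    also have "\<dots> = (\<Sum>r<M. (sqrt (Sf j) * (x j r - p0 r))\<^sup>2 / p0 r)"
      unfolding dotp_def sum_distrib_left
    proof (rule sum.cong[OF refl])
      fix r
      show "Sf j * (?y r * ?y r) = (sqrt (Sf j) * (x j r - p0 r))\<^sup>2 / p0 r"
        using S0[of j] pm_pos[of \<theta>0 r] by (simp add: power_mult_distrib) (simp add: power2_eq_square)
    qed
    also have "\<dots> \<le> (\<Sum>r<M. KK\<^sup>2 / p0 r)"
    proof (rule sum_mono)
      fix r assume "r \<in> {..<M}"
      hence "(\<bar>sqrt (Sf j) * (x j r - p0 r)\<bar>)\<^sup>2 \<le> KK\<^sup>2" using bd by (intro power_mono) auto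
      thus "(sqrt (Sf j) * (x j r - p0 r))\<^sup>2 / p0 r \<le> KK\<^sup>2 / p0 r"
        using pm_pos[of \<theta>0 r] by (intro divide_right_mono) auto
    qed
    finally have "d j \<le> (\<Sum>r<M. KK\<^sup>2 / p0 r)" .
    moreover have "d j \<ge> 0" unfolding d_def using S0 by (intro mult_nonneg_nonneg sum_nonneg) auto
    ultimately show ?thesis by simp
  qed
  hence db: "\<forall>\<^sub>F j in sequentially. \<bar>d j\<bar> \<le> (\<Sum>r<M. KK\<^sup>2 / p0 r)" by (intro always_eventually) auto
  have v0: "vstar \<noteq> 0" using vstar_pos by simp
  have "(\<lambda>j. 1 / vt_hat (pm (\<theta> j)) (f j) (w j) - 1 / vstar) \<longlonglongrightarrow> 1 / vstar - 1 / vstar"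
    by (intro tendsto_intros vth v0)
  hence "(\<lambda>j. 1 / vt_hat (pm (\<theta> j)) (f j) (w j) - 1 / vstar) \<longlonglongrightarrow> 0" by simp
  from null_mult_bounded[OF this db]
  have "(\<lambda>j. (T j - d j) / vt_hat (pm (\<theta> j)) (f j) (w j)
      + (1 / vt_hat (pm (\<theta> j)) (f j) (w j) - 1 / vstar) * d j) \<longlonglongrightarrow> 0 / vstar + 0"
    by (intro tendsto_intros Td vth v0)
  \<comment> \<open>The difference splits into the error of the divergence and the error of the
    design effect; the latter is multiplied by \<open>d j\<close>, which is why \<open>d\<close> had
    to be bounded.\<close>
  moreover have "statistic \<phi>1 th (f j) (w j) - (\<Sum>i<dof. (Z b (f j) i (w j))\<^sup>2)
      = (T j - d j) / vt_hat (pm (\<theta> j)) (f j) (w j) + (1 / vt_hat (pm (\<theta> j)) (f j) (w j) - 1 / vstar) * d j" for j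
  proof -
    have "d j = vstar * (\<Sum>i<dof. (Z b (f j) i (w j))\<^sup>2)"
      unfolding d_def Sf_def x_def by (rule sum_Z_square)
    hence "(\<Sum>i<dof. (Z b (f j) i (w j))\<^sup>2) = d j / vstar" using v0 by simp
    moreover have "2 * S (f j) / deriv (deriv \<phi>1) 1 * phidiv \<phi>1 M (phat (f j) (w j)) (pm (th (f j) (w j))) = T j"
      by (simp add: T_def Sf_def x_def \<theta>_def)
    ultimately show ?thesis
      unfolding statistic_def \<theta>_def[symmetric] by (simp add: left_diff_distrib diff_divide_distrib)
  qed
  ultimately show "(\<lambda>j. statistic \<phi>1 th (f j) (w j) - (\<Sum>i<dof. (Z b (f j) i (w j))\<^sup>2)) \<longlonglongrightarrow> 0" by simp
qed

lemma statistic_measurable: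
  fixes th :: "nat \<Rightarrow> 'a \<Rightarrow> nat \<Rightarrow> real"
  assumes \<phi>1: "admissible \<phi>1" and th: "\<And>s. (\<lambda>\<omega>. th N \<omega> s) \<in> borel_measurable \<Omega>"
  shows "statistic \<phi>1 th N \<in> borel_measurable \<Omega>"
proof -
  note [measurable] = th
  have pm: "(\<lambda>\<omega>. pm (th N \<omega>) r) \<in> borel_measurable \<Omega>" for r unfolding pmodel_def by measurable
  have Ym: "(\<lambda>\<omega>. real (Y g l \<omega> r)) \<in> borel_measurable \<Omega>" if "g < G" "r < M" for g l r
    using Y_coord_measurable[OF that] .
  have "(\<lambda>\<omega>. phidiv \<phi>1 M (phat N \<omega>) (pm (th N \<omega>))) \<in> borel_measurable \<Omega>"
    unfolding phidiv_def
  proof (intro borel_measurable_sum borel_measurable_times pm admissible_measurable_nonneg[OF \<phi>1])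
    fix r assume "r \<in> {..<M}"
    thus "(\<lambda>\<omega>. phat N \<omega> r / pm (th N \<omega>) r) \<in> borel_measurable \<Omega>"
      by (intro borel_measurable_divide pm phat_measurable) auto
    show "0 \<le> phat N \<omega> r / pm (th N \<omega>) r" for \<omega>
      using pm_pos[of "th N \<omega>" r] S_nonneg[of N] unfolding phat_def
      by (intro divide_nonneg_nonneg of_nat_0_le_iff) auto
  qed
  moreover have "(\<lambda>\<omega>. vt_hat (pm (th N \<omega>)) N \<omega>) \<in> borel_measurable \<Omega>"
    unfolding vt_hat_def vt_hat_group_def of_nat_sum
    by (intro borel_measurable_sum borel_measurable_times borel_measurable_divide borel_measurable_power
        borel_measurable_diff borel_measurable_const pm Ym) auto
  ultimately show ?thesis
    unfolding statistic_def[abs_def] by (intro borel_measurable_divide borel_measurable_times borel_measurable_const)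
qed

theorem statistic_weak_conv:
  fixes th :: "nat \<Rightarrow> 'a \<Rightarrow> nat \<Rightarrow> real"
  assumes \<phi>1: "admissible \<phi>1" and \<phi>2: "admissible \<phi>2"
    and th_meas: "\<And>N s. (\<lambda>\<omega>. th N \<omega> s) \<in> borel_measurable \<Omega>"
    and th: "\<And>N \<omega>. (\<exists>\<theta>. \<forall>\<theta>'. phidiv \<phi>2 M (phat N \<omega>) (pm \<theta>) \<le> phidiv \<phi>2 M (phat N \<omega>) (pm \<theta>')) \<Longrightarrow>
        (\<forall>\<theta>'. phidiv \<phi>2 M (phat N \<omega>) (pm (th N \<omega>)) \<le> phidiv \<phi>2 M (phat N \<omega>) (pm \<theta>'))"
  shows "weak_conv_m (\<lambda>N. distr \<Omega> borel (statistic \<phi>1 th N)) (chi2 dof)"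
proof -
  \<comment> \<open>A positive number of degrees of freedom makes \<open>chi2 dof\<close> a
    probability law.\<close>
  have k: "dof \<ge> 1" using M0_less by simp
  obtain b C where bC: "tangent_complement b C" using ex_tangent_complement by blast
  have meas: "statistic \<phi>1 th N \<in> borel_measurable \<Omega>" for N by (rule statistic_measurable[OF \<phi>1 th_meas])
  have Zm: "(\<lambda>\<omega>. \<Sum>i<dof. (Z b N i \<omega>)\<^sup>2) \<in> borel_measurable \<Omega>" for N
    by (intro borel_measurable_sum borel_measurable_power Z_measurable)
  show ?thesis
  proof (rule integral_cts_step_conv_imp_weak_conv[OF _ real_distribution_chi2[OF k]])
    show "real_distribution (distr \<Omega> borel (statistic \<phi>1 th N))" for N using meas by (rule real_distribution_distr)
    fix c d :: real assume cd: "c < d"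
    have "(\<lambda>N. expectation (\<lambda>\<omega>. cts_step c d (\<Sum>i<dof. (Z b N i \<omega>)\<^sup>2))) \<longlonglongrightarrow> (\<integral>x. cts_step c d x \<partial>chi2 dof)"
      by (rule square_norm_cts_step_tendsto_chi2[OF Z_measurable k Z_char_tendsto[OF bC] cd])
    from cts_step_slutsky[OF meas Zm statistic_null_in_prob[OF bC \<phi>1 \<phi>2 th] cd this]
    have "(\<lambda>N. expectation (\<lambda>\<omega>. cts_step c d (statistic \<phi>1 th N \<omega>))) \<longlonglongrightarrow> (\<integral>x. cts_step c d x \<partial>chi2 dof)" .
    moreover have "cts_step c d \<in> borel_measurable borel" using cd by (auto simp: cts_step_def[abs_def])
    hence "integral\<^sup>L (distr \<Omega> borel (statistic \<phi>1 th N)) (cts_step c d) = expectation (\<lambda>\<omega>. cts_step c d (statistic \<phi>1 th N \<omega>))" for N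
      by (intro integral_distr meas)
    ultimately show "(\<lambda>N. integral\<^sup>L (distr \<Omega> borel (statistic \<phi>1 th N)) (cts_step c d)) \<longlonglongrightarrow> integral\<^sup>L (chi2 dof) (cts_step c d)" by simp
  qed
qed

end

text \<open>\<open>\<theta>hat_min\<close> demands minimality only at outcomes where the minimum is
  attained, because attainment at every outcome cannot be taken for granted. Elsewhere
  \<open>\<theta>hat\<close> is free apart from being measurable; such outcomes have asymptotically
  negligible influence.\<close>

theorem theorem7:
  fixes M M0 G :: nat
    and W :: "nat \<Rightarrow> nat \<Rightarrow> real"
    and \<theta>0 :: "nat \<Rightarrow> real"
    and rho2 :: real
    and n :: "nat \<Rightarrow> nat"
    and Ns :: "nat \<Rightarrow> nat \<Rightarrow> nat"
    and Nstar :: "nat \<Rightarrow> real"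
    and \<Omega> :: "'a measure"
    and Y :: "nat \<Rightarrow> nat \<Rightarrow> 'a \<Rightarrow> nat \<Rightarrow> nat"
    and \<phi>1 \<phi>2 :: "real \<Rightarrow> real"
    and \<theta>hat :: "nat \<Rightarrow> 'a \<Rightarrow> nat \<Rightarrow> real"
  assumes M: "M \<ge> 3" and M0: "1 \<le> M0" "M0 < M - 1"
    and W_indep: "\<And>a c. (\<forall>r<M. a + (\<Sum>s<M0. W r s * c s) = 0) \<Longrightarrow> a = 0 \<and> (\<forall>s<M0. c s = 0)"
    and G: "G \<ge> 1"
    and n_ge2: "\<And>g. g < G \<Longrightarrow> n g \<ge> 2"
    and n_distinct: "inj_on n {..<G}"
    and N_sum: "\<And>N. (\<Sum>g<G. Ns N g) = N"
    and N_lim: "\<And>g. g < G \<Longrightarrow> (\<lambda>N. real (Ns N g) / real N) \<longlonglongrightarrow> Nstar g"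
    and Nstar: "\<And>g. g < G \<Longrightarrow> 0 < Nstar g \<and> Nstar g \<le> 1"
    and P: "prob_space \<Omega>"
    and Y_meas: "\<And>g l. g < G \<Longrightarrow>
        (\<lambda>\<omega>. restrict (Y g l \<omega>) {..<M}) \<in> measurable \<Omega> (Pi\<^sub>M {..<M} (\<lambda>_. count_space UNIV))"
    and Y_indep: "prob_space.indep_vars \<Omega> (\<lambda>_. Pi\<^sub>M {..<M} (\<lambda>_. count_space UNIV))
        (\<lambda>(g, l) \<omega>. restrict (Y g l \<omega>) {..<M}) ({..<G} \<times> UNIV)"
    and Y_ident: "\<And>g l. g < G \<Longrightarrow>
        distr \<Omega> (Pi\<^sub>M {..<M} (\<lambda>_. count_space UNIV)) (\<lambda>\<omega>. restrict (Y g l \<omega>) {..<M})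
      = distr \<Omega> (Pi\<^sub>M {..<M} (\<lambda>_. count_space UNIV)) (\<lambda>\<omega>. restrict (Y g 0 \<omega>) {..<M})"
    and Y_sum: "\<And>g l \<omega>. g < G \<Longrightarrow> \<omega> \<in> space \<Omega> \<Longrightarrow> (\<Sum>r<M. Y g l \<omega> r) = n g"
    and Y_mean: "\<And>g l r. g < G \<Longrightarrow> r < M \<Longrightarrow>
        prob_space.expectation \<Omega> (\<lambda>\<omega>. real (Y g l \<omega> r)) = real (n g) * pmodel M M0 W \<theta>0 r"
    and rho2: "rho2 \<ge> 0"
    and Y_cov: "\<And>g l r s. g < G \<Longrightarrow> r < M \<Longrightarrow> s < M \<Longrightarrow>
        prob_space.expectation \<Omega>
          (\<lambda>\<omega>. (real (Y g l \<omega> r) - real (n g) * pmodel M M0 W \<theta>0 r)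
              * (real (Y g l \<omega> s) - real (n g) * pmodel M M0 W \<theta>0 s))
        = (1 + (real (n g) - 1) * rho2) * real (n g)
          * ((if r = s then pmodel M M0 W \<theta>0 r else 0) - pmodel M M0 W \<theta>0 r * pmodel M M0 W \<theta>0 s)"
    and \<phi>1: "admissible \<phi>1" and \<phi>2: "admissible \<phi>2"
    and \<theta>hat_meas: "\<And>N s. (\<lambda>\<omega>. \<theta>hat N \<omega> s) \<in> borel_measurable \<Omega>"
    and \<theta>hat_min: "\<And>N \<omega>.
        (\<exists>\<theta>. \<forall>\<theta>'.
            dphi \<phi>2 M (\<lambda>r. real (\<Sum>g<G. \<Sum>l<Ns N g. Y g l \<omega> r) / real (\<Sum>h<G. n h * Ns N h)) (pmodel M M0 W \<theta>)
          \<le> dphi \<phi>2 M (\<lambda>r. real (\<Sum>g<G. \<Sum>l<Ns N g. Y g l \<omega> r) / real (\<Sum>h<G. n h * Ns N h)) (pmodel M M0 W \<theta>'))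
        \<Longrightarrow> (\<forall>\<theta>'.
            dphi \<phi>2 M (\<lambda>r. real (\<Sum>g<G. \<Sum>l<Ns N g. Y g l \<omega> r) / real (\<Sum>h<G. n h * Ns N h)) (pmodel M M0 W (\<theta>hat N \<omega>))
          \<le> dphi \<phi>2 M (\<lambda>r. real (\<Sum>g<G. \<Sum>l<Ns N g. Y g l \<omega> r) / real (\<Sum>h<G. n h * Ns N h)) (pmodel M M0 W \<theta>'))"
  shows "weak_conv_m
    (\<lambda>N. distr \<Omega> borel (\<lambda>\<omega>.
       let S = real (\<Sum>h<G. n h * Ns N h);
           phat = (\<lambda>r. real (\<Sum>g<G. \<Sum>l<Ns N g. Y g l \<omega> r) / S);
           pth = pmodel M M0 W (\<theta>hat N \<omega>);
           T = 2 * S / deriv (deriv \<phi>1) 1 * real_of_ereal (dphi \<phi>1 M phat pth);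
           phat_gl = (\<lambda>g l r. real (Y g l \<omega> r) / real (n g));
           phat_g = (\<lambda>g r. real (\<Sum>l<Ns N g. Y g l \<omega> r) / (real (n g) * real (Ns N g)));
           w = (\<lambda>g. real (n g) * real (Ns N g) / S);
           vt_g = (\<lambda>g. real (n g) / ((real (Ns N g) - 1) * (real M - 1))
                    * (\<Sum>r<M. 1 / pth r * (\<Sum>l<Ns N g. (phat_gl g l r - phat_g g r)\<^sup>2)));
           vt = (\<Sum>g<G. w g * vt_g g)
       in T / vt))
    (chi2 (M - M0 - 1))"
proof -
  interpret prob_space \<Omega> by (rule P)
  have "loglinear M M0 W"
    by (unfold_locales) (use M W_indep in auto)
  then interpret loglinear M M0 W \<theta>0 .
  interpret cluster_sample M M0 W \<theta>0 \<Omega> G n Ns Nstar Y rho2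
    by unfold_locales (use M M0(2) G n_ge2 N_sum N_lim Nstar Y_meas Y_indep Y_sum Y_mean rho2 Y_cov in auto)
  have phat_eq: "phat N \<omega> = (\<lambda>r. real (\<Sum>g<G. \<Sum>l<Ns N g. Y g l \<omega> r) / real (\<Sum>h<G. n h * Ns N h))" for N \<omega>
    by (intro ext) (simp only: phat_def S_def)
  have "weak_conv_m (\<lambda>N. distr \<Omega> borel (statistic \<phi>1 \<theta>hat N)) (chi2 (M - M0 - 1))"
  proof (rule statistic_weak_conv[OF \<phi>1 \<phi>2 \<theta>hat_meas])
    fix N \<omega> assume "\<exists>\<theta>. \<forall>\<theta>'. phidiv \<phi>2 M (phat N \<omega>) (pm \<theta>) \<le> phidiv \<phi>2 M (phat N \<omega>) (pm \<theta>')"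
    thus "\<forall>\<theta>'. phidiv \<phi>2 M (phat N \<omega>) (pm (\<theta>hat N \<omega>)) \<le> phidiv \<phi>2 M (phat N \<omega>) (pm \<theta>')"
      using \<theta>hat_min[where N=N and \<omega>=\<omega>, folded phat_eq, unfolded dphi_eq_phidiv ereal_less_eq] by blast
  qed
  thus ?thesis
    unfolding Let_def statistic_def[abs_def] vt_hat_def vt_hat_group_def phat_eq S_def dphi_eq_phidiv real_of_ereal.simps .
qed

end
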